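(* Let $\Omega\subset\mathbb{R}^n$ be a bounded domain with $C^2$ boundary, $1<q\le p<\infty$, $s\in(0,1)$, $\delta>0$, $\beta\ge p$, and let $f\in L^\infty_{\mathrm{loc}}(\Omega)$, $f\ge0$, satisfy $c_1d(x)^{-\beta}\le f(x)\le c_2d(x)^{-\beta}$ for $x\in\Omega$ with $d(x)<\rho$, for some constants $c_1,c_2,\rho>0$, where $d(x)=\operatorname{dist}(x,\partial\Omega)$. Then there does not exist any weak solution of $$-\Delta_pu+(-\Delta)^s_qu=f(x)u^{-\delta}\ \text{in }\Omega,\qquad u>0\ \text{in }\Omega,\qquad u=0\ \text{in }\mathbb{R}^n\setminus\Omega .$$
   Context: Weak solution: $u\in W^{1,p}_{\mathrm{loc}}(\Omega)$ (with $u=0$ outside $\Omega$) such that $u>0$ in $\Omega$, $fu^{-\delta}\in L^1_{\mathrm{loc}}(\Omega)$, there exists $\gamma\ge1$ with $u^\gamma\in W^{1,p}_0(\Omega)$, and for all $\phi\in C_c^\infty(\Omega)$ $$\int_\Omega|\nabla u|^{p-2}\nabla u\cdot\nabla\phi+\int_{\mathbb{R}^n}\int_{\mathbb{R}^n}\frac{|u(x)-u(y)|^{q-2}(u(x)-u(y))(\phi(x)-\phi(y))}{|x-y|^{n+sq}}dx\,dy=\int_\Omega fu^{-\delta}\phi .$$ *)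

theory Defs
  imports "HOL-Analysis.Analysis"
begin

text \<open>Functions on the whole space that are \<open>k\<close> times continuously differentiable.\<close>

primrec Ck :: "nat \<Rightarrow> ('a::euclidean_space \<Rightarrow> real) \<Rightarrow> bool" where
  "Ck 0 f \<longleftrightarrow> continuous_on UNIV f"
| "Ck (Suc k) f \<longleftrightarrow> (\<forall>x. f differentiable at x) \<and>
     (\<forall>v. Ck k (\<lambda>x. frechet_derivative f (at x) v))"

definition gradient :: "('a::euclidean_space \<Rightarrow> real) \<Rightarrow> 'a \<Rightarrow> 'a" where
  "gradient f x = (\<Sum>i\<in>Basis. frechet_derivative f (at x) i *\<^sub>R i)"

definition test_functions :: "'a::euclidean_space set \<Rightarrow> ('a \<Rightarrow> real) set" where
  "test_functions \<Omega> = {\<phi>. (\<forall>k. Ck k \<phi>) \<and>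
     compact (closure {x. \<phi> x \<noteq> 0}) \<and> closure {x. \<phi> x \<noteq> 0} \<subseteq> \<Omega>}"

text \<open>
  Boundary of class \<open>C\<^sup>k\<close>: near each boundary point, \<open>\<Omega>\<close> is the region above the graph, in some
  unit direction \<open>e\<close>, of a \<open>C\<^sup>k\<close> function of the variables orthogonal to \<open>e\<close>. The function
  \<open>h\<close> is defined on the whole space but evaluated only on the hyperplane orthogonal to \<open>e\<close>;
  a \<open>C\<^sup>k\<close> function on that hyperplane extends to one on the whole space, constant along \<open>e\<close>.
\<close>

definition Ck_boundary :: "nat \<Rightarrow> 'a::euclidean_space set \<Rightarrow> bool" where
  "Ck_boundary k \<Omega> \<longleftrightarrow> (\<forall>x0\<in>frontier \<Omega>. \<exists>r>0. \<exists>e h. norm e = 1 \<and> Ck k h \<and>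
     \<Omega> \<inter> ball x0 r = {x \<in> ball x0 r. h (x - (x \<bullet> e) *\<^sub>R e) < x \<bullet> e})"

text \<open>Lebesgue and Sobolev classes are represented by functions, not by their a.e. classes.\<close>

definition Lp :: "real \<Rightarrow> 'a::euclidean_space set \<Rightarrow> ('a \<Rightarrow> 'b::euclidean_space) set" where
  "Lp p S = {u. u \<in> borel_measurable (lebesgue_on S) \<and>
     integrable (lebesgue_on S) (\<lambda>x. norm (u x) powr p)}"

definition Lp_loc :: "real \<Rightarrow> 'a::euclidean_space set \<Rightarrow> ('a \<Rightarrow> 'b::euclidean_space) set" where
  "Lp_loc p \<Omega> = {u. u \<in> borel_measurable (lebesgue_on \<Omega>) \<and>
     (\<forall>K. compact K \<and> K \<subseteq> \<Omega> \<longrightarrow> u \<in> Lp p K)}"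

definition Linf_loc :: "'a::euclidean_space set \<Rightarrow> ('a \<Rightarrow> real) set" where
  "Linf_loc \<Omega> = {u. u \<in> borel_measurable (lebesgue_on \<Omega>) \<and>
     (\<forall>K. compact K \<and> K \<subseteq> \<Omega> \<longrightarrow> (\<exists>M. AE x in lebesgue_on K. \<bar>u x\<bar> \<le> M))}"

definition has_weak_gradient ::
    "'a::euclidean_space set \<Rightarrow> ('a \<Rightarrow> real) \<Rightarrow> ('a \<Rightarrow> 'a) \<Rightarrow> bool" where
  "has_weak_gradient \<Omega> u Du \<longleftrightarrow> u \<in> Lp_loc 1 \<Omega> \<and> Du \<in> Lp_loc 1 \<Omega> \<and>
     (\<forall>\<phi>\<in>test_functions \<Omega>.
        (LINT x|lebesgue_on \<Omega>. u x *\<^sub>R gradient \<phi> x) =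
        - (LINT x|lebesgue_on \<Omega>. \<phi> x *\<^sub>R Du x))"

definition W1p_loc :: "real \<Rightarrow> 'a::euclidean_space set \<Rightarrow> ('a \<Rightarrow> real) set" where
  "W1p_loc p \<Omega> = {u. u \<in> Lp_loc p \<Omega> \<and> (\<exists>Du. has_weak_gradient \<Omega> u Du \<and> Du \<in> Lp_loc p \<Omega>)}"

definition W1p_norm ::
    "real \<Rightarrow> 'a::euclidean_space set \<Rightarrow> ('a \<Rightarrow> real) \<Rightarrow> ('a \<Rightarrow> 'a) \<Rightarrow> real" where
  "W1p_norm p \<Omega> u Du =
     ((LINT x|lebesgue_on \<Omega>. \<bar>u x\<bar> powr p) + (LINT x|lebesgue_on \<Omega>. norm (Du x) powr p)) powr (1 / p)"

text \<open>The closure of the test functions in \<open>W\<^sup>1\<^sup>,\<^sup>p(\<Omega>)\<close>.\<close>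

definition W1p0 :: "real \<Rightarrow> 'a::euclidean_space set \<Rightarrow> ('a \<Rightarrow> real) set" where
  "W1p0 p \<Omega> = {u. u \<in> Lp p \<Omega> \<and> (\<exists>Du. has_weak_gradient \<Omega> u Du \<and> Du \<in> Lp p \<Omega> \<and>
     (\<exists>\<phi>. (\<forall>k::nat. \<phi> k \<in> test_functions \<Omega>) \<and>
        (\<lambda>k. W1p_norm p \<Omega> (\<lambda>x. u x - \<phi> k x) (\<lambda>x. Du x - gradient (\<phi> k) x)) \<longlonglongrightarrow> 0))}"

definition nonlocal_integrand ::
    "real \<Rightarrow> real \<Rightarrow> ('a::euclidean_space \<Rightarrow> real) \<Rightarrow> ('a \<Rightarrow> real) \<Rightarrow> 'a \<times> 'a \<Rightarrow> real" where
  "nonlocal_integrand q s u \<phi> = (\<lambda>(x, y).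
     \<bar>u x - u y\<bar> powr (q - 2) * (u x - u y) * (\<phi> x - \<phi> y)
       / norm (x - y) powr (real DIM('a) + s * q))"

text \<open>
  Pointwise conditions on \<open>u\<close> are meant almost everywhere. The weak gradient is unique up to null
  sets, so it does not matter which one is taken in the equation. Integrability of the nonlocal
  integrand is stated because a divergent integral has the default value 0; the other two
  integrands are integrable by the first conditions. The conventions \<open>0 powr a = 0\<close> and
  \<open>a / 0 = 0\<close> give the usual value 0 to \<open>|\<xi>|\<^sup>p\<^sup>-\<^sup>2 \<xi>\<close> at \<open>\<xi> = 0\<close>, and otherwise only act on null sets.
\<close>

definition weak_solution ::
    "real \<Rightarrow> real \<Rightarrow> real \<Rightarrow> real \<Rightarrow> 'a::euclidean_space set \<Rightarrow> ('a \<Rightarrow> real) \<Rightarrow> ('a \<Rightarrow> real) \<Rightarrow> bool" where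
  "weak_solution p q s \<delta> \<Omega> f u \<longleftrightarrow>
     u \<in> W1p_loc p \<Omega> \<and>
     (AE x in lebesgue. x \<notin> \<Omega> \<longrightarrow> u x = 0) \<and>
     (AE x in lebesgue. x \<in> \<Omega> \<longrightarrow> u x > 0) \<and>
     (\<lambda>x. f x * u x powr (- \<delta>)) \<in> Lp_loc 1 \<Omega> \<and>
     (\<exists>\<gamma>\<ge>1. (\<lambda>x. u x powr \<gamma>) \<in> W1p0 p \<Omega>) \<and>
     (\<exists>Du. has_weak_gradient \<Omega> u Du \<and>
       (\<forall>\<phi>\<in>test_functions \<Omega>.
          integrable (lebesgue \<Otimes>\<^sub>M lebesgue) (nonlocal_integrand q s u \<phi>) \<and>
          (LINT x|lebesgue_on \<Omega>. norm (Du x) powr (p - 2) * (Du x \<bullet> gradient \<phi> x))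
          + (LINT z|(lebesgue \<Otimes>\<^sub>M lebesgue). nonlocal_integrand q s u \<phi> z)
          = (LINT x|lebesgue_on \<Omega>. f x * u x powr (- \<delta>) * \<phi> x)))"

end

theory Submission
  imports Defs
begin

text \<open>
  Let \<open>u\<close> be a weak solution, \<open>\<psi>\<close> a bump function on a ball of radius \<open>R\<close> in \<open>\<Omega>\<close>, and \<open>m \<ge> p\<close>.
  Testing the equation with \<open>\<psi>\<^sup>m e\<^sup>-\<^sup>u\<close>, the gradient of \<open>e\<^sup>-\<^sup>u\<close> absorbs the gradient of \<open>u\<close> in the local
  term, and a pointwise inequality absorbs the differences of \<open>u\<close> in the nonlocal term, so
  that the integral of \<open>f u\<^sup>-\<^sup>\<delta> e\<^sup>-\<^sup>u \<psi>\<^sup>m\<close> is at most \<open>C R\<^sup>-\<^sup>p\<close> times the volume of the ball. On a Whitney ball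
  at distance about \<open>\<epsilon>\<close> from the boundary, \<open>R\<close> is comparable to \<open>\<epsilon>\<close> and \<open>f \<ge> c \<epsilon>\<^sup>-\<^sup>p\<close> because \<open>\<beta> \<ge> p\<close>.
  Hence the average of \<open>u\<^sup>-\<^sup>\<delta> e\<^sup>-\<^sup>u\<close> is bounded uniformly in \<open>\<epsilon>\<close>, and \<open>u\<close> is bounded below on half of the ball.
  The integral of \<open>u\<^sup>\<gamma>\<^sup>p\<close> over a boundary strip of width \<open>\<epsilon>\<close> is therefore at least of order \<open>\<epsilon>\<close>. But
  \<open>u\<^sup>\<gamma>\<close> is a limit of test functions, which vanish after a translation by \<open>3 \<epsilon>\<close> out of \<open>\<Omega>\<close>, so the same
  integral is \<open>O(\<epsilon>\<^sup>p)\<close>, which is impossible as \<open>p > 1\<close>.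

  The test function is made admissible by mollifying \<open>u\<close>.
\<close>

section \<open>Smooth functions and bump functions\<close>

text \<open>The pointwise bound on the nonlocal integrand contains only the difference of the
  cut-off values, not \<open>u\<close>. Hence no tail of \<open>u\<close> outside the ball survives,
  and neither an upper nor a lower bound for \<open>u\<close> has to be known beforehand. The weight
  exp(-u), in place of a negative power of \<open>u\<close>, makes this possible: it and its
  derivative are bounded, and so is t^(q-1) exp(-t) for t \<ge> 0. The local term costs R^(-p), the
  nonlocal one R^(-q). As R \<le> 1 and q \<le> p, both cost at most R^(-p) up to constants, and the
  lower bound of \<open>f\<close> matches this on a ball whose radius is comparable to its distance
  from the boundary. The equation involves \<open>u\<close>, while a test function must be smooth;
  so \<open>u\<close> is mollified in the test function only. The limit needs the gradients in L^p
  on the ball for the local term and the Gagliardo seminorm of the difference on the ball for the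
  nonlocal one, which the gradients in L^q control.\<close>

lemma Ck_Suc_imp: "Ck (Suc k) f \<Longrightarrow> Ck k f"
proof (induction k arbitrary: f)
  case 0
  then show ?case
    by (auto simp: continuous_on_eq_continuous_within intro!: differentiable_imp_continuous_within)
qed auto

lemma Ck_differentiable: "Ck (Suc k) f \<Longrightarrow> f differentiable (at x)"
  by simp

lemma Ck_const: "Ck k (\<lambda>x. c)"
  by (induction k arbitrary: c) (simp_all add: frechet_derivative_const)

lemma Ck_add: "Ck k f \<Longrightarrow> Ck k g \<Longrightarrow> Ck k (\<lambda>x. f x + g x)"
proof (induction k arbitrary: f g)
  case 0
  then show ?case by (auto intro: continuous_on_add)
next
  case (Suc k)
  have eq: "frechet_derivative (\<lambda>x. f x + g x) (at x) v
      = frechet_derivative f (at x) v + frechet_derivative g (at x) v" for x v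
  proof -
    have "((\<lambda>x. f x + g x) has_derivative
        (\<lambda>v. frechet_derivative f (at x) v + frechet_derivative g (at x) v)) (at x)"
      using Suc.prems by (auto intro!: has_derivative_add simp: frechet_derivative_works)
    from frechet_derivative_at[OF this] show ?thesis by metis
  qed
  show ?case using Suc by (auto simp: eq)
qed

lemma frechet_derivative_mult_real:
  fixes f g :: "'a::real_normed_vector \<Rightarrow> real"
  assumes "f differentiable (at x)" "g differentiable (at x)"
  shows "frechet_derivative (\<lambda>x. f x * g x) (at x) v
      = f x * frechet_derivative g (at x) v + frechet_derivative f (at x) v * g x"
proof -
  have "((\<lambda>x. f x * g x) has_derivative
      (\<lambda>v. f x * frechet_derivative g (at x) v + frechet_derivative f (at x) v * g x)) (at x)"
    using assms by (auto intro!: has_derivative_mult simp: frechet_derivative_works)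
  from frechet_derivative_at[OF this] show ?thesis by metis
qed

lemma Ck_mult: "Ck k f \<Longrightarrow> Ck k g \<Longrightarrow> Ck k (\<lambda>x. f x * g x)"
proof (induction k arbitrary: f g)
  case 0
  then show ?case by (auto intro: continuous_on_mult)
next
  case (Suc k)
  have eq: "frechet_derivative (\<lambda>x. f x * g x) (at x) v
      = f x * frechet_derivative g (at x) v + frechet_derivative f (at x) v * g x" for x v
    using Suc.prems by (subst frechet_derivative_mult_real) auto
  have "Ck k f" "Ck k g"
    using Suc.prems Ck_Suc_imp by blast+
  then show ?case using Suc by (auto simp: eq intro!: Ck_add)
qed

lemma Ck_power: "Ck k f \<Longrightarrow> Ck k (\<lambda>x. f x ^ m)"
  by (induction m) (auto intro: Ck_const Ck_mult)

lemma Ck_sum: "(\<And>i. i \<in> I \<Longrightarrow> Ck k (f i)) \<Longrightarrow> Ck k (\<lambda>x. \<Sum>i\<in>I. f i x)"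
  by (induction I rule: infinite_finite_induct) (auto intro: Ck_const Ck_add)

lemma Ck_inner: "Ck k (\<lambda>x. (x - c) \<bullet> v)"
proof (cases k)
  case 0
  then show ?thesis by (auto intro!: continuous_intros)
next
  case (Suc j)
  have d: "((\<lambda>x. (x - c) \<bullet> v) has_derivative (\<lambda>w. w \<bullet> v)) (at x)" for x
    by (auto intro!: derivative_eq_intros)
  have "frechet_derivative (\<lambda>x. (x - c) \<bullet> v) (at x) w = w \<bullet> v" for x w
    using frechet_derivative_at[OF d[of x]] by metis
  then show ?thesis using Suc d by (auto simp: differentiable_def intro: Ck_const)
qed

text \<open>Demanding the whole chain of derivatives \<open>G\<close> at once lets the induction on
  \<open>k\<close> run with \<open>j\<close> arbitrary: differentiating \<open>G j (f x)\<close>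
  produces \<open>G (Suc j) (f x)\<close> times a derivative of \<open>f\<close>. It serves for
  exp(-t) and for \<open>flat\<close>.\<close>

lemma Ck_chain:
  assumes "\<And>j t. (G j has_real_derivative G (Suc j) t) (at t)" and "Ck k f"
  shows "Ck k (\<lambda>x. G j (f x))"
  using assms(2)
proof (induction k arbitrary: j f)
  case 0
  have "continuous_on UNIV (G j)"
    using assms(1) DERIV_isCont continuous_at_imp_continuous_on by blast
  then show ?case using 0 by (auto intro: continuous_on_compose2)
next
  case (Suc k)
  have d: "((\<lambda>x. G j (f x)) has_derivative (\<lambda>v. G (Suc j) (f x) * frechet_derivative f (at x) v)) (at x)" for x
  proof -
    have "(f has_derivative frechet_derivative f (at x)) (at x)"
      using Suc.prems by (simp add: frechet_derivative_works)
    from has_derivative_compose[OF this assms(1)[of j "f x", unfolded has_field_derivative_def]]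
    show ?thesis .
  qed
  have eq: "frechet_derivative (\<lambda>x. G j (f x)) (at x) v = G (Suc j) (f x) * frechet_derivative f (at x) v" for x v
    using frechet_derivative_at[OF d[of x]] by metis
  have "Ck k f" using Suc.prems Ck_Suc_imp by blast
  then show ?case using Suc d by (auto simp: eq differentiable_def intro!: Ck_mult)
qed

lemma Ck_exp_minus: 
  assumes "Ck k f" shows "Ck k (\<lambda>x. exp (- f x))"
proof -
  have "((\<lambda>t. (-1) ^ j * exp (- t)) has_real_derivative (-1) ^ Suc j * exp (- t)) (at t)" for j and t :: real
    by (auto intro!: derivative_eq_intros)
  from Ck_chain[where G = "\<lambda>j t. (-1) ^ j * exp (- t)" and j = 0, OF this assms]
  show ?thesis by simp
qed

lemma Ck_continuous: "Ck k f \<Longrightarrow> continuous_on S f"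
proof (induction k arbitrary: f)
  case 0
  then show ?case using continuous_on_subset by auto
next
  case (Suc k)
  then show ?case using Ck_Suc_imp by blast
qed

lemma Ck_borel_measurable: "Ck k f \<Longrightarrow> f \<in> borel_measurable borel"
  using Ck_continuous borel_measurable_continuous_onI by blast

lemma gradient_inner:
  fixes f :: "'a::euclidean_space \<Rightarrow> real"
  assumes "f differentiable (at x)"
  shows "gradient f x \<bullet> v = frechet_derivative f (at x) v"
proof -
  have l: "linear (frechet_derivative f (at x))"
    using assms linear_frechet_derivative by blast
  have "frechet_derivative f (at x) v = frechet_derivative f (at x) (\<Sum>i\<in>Basis. (v \<bullet> i) *\<^sub>R i)"
    by (simp add: euclidean_representation)
  also have "\<dots> = (\<Sum>i\<in>Basis. (v \<bullet> i) * frechet_derivative f (at x) i)"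
    using l by (simp add: linear_sum linear_cmul)
  also have "\<dots> = gradient f x \<bullet> v"
    by (simp add: gradient_def inner_sum_left inner_commute[of v] mult.commute)
  finally show ?thesis by simp
qed

lemma gradient_eqI:
  fixes f :: "'a::euclidean_space \<Rightarrow> real"
  assumes "(f has_derivative (\<lambda>v. w \<bullet> v)) (at x)"
  shows "gradient f x = w"
proof -
  have "frechet_derivative f (at x) = (\<lambda>v. w \<bullet> v)"
    using frechet_derivative_at[OF assms] by simp
  then show ?thesis by (simp add: gradient_def euclidean_representation)
qed

lemma has_derivative_gradient:
  fixes f :: "'a::euclidean_space \<Rightarrow> real"
  assumes "f differentiable (at x)"
  shows "(f has_derivative (\<lambda>v. gradient f x \<bullet> v)) (at x)"
  using assms by (simp add: gradient_inner[OF assms] frechet_derivative_works)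

lemma Ck_gradient_continuous:
  assumes "Ck (Suc 0) f" shows "continuous_on S (gradient f)"
  unfolding gradient_def
  using assms by (auto intro!: continuous_intros intro: continuous_on_subset)

text \<open>\<open>flat j\<close> is the \<open>j\<close>-th derivative of \<open>exp (- 1 / t)\<close>, extended by \<open>0\<close> to \<open>t \<le> 0\<close>.\<close>

definition flat_family :: "nat \<Rightarrow> real poly"
  where "flat_family = rec_nat 1 (\<lambda>_ P. [:0, 0, 1:] * (P - pderiv P))"

definition flat :: "nat \<Rightarrow> real \<Rightarrow> real"
  where "flat j t = (if t > 0 then poly (flat_family j) (1 / t) * exp (- (1 / t)) else 0)"

text \<open>The extra power \<open>s ^ k\<close> carries the induction over the coefficients of
  \<open>P\<close>: splitting off the constant term turns the rest into the same expression with
  \<open>Suc k\<close>.\<close>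

lemma power_poly_exp_tendsto_0:
  "((\<lambda>s. s ^ k * poly P s * exp (- s)) \<longlongrightarrow> (0::real)) at_top"
proof (induction P arbitrary: k)
  case 0
  then show ?case by simp
next
  case (pCons a P)
  have "((\<lambda>s. a * (s ^ k / exp s) + s ^ Suc k * poly P s * exp (- s)) \<longlongrightarrow> a * 0 + 0) at_top"
    by (intro tendsto_intros tendsto_power_div_exp_0 pCons.IH)
  then show ?case
    by (rule Lim_transform_eventually[OF _ always_eventually, THEN tendsto_eq_rhs])
      (auto simp: algebra_simps exp_minus divide_inverse)
qed

lemma flat_deriv: "(flat j has_real_derivative flat (Suc j) t) (at t)"
proof -
  consider "t > 0" | "t < 0" | "t = 0" by linarith
  then show ?thesis
  proof cases
    case 1
    let ?P = "flat_family j"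
    have i: "((\<lambda>t. 1 / t) has_real_derivative - (1 / t\<^sup>2)) (at t)"
      using 1 by (auto intro!: derivative_eq_intros simp: power2_eq_square)
    have "((\<lambda>t. poly ?P (1 / t) * exp (- (1 / t))) has_real_derivative
        poly (pderiv ?P) (1 / t) * (- (1 / t\<^sup>2)) * exp (- (1 / t))
        + exp (- (1 / t)) * (- (- (1 / t\<^sup>2))) * poly ?P (1 / t)) (at t)"
      by (intro DERIV_mult DERIV_chain2[OF poly_DERIV i] DERIV_chain2[OF DERIV_exp] DERIV_minus i)
    moreover have "flat (Suc j) t = poly (pderiv ?P) (1 / t) * (- (1 / t\<^sup>2)) * exp (- (1 / t))
        + exp (- (1 / t)) * (- (- (1 / t\<^sup>2))) * poly ?P (1 / t)"
      using 1 by (simp add: flat_def flat_family_def algebra_simps power2_eq_square)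
    ultimately have "((\<lambda>t. poly ?P (1 / t) * exp (- (1 / t))) has_real_derivative flat (Suc j) t) (at t)"
      by simp
    moreover have ev: "eventually (\<lambda>t. poly (flat_family j) (1 / t) * exp (- (1 / t)) = flat j t) (nhds t)"
      using eventually_nhds_in_open[of "{0<..}" t] 1 by (auto elim!: eventually_mono simp: flat_def)
    ultimately show ?thesis using DERIV_cong_ev[OF refl ev refl] by simp
  next
    case 2
    have ev: "eventually (\<lambda>t. 0 = flat j t) (nhds t)"
      using eventually_nhds_in_open[of "{..<0}" t] 2 by (auto elim!: eventually_mono simp: flat_def)
    moreover have "((\<lambda>t. 0) has_real_derivative flat (Suc j) t) (at t)"
      using 2 by (simp add: flat_def)
    ultimately show ?thesis using DERIV_cong_ev[OF refl ev refl] by simp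
  next
    case 3
    \<comment> \<open>With s = 1/t the difference quotient at 0 from the right is s P(s) exp(-s),
      whence the exponent 1; from the left it is identically 0.\<close>
    have "((\<lambda>s. s ^ 1 * poly (flat_family j) s * exp (- s)) \<longlongrightarrow> 0) at_top"
      by (rule power_poly_exp_tendsto_0)
    then have "((\<lambda>t. inverse t ^ 1 * poly (flat_family j) (inverse t) * exp (- inverse t)) \<longlongrightarrow> 0) (at_right 0)"
      by (rule filterlim_compose[OF _ filterlim_inverse_at_top_right])
    then have "((\<lambda>t. (flat j t - flat j 0) / (t - 0)) \<longlongrightarrow> 0) (at_right 0)"
      by (rule Lim_transform_eventually)
        (auto simp: eventually_at_right_field flat_def divide_inverse mult_ac intro!: exI[of _ 1])
    moreover have "((\<lambda>t. (flat j t - flat j 0) / (t - 0)) \<longlongrightarrow> 0) (at_left 0)"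
      by (rule tendsto_eventually) (auto simp: eventually_at_left_field flat_def intro!: exI[of _ "-1"])
    ultimately have "((\<lambda>t. (flat j t - flat j 0) / (t - 0)) \<longlongrightarrow> 0) (at 0)"
      by (rule filterlim_split_at_real[rotated])
    then show ?thesis using 3 by (simp add: has_field_derivative_iff flat_def)
  qed
qed

text \<open>Using the squared distance keeps the argument of \<open>flat 0\<close> a polynomial in
  \<open>x\<close>, so that smoothness follows by composition, also at the centre.\<close>

definition bump :: "'a::euclidean_space \<Rightarrow> real \<Rightarrow> 'a \<Rightarrow> real"
  where "bump c r x = flat 0 (1 - (x - c) \<bullet> (x - c) / r\<^sup>2)"

lemma bump_Ck: "Ck k (bump c r)"
proof -
  have "Ck k (\<lambda>x::'a. 1 + (- 1 / r\<^sup>2) * (\<Sum>i\<in>Basis. ((x - c) \<bullet> i) * ((x - c) \<bullet> i)))"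
    by (intro Ck_add Ck_const Ck_mult Ck_sum Ck_inner)
  then have "Ck k (\<lambda>x::'a. 1 - (x - c) \<bullet> (x - c) / r\<^sup>2)"
    by (subst euclidean_inner) simp
  from Ck_chain[where G = flat, OF flat_deriv this]
  show ?thesis unfolding bump_def .
qed

lemma flat_0: "flat 0 t = (if t > 0 then exp (- (1 / t)) else 0)"
  by (simp add: flat_def flat_family_def)

lemma bump_nonneg: "bump c r x \<ge> 0"
  by (simp add: bump_def flat_0)

lemma bump_le_1: "bump c r x \<le> 1"
  by (simp add: bump_def flat_0)

lemma bump_eq_0_iff:
  assumes "r > 0" shows "bump c r x = 0 \<longleftrightarrow> norm (x - c) \<ge> r"
proof -
  have "bump c r x = 0 \<longleftrightarrow> r\<^sup>2 \<le> (norm (x - c))\<^sup>2"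
    using assms by (simp add: bump_def flat_0 field_simps power2_norm_eq_inner not_less)
  also have "\<dots> \<longleftrightarrow> r \<le> norm (x - c)"
    using assms by (simp add: abs_le_square_iff[symmetric])
  finally show ?thesis .
qed

text \<open>On the ball of half the radius the argument of \<open>flat 0\<close> is at least 3/4,
  and exp(-1/(3/4)) = exp(-4/3).\<close>

lemma bump_lower:
  assumes "r > 0" "norm (x - c) \<le> r / 2"
  shows "bump c r x \<ge> exp (- (4 / 3))"
proof -
  have "(norm (x - c))\<^sup>2 \<le> (r / 2)\<^sup>2"
    using assms by (intro power_mono) auto
  then have "(x - c) \<bullet> (x - c) / r\<^sup>2 \<le> 1 / 4"
    using assms by (simp add: power2_norm_eq_inner field_simps)
  then show ?thesis by (auto simp: bump_def flat_0 field_simps)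
qed

text \<open>One constant serves all centres and radii: the gradient is a bounded multiple of (x -
  c)/r^2 that vanishes outside the ball of radius \<open>r\<close>. This uniformity lets the final
  estimate scale with the radius. Asking for \<open>L \<ge> 1\<close> allows the resulting bound on
  the gradient to control differences of values in [0,1] as well, as long as the radius is at most
  1.\<close>

lemma bump_gradient_bound:
  obtains L where "L \<ge> 1"
    "\<And>(c::'a::euclidean_space) r x. r > 0 \<Longrightarrow> norm (gradient (bump c r) x) \<le> L / r"
proof -
  have "compact (flat 1 ` {0..1})"
    by (intro compact_continuous_image compact_Icc)
      (metis DERIV_isCont continuous_at_imp_continuous_on flat_deriv)
  then obtain M where M: "M > 0" "\<And>t. t \<in> {0..1} \<Longrightarrow> \<bar>flat 1 t\<bar> \<le> M"
    using bounded_pos compact_imp_bounded by (metis image_eqI real_norm_def)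
  have "norm (gradient (bump c r) x) \<le> max 1 (2 * M) / r" if r: "r > 0" for c :: 'a and r x
  proof -
    let ?t = "1 - (x - c) \<bullet> (x - c) / r\<^sup>2"
    have "((\<lambda>x. 1 - (x - c) \<bullet> (x - c) / r\<^sup>2) has_derivative (\<lambda>v. - (2 * ((x - c) \<bullet> v)) / r\<^sup>2)) (at x)"
      using r by (auto intro!: derivative_eq_intros simp: inner_commute field_simps power2_eq_square)
    from has_derivative_compose[OF this flat_deriv[of 0, unfolded has_field_derivative_def]]
    have "(bump c r has_derivative (\<lambda>v. ((- 2 * flat 1 ?t / r\<^sup>2) *\<^sub>R (x - c)) \<bullet> v)) (at x)"
      by (simp add: bump_def[abs_def] mult_ac)
    from gradient_eqI[OF this]
    have g: "gradient (bump c r) x = (- 2 * flat 1 ?t / r\<^sup>2) *\<^sub>R (x - c)" .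
    show ?thesis
    proof (cases "norm (x - c) \<le> r")
      case True
      then have "(norm (x - c))\<^sup>2 \<le> r\<^sup>2" by (intro power_mono) auto
      then have "?t \<in> {0..1}" using r by (simp add: power2_norm_eq_inner field_simps)
      then have "\<bar>flat 1 ?t\<bar> \<le> M" by (rule M)
      then have "\<bar>flat 1 ?t\<bar> * norm (x - c) \<le> M * r"
        using True by (intro mult_mono) auto
      then have "norm (gradient (bump c r) x) \<le> 2 * M / r"
        using r unfolding g by (simp add: abs_mult) (simp add: field_simps power2_eq_square)
      then show ?thesis using r by (smt (verit) divide_right_mono)
    next
      case False
      then have "(norm (x - c))\<^sup>2 > r\<^sup>2" using r by (intro power_strict_mono) auto
      then have "\<not> ?t > 0" using r by (simp add: power2_norm_eq_inner field_simps)
      then have "flat 1 ?t = 0" by (simp add: flat_def)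
      then show ?thesis using r by (simp add: g)
    qed
  qed
  then show ?thesis using that[of "max 1 (2 * M)"] by auto
qed

lemma gradient_bound_lipschitz:
  fixes f :: "'a::euclidean_space \<Rightarrow> real"
  assumes "\<And>x. f differentiable (at x)" "\<And>x. norm (gradient f x) \<le> L"
  shows "\<bar>f x - f y\<bar> \<le> L * norm (x - y)"
proof -
  have "norm (f x - f y) \<le> L * norm (x - y)"
  proof (rule differentiable_bound[of UNIV f "\<lambda>x v. gradient f x \<bullet> v"])
    show "onorm (\<lambda>v. gradient f x \<bullet> v) \<le> L" for x
    proof (rule onorm_bound)
      show "0 \<le> L" using assms(2) norm_ge_zero order_trans by blast
      show "norm (gradient f x \<bullet> v) \<le> L * norm v" for v
        using assms(2)[of x] by (smt (verit) Cauchy_Schwarz_ineq2 mult_right_mono norm_ge_zero real_norm_def)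
    qed
  qed (auto intro: has_derivative_gradient assms has_derivative_at_withinI)
  then show ?thesis by simp
qed

lemma test_functionsI:
  assumes "\<And>k. Ck k f" "\<And>x. f x \<noteq> 0 \<Longrightarrow> x \<in> cball c r" "cball c r \<subseteq> \<Omega>"
  shows "f \<in> test_functions \<Omega>"
proof -
  have sub: "closure {x. f x \<noteq> 0} \<subseteq> cball c r"
    using assms(2) by (intro closure_minimal) auto
  then have "compact (closure {x. f x \<noteq> 0})"
    by (meson bounded_subset bounded_cball closed_closure compact_eq_bounded_closed)
  then show ?thesis using sub assms by (auto simp: test_functions_def)
qed

section \<open>Translations in \<open>L\<^sup>p\<close>\<close>

lemma nn_integral_translate:
  fixes z :: "'a::euclidean_space"
  assumes "f \<in> borel_measurable borel"
  shows "(\<integral>\<^sup>+x. f (x + z) \<partial>lborel) = (\<integral>\<^sup>+x. f x \<partial>lborel)"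
proof -
  have "(\<integral>\<^sup>+x. f x \<partial>lborel) = (\<integral>\<^sup>+x. f x \<partial>distr lborel borel ((+) z))"
    by (simp add: lborel_distr_plus)
  also have "\<dots> = (\<integral>\<^sup>+x. f (z + x) \<partial>lborel)"
    using assms by (subst nn_integral_distr) auto
  finally show ?thesis by (simp add: add.commute)
qed

lemma lborel_distr_diff:
  fixes z :: "'a::euclidean_space"
  shows "distr lborel borel (\<lambda>x. z - x) = lborel"
  using lborel_affine[of "-1" z] by (simp add: density_1)

lemma nn_integral_reflect:
  fixes z :: "'a::euclidean_space"
  assumes "f \<in> borel_measurable borel"
  shows "(\<integral>\<^sup>+x. f (z - x) \<partial>lborel) = (\<integral>\<^sup>+x. f x \<partial>lborel)"
proof -
  have "(\<integral>\<^sup>+x. f x \<partial>lborel) = (\<integral>\<^sup>+x. f x \<partial>distr lborel borel (\<lambda>x. z - x))"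
    by (simp add: lborel_distr_diff)
  also have "\<dots> = (\<integral>\<^sup>+x. f (z - x) \<partial>lborel)"
    using assms by (subst nn_integral_distr) auto
  finally show ?thesis by simp
qed

lemma powr_add_le:
  fixes a b p :: real
  assumes "a \<ge> 0" "b \<ge> 0" "p \<ge> 0"
  shows "(a + b) powr p \<le> 2 powr p * (a powr p + b powr p)"
proof -
  have "(a + b) powr p \<le> (2 * max a b) powr p"
    using assms by (intro powr_mono2) auto
  also have "\<dots> = 2 powr p * max a b powr p"
    using assms by (simp add: powr_mult)
  also have "\<dots> \<le> 2 powr p * (a powr p + b powr p)"
    by (intro mult_left_mono) (auto simp: max_def)
  finally show ?thesis .
qed

lemma norm_add_powr_le:
  assumes "p \<ge> 0"
  shows "norm (a + b) powr p \<le> 2 powr p * (norm a powr p + norm b powr p)"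
proof -
  have "norm (a + b) powr p \<le> (norm a + norm b) powr p"
    using assms by (intro powr_mono2 norm_triangle_ineq) auto
  also have "\<dots> \<le> 2 powr p * (norm a powr p + norm b powr p)"
    using assms by (intro powr_add_le) auto
  finally show ?thesis .
qed

lemma norm_diff_powr_le:
  "p \<ge> 0 \<Longrightarrow> norm (a - b) powr p \<le> 2 powr p * (norm a powr p + norm b powr p)"
  using norm_add_powr_le[of p a "- b"] by simp

lemma nn_integral_norm_add_powr_le:
  fixes f g :: "'a \<Rightarrow> 'b::{real_normed_vector, second_countable_topology}"
  assumes [measurable]: "f \<in> borel_measurable M" "g \<in> borel_measurable M" and "p \<ge> 0"
  shows "(\<integral>\<^sup>+x. norm (f x + g x) powr p \<partial>M)
    \<le> ennreal (2 powr p) * ((\<integral>\<^sup>+x. norm (f x) powr p \<partial>M) + (\<integral>\<^sup>+x. norm (g x) powr p \<partial>M))"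
proof -
  have "(\<integral>\<^sup>+x. norm (f x + g x) powr p \<partial>M)
      \<le> (\<integral>\<^sup>+x. ennreal (2 powr p) * (ennreal (norm (f x) powr p) + ennreal (norm (g x) powr p)) \<partial>M)"
    using norm_add_powr_le[OF assms(3), of "f _" "g _"]
    by (intro nn_integral_mono) (simp flip: ennreal_plus ennreal_mult)
  also have "\<dots> = ennreal (2 powr p) * ((\<integral>\<^sup>+x. norm (f x) powr p \<partial>M) + (\<integral>\<^sup>+x. norm (g x) powr p \<partial>M))"
    by (simp add: nn_integral_cmult nn_integral_add)
  finally show ?thesis .
qed

text \<open>The supporting line of a convex function, the pointwise form of Jensen's inequality.
  Convexity is applied on the open half-line, so a = 0 is computed directly; c = 0 is settled by
  \<open>0 powr r = 0\<close>.\<close>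

lemma powr_tangent:
  fixes a c p :: real
  assumes "a \<ge> 0" "c \<ge> 0" "p \<ge> 1"
  shows "c powr p + p * c powr (p - 1) * (a - c) \<le> a powr p"
proof (cases "c = 0")
  case False
  then have c: "c > 0" using assms by simp
  show ?thesis
  proof (cases "a = 0")
    case True
    have "c powr (p - 1) * c = c powr p"
      using c powr_mult_base[of c "p - 1"] by (simp add: mult.commute)
    then have "c powr p + p * c powr (p - 1) * (a - c) = (1 - p) * c powr p"
      using True by (simp add: algebra_simps)
    also have "\<dots> \<le> 0" using assms by (simp add: mult_nonpos_nonneg)
    finally show ?thesis using True by simp
  next
    case False
    have "(\<lambda>x. x powr p) a - (\<lambda>x. x powr p) c \<ge> (p * c powr (p - 1)) * (a - c)"
    proof (rule convex_on_imp_above_tangent[of "{0<..}"])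
      show "convex_on {0<..} (\<lambda>x. x powr p)" by (rule powr_convex[OF assms(3)])
      show "((\<lambda>x. x powr p) has_real_derivative p * c powr (p - 1)) (at c within {0<..})"
        using c by (auto intro!: derivative_eq_intros)
    qed (use c False assms in \<open>auto simp: interior_open\<close>)
    then show ?thesis by simp
  qed
qed (use assms in auto)

text \<open>The tangent inequality at the mean c of |g| is integrated against the probability
  density \<open>w\<close>. If \<open>w x * g x\<close> is not integrable, the integral on the left
  has the default value 0 and its power is 0, so that this case is trivial.\<close>

lemma jensen_powr:
  fixes g w :: "'a \<Rightarrow> real"
  assumes p: "p \<ge> 1" and [measurable]: "w \<in> borel_measurable M" "g \<in> borel_measurable M"
    and w: "\<And>x. w x \<ge> 0" "(\<integral>\<^sup>+x. w x \<partial>M) = 1"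
  shows "ennreal (\<bar>LINT x|M. w x * g x\<bar> powr p) \<le> (\<integral>\<^sup>+x. w x * \<bar>g x\<bar> powr p \<partial>M)"
proof (cases "integrable M (\<lambda>x. w x * g x) \<and> (\<integral>\<^sup>+x. w x * \<bar>g x\<bar> powr p \<partial>M) < \<infinity>")
  case True
  have "integrable M (\<lambda>x. norm (w x * g x))" using True by (intro integrable_norm) simp
  then have i: "integrable M (\<lambda>x. w x * \<bar>g x\<bar>)" using w by (simp add: abs_mult)
  have wi: "integrable M w" using w by (auto intro!: integrableI_nonneg)
  have w1: "(LINT x|M. w x) = 1" using w by (simp add: integral_eq_nn_integral)
  have pi: "integrable M (\<lambda>x. w x * \<bar>g x\<bar> powr p)"
    using True w by (intro integrableI_nonneg) auto
  define c where "c = (LINT x|M. w x * \<bar>g x\<bar>)"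
  have c: "c \<ge> 0" unfolding c_def using w by (simp add: integral_nonneg_AE)
  have "\<bar>LINT x|M. w x * g x\<bar> \<le> (LINT x|M. \<bar>w x * g x\<bar>)"
    by (rule integral_abs_bound)
  also have "\<dots> = c" using w by (simp add: c_def abs_mult)
  finally have "\<bar>LINT x|M. w x * g x\<bar> powr p \<le> c powr p"
    using p by (intro powr_mono2) auto
  also have "c powr p = (LINT x|M. w x * (c powr p + p * c powr (p - 1) * (\<bar>g x\<bar> - c)))"
  proof -
    have "(LINT x|M. w x * (c powr p + p * c powr (p - 1) * (\<bar>g x\<bar> - c)))
        = (LINT x|M. (c powr p - p * c powr (p - 1) * c) * w x + (p * c powr (p - 1)) * (w x * \<bar>g x\<bar>))"
      by (intro Bochner_Integration.integral_cong) (auto simp: algebra_simps)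
    also have "\<dots> = (c powr p - p * c powr (p - 1) * c) * 1 + (p * c powr (p - 1)) * c"
      using i wi by (simp add: w1 c_def[symmetric])
    finally show ?thesis by simp
  qed
  also have "\<dots> \<le> (LINT x|M. w x * \<bar>g x\<bar> powr p)"
  proof (rule integral_mono)
    have "integrable M (\<lambda>x. (c powr p - p * c powr (p - 1) * c) * w x + (p * c powr (p - 1)) * (w x * \<bar>g x\<bar>))"
      using i wi by auto
    then show "integrable M (\<lambda>x. w x * (c powr p + p * c powr (p - 1) * (\<bar>g x\<bar> - c)))"
      by (rule Bochner_Integration.integrable_bound) (auto simp: algebra_simps)
    show "w x * (c powr p + p * c powr (p - 1) * (\<bar>g x\<bar> - c)) \<le> w x * \<bar>g x\<bar> powr p" for x
      using powr_tangent[of "\<bar>g x\<bar>" c p] c p w by (intro mult_left_mono) auto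
  qed (rule pi)
  also have "ennreal (LINT x|M. w x * \<bar>g x\<bar> powr p) = (\<integral>\<^sup>+x. w x * \<bar>g x\<bar> powr p \<partial>M)"
    using w by (intro nn_integral_eq_integral[symmetric] pi) auto
  finally show ?thesis using ennreal_leI by metis
next
  case False
  then consider "\<not> integrable M (\<lambda>x. w x * g x)" | "(\<integral>\<^sup>+x. w x * \<bar>g x\<bar> powr p \<partial>M) = \<infinity>"
    using less_top by fastforce
  then show ?thesis
    by cases (auto simp: not_integrable_integral_eq)
qed

text \<open>The difference is the integral of
  \<open>gradient w (x + t *\<^sub>R z) \<bullet> z\<close> over t in [0,1]; Jensen's inequality in
  t, Fubini and translation invariance give the bound. \<open>U\<close> has to contain the segments
  from \<open>A\<close> in direction \<open>z\<close>, which keeps the estimate local.\<close>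

lemma translation_estimate:
  fixes w :: "'a::euclidean_space \<Rightarrow> real"
  assumes w: "Ck (Suc 0) w" and p: "p \<ge> 1" and [measurable]: "A \<in> sets borel" "U \<in> sets borel"
    and sub: "\<And>x t. x \<in> A \<Longrightarrow> t \<in> {0..1} \<Longrightarrow> x + t *\<^sub>R z \<in> U"
  shows "(\<integral>\<^sup>+x. indicator A x * ennreal (\<bar>w (x + z) - w x\<bar> powr p) \<partial>lborel)
    \<le> ennreal (norm z powr p) * (\<integral>\<^sup>+x. indicator U x * ennreal (norm (gradient w x) powr p) \<partial>lborel)"
proof -
  have cont: "continuous_on UNIV (gradient w)" by (rule Ck_gradient_continuous[OF w])
  then have [measurable]: "gradient w \<in> borel_measurable borel"
    by (rule borel_measurable_continuous_onI)
  have wd: "w differentiable (at x)" for x using w by simp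
  let ?I = "\<lambda>t. indicator {0..1} t :: real"
  have ftc: "(LINT t|lborel. ?I t * (gradient w (x + t *\<^sub>R z) \<bullet> z)) = w (x + z) - w x" for x
  proof -
    have "(LINT t|lborel. ?I t *\<^sub>R (gradient w (x + t *\<^sub>R z) \<bullet> z)) = w (x + 1 *\<^sub>R z) - w (x + 0 *\<^sub>R z)"
    proof (rule integral_FTC_atLeastAtMost)
      fix t :: real
      have "((\<lambda>t. x + t *\<^sub>R z) has_derivative (\<lambda>s. s *\<^sub>R z)) (at t within {0..1})"
        by (auto intro!: derivative_eq_intros)
      from has_derivative_compose[OF this has_derivative_gradient[OF wd]]
      show "((\<lambda>t. w (x + t *\<^sub>R z)) has_vector_derivative gradient w (x + t *\<^sub>R z) \<bullet> z) (at t within {0..1})"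
        by (simp add: has_vector_derivative_def)
      show "continuous_on {0..1} (\<lambda>t. gradient w (x + t *\<^sub>R z) \<bullet> z)"
        by (intro continuous_intros continuous_on_compose2[OF cont]) auto
    qed simp
    then show ?thesis by simp
  qed
  have "(\<integral>\<^sup>+x. indicator A x * ennreal (\<bar>w (x + z) - w x\<bar> powr p) \<partial>lborel)
      \<le> (\<integral>\<^sup>+x. \<integral>\<^sup>+t. indicator {0..1} t * (ennreal (norm z powr p) *
           (indicator U (x + t *\<^sub>R z) * ennreal (norm (gradient w (x + t *\<^sub>R z)) powr p))) \<partial>lborel \<partial>lborel)"
  proof (rule nn_integral_mono)
    fix x :: 'a
    show "indicator A x * ennreal (\<bar>w (x + z) - w x\<bar> powr p) \<le> (\<integral>\<^sup>+t. indicator {0..1} t * (ennreal (norm z powr p) *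
           (indicator U (x + t *\<^sub>R z) * ennreal (norm (gradient w (x + t *\<^sub>R z)) powr p))) \<partial>lborel)"
    proof (cases "x \<in> A")
      case True
      have "ennreal (\<bar>w (x + z) - w x\<bar> powr p) = ennreal (\<bar>LINT t|lborel. ?I t * (gradient w (x + t *\<^sub>R z) \<bullet> z)\<bar> powr p)"
        by (simp add: ftc)
      also have "\<dots> \<le> (\<integral>\<^sup>+t. ?I t * \<bar>gradient w (x + t *\<^sub>R z) \<bullet> z\<bar> powr p \<partial>lborel)"
        using p by (intro jensen_powr) (auto simp: ennreal_indicator)
      also have "\<dots> \<le> (\<integral>\<^sup>+t. indicator {0..1} t * (ennreal (norm z powr p) *
           (indicator U (x + t *\<^sub>R z) * ennreal (norm (gradient w (x + t *\<^sub>R z)) powr p))) \<partial>lborel)"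
      proof (rule nn_integral_mono)
        fix t :: real
        have "\<bar>gradient w (x + t *\<^sub>R z) \<bullet> z\<bar> powr p \<le> (norm (gradient w (x + t *\<^sub>R z)) * norm z) powr p"
          using p by (intro powr_mono2 Cauchy_Schwarz_ineq2) auto
        also have "\<dots> = norm z powr p * norm (gradient w (x + t *\<^sub>R z)) powr p"
          by (simp add: powr_mult)
        finally show "ennreal (?I t * \<bar>gradient w (x + t *\<^sub>R z) \<bullet> z\<bar> powr p) \<le> indicator {0..1} t * (ennreal (norm z powr p) *
           (indicator U (x + t *\<^sub>R z) * ennreal (norm (gradient w (x + t *\<^sub>R z)) powr p)))"
          using sub[OF True, of t] by (auto simp: indicator_def ennreal_mult[symmetric] intro!: ennreal_leI)
      qed
      finally show ?thesis using True by simp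
    qed simp
  qed
  also have "\<dots> = (\<integral>\<^sup>+t. \<integral>\<^sup>+x. indicator {0..1} t * (ennreal (norm z powr p) *
           (indicator U (x + t *\<^sub>R z) * ennreal (norm (gradient w (x + t *\<^sub>R z)) powr p))) \<partial>lborel \<partial>lborel)"
    by (rule lborel_pair.Fubini') measurable
  also have "\<dots> = (\<integral>\<^sup>+t. indicator {0..1} t * (ennreal (norm z powr p) *
      (\<integral>\<^sup>+x. indicator U (x + t *\<^sub>R z) * ennreal (norm (gradient w (x + t *\<^sub>R z)) powr p) \<partial>lborel)) \<partial>(lborel::real measure))"
    by (intro nn_integral_cong) (subst nn_integral_cmult; simp)+
  also have "\<dots> = (\<integral>\<^sup>+t. indicator {0..1} t * (ennreal (norm z powr p) *
      (\<integral>\<^sup>+x. indicator U x * ennreal (norm (gradient w x) powr p) \<partial>lborel)) \<partial>(lborel::real measure))"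
    by (subst nn_integral_translate[of "\<lambda>x. indicator U x * ennreal (norm (gradient w x) powr p)"]) auto
  also have "\<dots> = ennreal (norm z powr p) * (\<integral>\<^sup>+x. indicator U x * ennreal (norm (gradient w x) powr p) \<partial>lborel)"
    by (subst nn_integral_multc) auto
  finally show ?thesis .
qed

lemma ennreal_tendsto_0I:
  fixes g :: "'a \<Rightarrow> ennreal"
  assumes "\<And>e::real. e > 0 \<Longrightarrow> eventually (\<lambda>x. g x \<le> ennreal e) F"
  shows "(g \<longlongrightarrow> 0) F"
proof (rule order_tendstoI)
  fix a :: ennreal assume "0 < a"
  then obtain b where b: "0 < b" "b < a" using dense by blast
  then obtain e where e: "b = ennreal e" "e > 0"
    by (cases b) (auto simp: ennreal_less_zero_iff)
  show "eventually (\<lambda>x. g x < a) F"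
    using assms[OF e(2)] b e by (auto elim!: eventually_mono)
qed auto

lemma ennreal_tendsto_0D:
  fixes g :: "'a \<Rightarrow> ennreal"
  assumes "(g \<longlongrightarrow> 0) F" "(e::real) > 0"
  shows "eventually (\<lambda>x. g x \<le> ennreal e) F"
  using order_tendstoD(2)[OF assms(1), of "ennreal e"] assms(2)
  by (auto elim!: eventually_mono)

lemma ennreal_tendsto_0_le:
  fixes f g :: "'a \<Rightarrow> ennreal"
  assumes "(g \<longlongrightarrow> 0) F" "\<And>x. f x \<le> g x"
  shows "(f \<longlongrightarrow> 0) F"
  by (rule tendsto_sandwich[OF _ _ tendsto_const assms(1)]) (auto simp: assms(2))

text \<open>The cost of replacing \<open>f\<close> by \<open>g\<close> does not depend on
  \<open>z\<close>, so closeness in L^1 transfers continuity under translations.\<close>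

lemma translation_L1_le:
  fixes f g :: "'a::euclidean_space \<Rightarrow> real"
  assumes [measurable]: "f \<in> borel_measurable borel" "g \<in> borel_measurable borel"
  shows "(\<integral>\<^sup>+x. \<bar>f (x + z) - f x\<bar> \<partial>lborel)
    \<le> (\<integral>\<^sup>+x. \<bar>g (x + z) - g x\<bar> \<partial>lborel) + 2 * (\<integral>\<^sup>+x. \<bar>f x - g x\<bar> \<partial>lborel)"
proof -
  have "(\<integral>\<^sup>+x. \<bar>f (x + z) - f x\<bar> \<partial>lborel)
    \<le> (\<integral>\<^sup>+x. ennreal \<bar>g (x + z) - g x\<bar> + (ennreal \<bar>f (x + z) - g (x + z)\<bar> + ennreal \<bar>f x - g x\<bar>) \<partial>lborel)"
    by (intro nn_integral_mono) (simp flip: ennreal_plus)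
  also have "\<dots> = (\<integral>\<^sup>+x. \<bar>g (x + z) - g x\<bar> \<partial>lborel)
      + ((\<integral>\<^sup>+x. \<bar>f (x + z) - g (x + z)\<bar> \<partial>lborel) + (\<integral>\<^sup>+x. \<bar>f x - g x\<bar> \<partial>lborel))"
    by (simp add: nn_integral_add)
  also have "(\<integral>\<^sup>+x. \<bar>f (x + z) - g (x + z)\<bar> \<partial>lborel) = (\<integral>\<^sup>+x. \<bar>f x - g x\<bar> \<partial>lborel)"
    by (rule nn_integral_translate[where f = "\<lambda>x. ennreal \<bar>f x - g x\<bar>"]) simp
  finally show ?thesis by (simp add: mult_2)
qed

text \<open>The difference of the two indicators plus twice their product is their sum, so it
  suffices that the overlap of \<open>U\<close> with its translate converges. For open
  \<open>U\<close> this holds pointwise, and finite measure gives domination and permits the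
  subtraction.\<close>

lemma translation_L1_open:
  fixes U :: "'a::euclidean_space set"
  assumes U: "open U" "emeasure lborel U < \<infinity>"
  shows "((\<lambda>z. \<integral>\<^sup>+x. \<bar>indicator U (x + z) - indicator U x :: real\<bar> \<partial>lborel) \<longlongrightarrow> 0) (nhds 0)"
    (is "(?t \<longlongrightarrow> 0) _")
proof -
  have [measurable]: "U \<in> sets borel" using U by simp
  have split: "?t z = 2 * emeasure lborel U - 2 * (\<integral>\<^sup>+x. indicator U x * indicator U (x + z) \<partial>lborel)" for z
  proof -
    let ?A = "\<integral>\<^sup>+x. indicator U x * indicator U (x + z) \<partial>lborel"
    have "?t z + 2 * ?A = (\<integral>\<^sup>+x. ennreal \<bar>indicator U (x + z) - indicator U x :: real\<bar>
        + 2 * (indicator U x * indicator U (x + z)) \<partial>lborel)"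
      by (simp add: nn_integral_add nn_integral_cmult)
    also have "\<dots> = (\<integral>\<^sup>+x. indicator U x + indicator U (x + z) \<partial>lborel)"
      by (intro nn_integral_cong) (auto simp: indicator_def)
    also have "\<dots> = emeasure lborel U + (\<integral>\<^sup>+x. indicator U (x + z) \<partial>lborel)"
      by (simp add: nn_integral_add)
    also have "(\<integral>\<^sup>+x. indicator U (x + z) \<partial>lborel) = emeasure lborel U"
      by (subst nn_integral_translate[where f = "indicator U"]) auto
    finally have *: "?t z + 2 * ?A = 2 * emeasure lborel U" by (simp add: mult_2)
    have "?A \<le> (\<integral>\<^sup>+x. indicator U x \<partial>lborel)"
      by (intro nn_integral_mono) (auto simp: indicator_def)
    then have "?A \<noteq> top" using U by (auto simp: top_unique)
    then have "2 * ?A \<noteq> top" by (simp add: ennreal_mult_eq_top_iff)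
    then show ?thesis using ennreal_add_diff_cancel_right[of "2 * ?A" "?t z"] * by simp
  qed
  have "(?t \<longlongrightarrow> ?t 0) (at 0)"
    unfolding tendsto_at_iff_sequentially
  proof (intro allI impI)
    fix X :: "nat \<Rightarrow> 'a" assume X: "X \<longlonglongrightarrow> 0"
    have "(\<lambda>n. \<integral>\<^sup>+x. indicator U x * indicator U (x + X n) \<partial>lborel) \<longlonglongrightarrow> (\<integral>\<^sup>+x. indicator U x \<partial>lborel)"
    proof (rule nn_integral_dominated_convergence[where w = "indicator U"])
      show "AE x in lborel. (\<lambda>n. indicator U x * indicator U (x + X n)) \<longlonglongrightarrow> (indicator U x :: ennreal)"
      proof (intro AE_I2)
        fix x
        show "(\<lambda>n. indicator U x * indicator U (x + X n)) \<longlonglongrightarrow> (indicator U x :: ennreal)"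
        proof (cases "x \<in> U")
          case True
          have "(\<lambda>n. x + X n) \<longlonglongrightarrow> x + 0" by (intro tendsto_intros X)
          then have "eventually (\<lambda>n. x + X n \<in> U) sequentially"
            using U(1) True by (auto simp: topological_tendstoD)
          then show ?thesis using True by (auto intro!: tendsto_eventually elim!: eventually_mono)
        qed simp
      qed
      show "AE x in lborel. indicator U x * indicator U (x + X n) \<le> (indicator U x :: ennreal)" for n
        by (auto simp: indicator_def)
    qed (use U in auto)
    then have "(\<lambda>n. 2 * emeasure lborel U - 2 * (\<integral>\<^sup>+x. indicator U x * indicator U (x + X n) \<partial>lborel))
        \<longlonglongrightarrow> 2 * emeasure lborel U - 2 * emeasure lborel U"
      using U by (intro tendsto_diff_ennreal tendsto_const ennreal_tendsto_cmult)
        (simp_all add: ennreal_mult_eq_top_iff)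
    then have "(\<lambda>n. ?t (X n)) \<longlonglongrightarrow> 0"
      using U by (simp add: split ennreal_mult_eq_top_iff)
    then show "(?t \<circ> X) \<longlonglongrightarrow> ?t 0" by (simp add: o_def)
  qed
  then have "(?t \<longlongrightarrow> ?t 0) (nhds 0)" using tendsto_at_iff_tendsto_nhds by blast
  then show ?thesis by simp
qed

text \<open>Induction over integrable functions; in the base case outer regularity approximates the
  measurable set by an open one.\<close>

lemma translation_L1:
  fixes f :: "'a::euclidean_space \<Rightarrow> real"
  assumes "integrable lborel f"
  shows "((\<lambda>z. \<integral>\<^sup>+x. \<bar>f (x + z) - f x\<bar> \<partial>lborel) \<longlongrightarrow> 0) (nhds 0)"
  using assms
proof (induction f rule: integrable_induct)
  case (base A c)
  then have [measurable]: "A \<in> sets borel" by simp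
  have *: "((\<lambda>z. \<integral>\<^sup>+x. \<bar>indicator A (x + z) - indicator A x :: real\<bar> \<partial>lborel) \<longlongrightarrow> 0) (nhds 0)"
  proof (rule ennreal_tendsto_0I)
    fix e :: real assume e: "e > 0"
    obtain U where U: "open U" "A \<subseteq> U" "emeasure lborel (U - A) < ennreal (e / 4)"
      using outer_regular_lborel[of A "e / 4"] e by auto
    have [measurable]: "U \<in> sets borel" using U by simp
    have "emeasure lborel U \<le> emeasure lborel A + emeasure lborel (U - A)"
      using U(2) by (metis Diff_partition Un_commute \<open>A \<in> sets borel\<close> \<open>U \<in> sets borel\<close> emeasure_subadditive sets.Diff sets_lborel)
    also have "\<dots> < \<infinity>" using base U(3) by (auto simp: less_top[symmetric])
    finally have "emeasure lborel U < \<infinity>" .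
    then have "eventually (\<lambda>z. (\<integral>\<^sup>+x. \<bar>indicator U (x + z) - indicator U x :: real\<bar> \<partial>lborel) \<le> ennreal (e / 2)) (nhds 0)"
      using ennreal_tendsto_0D[OF translation_L1_open[OF U(1)]] e by simp
    then show "eventually (\<lambda>z. (\<integral>\<^sup>+x. \<bar>indicator A (x + z) - indicator A x :: real\<bar> \<partial>lborel) \<le> ennreal e) (nhds 0)"
    proof eventually_elim
      case (elim z)
      have "(\<integral>\<^sup>+x. \<bar>indicator A x - indicator U x :: real\<bar> \<partial>lborel) = (\<integral>\<^sup>+x. indicator (U - A) x \<partial>lborel)"
        using U(2) by (intro nn_integral_cong) (auto simp: indicator_def)
      then have "(\<integral>\<^sup>+x. \<bar>indicator A x - indicator U x :: real\<bar> \<partial>lborel) \<le> ennreal (e / 4)"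
        using U(3) by simp
      then have "2 * (\<integral>\<^sup>+x. \<bar>indicator A x - indicator U x :: real\<bar> \<partial>lborel) \<le> 2 * ennreal (e / 4)"
        by (rule mult_left_mono) simp
      also have "2 * ennreal (e / 4) = ennreal (e / 2)"
        using e by (simp flip: ennreal_numeral ennreal_mult)
      finally have "(\<integral>\<^sup>+x. \<bar>indicator A (x + z) - indicator A x :: real\<bar> \<partial>lborel) \<le> ennreal (e / 2) + ennreal (e / 2)"
        using elim by (intro order_trans[OF translation_L1_le[of "indicator A" "indicator U"]] add_mono) auto
      then show ?case using e by (simp flip: ennreal_plus)
    qed
  qed
  have "((\<lambda>z. ennreal \<bar>c\<bar> * (\<integral>\<^sup>+x. \<bar>indicator A (x + z) - indicator A x :: real\<bar> \<partial>lborel)) \<longlongrightarrow> ennreal \<bar>c\<bar> * 0) (nhds 0)"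
    by (intro ennreal_tendsto_cmult *) auto
  moreover have "ennreal \<bar>c\<bar> * (\<integral>\<^sup>+x. \<bar>indicator A (x + z) - indicator A x :: real\<bar> \<partial>lborel)
      = (\<integral>\<^sup>+x. \<bar>indicator A (x + z) *\<^sub>R c - indicator A x *\<^sub>R c\<bar> \<partial>lborel)" for z
    by (subst nn_integral_cmult[symmetric])
      (auto intro!: nn_integral_cong simp: ennreal_mult[symmetric] abs_mult[symmetric] right_diff_distrib mult.commute)
  ultimately show ?case by simp
next
  case (add f g)
  have [measurable]: "f \<in> borel_measurable borel" "g \<in> borel_measurable borel"
    using add.hyps by auto
  have t: "((\<lambda>z. (\<integral>\<^sup>+x. \<bar>f (x + z) - f x\<bar> \<partial>lborel) + (\<integral>\<^sup>+x. \<bar>g (x + z) - g x\<bar> \<partial>lborel)) \<longlongrightarrow> 0 + 0) (nhds 0)"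
    by (intro tendsto_add add.IH)
  have le: "(\<integral>\<^sup>+x. \<bar>(f (x + z) + g (x + z)) - (f x + g x)\<bar> \<partial>lborel)
      \<le> (\<integral>\<^sup>+x. \<bar>f (x + z) - f x\<bar> \<partial>lborel) + (\<integral>\<^sup>+x. \<bar>g (x + z) - g x\<bar> \<partial>lborel)" for z
    by (subst nn_integral_add[symmetric]) (auto intro!: nn_integral_mono simp flip: ennreal_plus)
  show ?case by (rule ennreal_tendsto_0_le[OF t[simplified] le])
next
  case (lim f s)
  have [measurable]: "f \<in> borel_measurable borel" "\<And>i. s i \<in> borel_measurable borel"
    using borel_measurable_integrable[OF lim.hyps(4)] borel_measurable_integrable[OF lim.hyps(1)] by simp_all
  have "(\<integral>\<^sup>+x. ennreal (norm (f x)) \<partial>lborel) < \<infinity>" using lim.hyps(4) by (simp add: integrable_iff_bounded)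
  then have "(\<integral>\<^sup>+x. ennreal (2 * norm (f x)) \<partial>lborel) < \<infinity>"
    by (simp add: ennreal_mult nn_integral_cmult ennreal_mult_less_top)
  then have c: "(\<lambda>i. \<integral>\<^sup>+x. norm (f x - s i x) \<partial>lborel) \<longlonglongrightarrow> 0"
    by (intro nn_integral_dominated_convergence_norm[where w = "\<lambda>x. 2 * norm (f x)"])
      (use lim.hyps(2,3) in simp_all)
  show ?case
  proof (rule ennreal_tendsto_0I)
    fix e :: real assume e: "e > 0"
    obtain i where i: "(\<integral>\<^sup>+x. norm (f x - s i x) \<partial>lborel) \<le> ennreal (e / 4)"
      using ennreal_tendsto_0D[OF c, of "e / 4"] e by (auto simp: eventually_sequentially)
    have "eventually (\<lambda>z. (\<integral>\<^sup>+x. \<bar>s i (x + z) - s i x\<bar> \<partial>lborel) \<le> ennreal (e / 2)) (nhds 0)"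
      using ennreal_tendsto_0D[OF lim.IH[of i]] e by simp
    then show "eventually (\<lambda>z. (\<integral>\<^sup>+x. \<bar>f (x + z) - f x\<bar> \<partial>lborel) \<le> ennreal e) (nhds 0)"
    proof eventually_elim
      case (elim z)
      have "2 * (\<integral>\<^sup>+x. \<bar>f x - s i x\<bar> \<partial>lborel) \<le> 2 * ennreal (e / 4)"
        using i by (intro mult_left_mono) auto
      also have "2 * ennreal (e / 4) = ennreal (e / 2)"
        using e by (simp flip: ennreal_numeral ennreal_mult)
      finally have "(\<integral>\<^sup>+x. \<bar>f (x + z) - f x\<bar> \<partial>lborel) \<le> ennreal (e / 2) + ennreal (e / 2)"
        using elim by (intro order_trans[OF translation_L1_le[of f "s i"]] add_mono) auto
      then show ?case using e by (simp flip: ennreal_plus)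
    qed
  qed
qed

text \<open>\<open>f\<close> is truncated at height \<open>M\<close>. For the truncation the p-th
  power of a difference is at most (2M)^(p-1) times the difference itself, so the L^1 result
  applies; the remainder is small in L^p by dominated convergence.\<close>

lemma translation_Lp:
  fixes f :: "'a::euclidean_space \<Rightarrow> real"
  assumes f: "integrable lborel f" and p: "p \<ge> 1" and fp: "(\<integral>\<^sup>+x. \<bar>f x\<bar> powr p \<partial>lborel) < \<infinity>"
  shows "((\<lambda>z. \<integral>\<^sup>+x. \<bar>f (x + z) - f x\<bar> powr p \<partial>lborel) \<longlongrightarrow> 0) (nhds 0)"
proof -
  have [measurable]: "f \<in> borel_measurable borel" using f by auto
  define g where "g M x = max (- real M) (min (real M) (f x))" for M :: nat and x
  have [measurable]: "g M \<in> borel_measurable borel" for M unfolding g_def by measurable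
  define C where "C = 2 powr p"
  have C: "C > 0" by (simp add: C_def)
  have dom: "\<bar>f x - g M x\<bar> powr p \<le> \<bar>f x\<bar> powr p" for M x
    using p by (intro powr_mono2) (auto simp: g_def)
  have "(\<lambda>M. \<integral>\<^sup>+x. \<bar>f x - g M x\<bar> powr p \<partial>lborel) \<longlonglongrightarrow> (\<integral>\<^sup>+x. 0 \<partial>(lborel :: 'a measure))"
  proof (rule nn_integral_dominated_convergence[where w = "\<lambda>x. \<bar>f x\<bar> powr p"])
    show "AE x in lborel. (\<lambda>M. ennreal (\<bar>f x - g M x\<bar> powr p)) \<longlonglongrightarrow> 0"
    proof (intro AE_I2 tendsto_eventually)
      fix x
      obtain N :: nat where "\<bar>f x\<bar> \<le> real N" using real_arch_simple by blast
      then show "eventually (\<lambda>M. ennreal (\<bar>f x - g M x\<bar> powr p) = 0) sequentially"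
        by (intro eventually_sequentiallyI[of N]) (auto simp: g_def)
    qed
  qed (use dom fp in \<open>auto intro: ennreal_leI\<close>)
  then have c: "(\<lambda>M. \<integral>\<^sup>+x. \<bar>f x - g M x\<bar> powr p \<partial>lborel) \<longlonglongrightarrow> 0" by simp
  show ?thesis
  proof (rule ennreal_tendsto_0I)
    fix e :: real assume e: "e > 0"
    \<comment> \<open>The remainder enters twice, at x and at x + z, each time with the factor
      \<open>C * C\<close>; this choice makes the total cost e/2.\<close>
    define e1 where "e1 = e / (4 * C * C)"
    have e1: "e1 > 0" using e C by (simp add: e1_def)
    obtain M where M: "(\<integral>\<^sup>+x. \<bar>f x - g M x\<bar> powr p \<partial>lborel) \<le> ennreal e1"
      using ennreal_tendsto_0D[OF c e1] by (auto simp: eventually_sequentially)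
    define K where "K = C * (2 * real M) powr (p - 1)"
    have K: "K \<ge> 0" using C by (simp add: K_def)
    have "integrable lborel (g M)"
      by (rule Bochner_Integration.integrable_bound[OF f]) (auto simp: g_def)
    from ennreal_tendsto_0D[OF translation_L1[OF this], of "e / (2 * (K + 1))"] K e
    have "eventually (\<lambda>z. (\<integral>\<^sup>+x. \<bar>g M (x + z) - g M x\<bar> \<partial>lborel) \<le> ennreal (e / (2 * (K + 1)))) (nhds 0)"
      by simp
    then show "eventually (\<lambda>z. (\<integral>\<^sup>+x. \<bar>f (x + z) - f x\<bar> powr p \<partial>lborel) \<le> ennreal e) (nhds 0)"
    proof eventually_elim
      case (elim z)
      let ?d = "\<lambda>x. f x - g M x"
      have pt: "\<bar>f (x + z) - f x\<bar> powr p \<le> K * \<bar>g M (x + z) - g M x\<bar>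
          + C * C * (\<bar>?d (x + z)\<bar> powr p + \<bar>?d x\<bar> powr p)" for x
      proof -
        let ?b = "\<bar>g M (x + z) - g M x\<bar>"
        have "\<bar>f (x + z) - f x\<bar> powr p \<le> C * (?b powr p + \<bar>?d (x + z) - ?d x\<bar> powr p)"
          using norm_add_powr_le[of p "g M (x + z) - g M x" "?d (x + z) - ?d x"] p by (simp add: C_def)
        also have "\<bar>?d (x + z) - ?d x\<bar> powr p \<le> C * (\<bar>?d (x + z)\<bar> powr p + \<bar>?d x\<bar> powr p)"
          using norm_diff_powr_le[of p "?d (x + z)" "?d x"] p by (simp add: C_def)
        also have "?b powr p \<le> (2 * real M) powr (p - 1) * ?b"
        proof -
          have "?b powr p = ?b powr (p - 1) * ?b"
            using powr_mult_base[of ?b "p - 1"] by (simp add: mult.commute)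
          also have "\<dots> \<le> (2 * real M) powr (p - 1) * ?b"
            using p by (intro mult_right_mono powr_mono2) (auto simp: g_def)
          finally show ?thesis .
        qed
        finally show ?thesis using C by (simp add: K_def algebra_simps)
      qed
      have "(\<integral>\<^sup>+x. \<bar>f (x + z) - f x\<bar> powr p \<partial>lborel)
          \<le> (\<integral>\<^sup>+x. ennreal K * ennreal \<bar>g M (x + z) - g M x\<bar>
            + ennreal (C * C) * (ennreal (\<bar>?d (x + z)\<bar> powr p) + ennreal (\<bar>?d x\<bar> powr p)) \<partial>lborel)"
        using pt K C by (intro nn_integral_mono) (simp add: ennreal_mult[symmetric] ennreal_plus[symmetric] del: ennreal_plus)
      also have "\<dots> = ennreal K * (\<integral>\<^sup>+x. \<bar>g M (x + z) - g M x\<bar> \<partial>lborel)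
          + ennreal (C * C) * ((\<integral>\<^sup>+x. \<bar>?d (x + z)\<bar> powr p \<partial>lborel) + (\<integral>\<^sup>+x. \<bar>?d x\<bar> powr p \<partial>lborel))"
        by (simp add: nn_integral_add nn_integral_cmult)
      also have "(\<integral>\<^sup>+x. \<bar>?d (x + z)\<bar> powr p \<partial>lborel) = (\<integral>\<^sup>+x. \<bar>?d x\<bar> powr p \<partial>lborel)"
        by (rule nn_integral_translate[where f = "\<lambda>x. ennreal (\<bar>?d x\<bar> powr p)"]) simp
      also have "ennreal K * (\<integral>\<^sup>+x. \<bar>g M (x + z) - g M x\<bar> \<partial>lborel)
          + ennreal (C * C) * ((\<integral>\<^sup>+x. \<bar>?d x\<bar> powr p \<partial>lborel) + (\<integral>\<^sup>+x. \<bar>?d x\<bar> powr p \<partial>lborel))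
          \<le> ennreal K * ennreal (e / (2 * (K + 1))) + ennreal (C * C) * (ennreal e1 + ennreal e1)"
        by (intro add_mono mult_left_mono elim M) auto
      also have "\<dots> = ennreal (K * (e / (2 * (K + 1))) + e / 2)"
        using e e1 K C by (simp add: ennreal_mult[symmetric] ennreal_plus[symmetric] e1_def del: ennreal_plus)
      also have "\<dots> \<le> ennreal e"
        using e K by (intro ennreal_leI) (simp add: field_simps)
      finally show ?case .
    qed
  qed
qed

section \<open>Convolution and the standard mollifier\<close>

definition conv :: "('a::euclidean_space \<Rightarrow> real) \<Rightarrow> ('a \<Rightarrow> real) \<Rightarrow> 'a \<Rightarrow> real"
  where "conv u \<kappa> x = (LINT y|lborel. u y * \<kappa> (x - y))"

definition mollifier :: "real \<Rightarrow> 'a::euclidean_space \<Rightarrow> real"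
  where "mollifier r x = bump 0 r x / (LINT y|lborel. bump (0::'a) r y)"

lemma integrable_bump: "r > 0 \<Longrightarrow> integrable lborel (bump c r)"
  for c :: "'a::euclidean_space"
proof -
  assume r: "r > 0"
  have "integrable lborel (\<lambda>x. indicator (cball c r) x *\<^sub>R bump c r x)"
    by (intro borel_integrable_compact compact_cball) (use bump_Ck[of 0 c r] Ck_continuous in blast)
  moreover have "(\<lambda>x. indicator (cball c r) x *\<^sub>R bump c r x) = bump c r"
    using r by (auto simp: indicator_def bump_eq_0_iff dist_norm norm_minus_commute intro!: ext)
  ultimately show ?thesis by simp
qed

lemma bump_integral_pos:
  fixes c :: "'a::euclidean_space"
  assumes r: "r > 0" shows "(LINT y|lborel. bump c r y) > 0"
proof -
  have "0 < exp (- (4 / 3)) * measure lborel (ball c (r / 2))"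
    using r content_ball_pos[of "r / 2" c] by simp
  also have "\<dots> = (LINT y|lborel. exp (- (4 / 3)) * indicator (ball c (r / 2)) y)"
    by simp
  also have "\<dots> \<le> (LINT y|lborel. bump c r y)"
  proof (intro integral_mono integrable_bump integrable_mult_right integrable_real_indicator)
    show "emeasure lborel (ball c (r / 2)) < \<infinity>"
      using emeasure_bounded_finite[OF bounded_ball] by simp
    show "exp (- (4 / 3)) * indicator (ball c (r / 2)) y \<le> bump c r y" for y
      using r by (auto simp: indicator_def bump_nonneg dist_norm norm_minus_commute intro!: bump_lower)
  qed (use r in auto)
  finally show ?thesis .
qed

lemma mollifier_nonneg: "r > 0 \<Longrightarrow> mollifier r x \<ge> 0"
  using bump_integral_pos by (simp add: mollifier_def bump_nonneg less_imp_le)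

lemma mollifier_Ck: "Ck k (mollifier r)"
proof -
  have "Ck k (\<lambda>x::'a. (1 / (LINT y|lborel. bump (0::'a) r y)) * bump 0 r x)"
    by (intro Ck_mult Ck_const bump_Ck)
  then show ?thesis by (simp add: mollifier_def[abs_def])
qed

lemma mollifier_support: "r > 0 \<Longrightarrow> mollifier r x \<noteq> 0 \<Longrightarrow> norm x < r"
  by (auto simp: mollifier_def bump_eq_0_iff)

lemma mollifier_borel [measurable]: "mollifier r \<in> borel_measurable borel"
  using mollifier_Ck[of 0 r] by (rule Ck_borel_measurable)

lemma mollifier_nn_integral:
  assumes r: "r > 0" shows "(\<integral>\<^sup>+x. mollifier r x \<partial>(lborel :: 'a::euclidean_space measure)) = 1"
proof -
  have "(\<integral>\<^sup>+x. mollifier r x \<partial>(lborel :: 'a measure)) = ennreal (LINT x|(lborel :: 'a measure). mollifier r x)"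
    using r by (intro nn_integral_eq_integral) (auto simp: mollifier_def[abs_def] integrable_bump bump_integral_pos bump_nonneg less_imp_le)
  also have "(LINT x|(lborel :: 'a measure). mollifier r x) = 1"
    using bump_integral_pos[OF r, of "0 :: 'a"] by (simp add: mollifier_def less_imp_neq)
  finally show ?thesis by simp
qed

section \<open>Mollification\<close>

lemma Ck_bounded_support_bounded:
  assumes "Ck 0 (\<kappa> :: 'a::euclidean_space \<Rightarrow> real)" "\<And>x. \<kappa> x \<noteq> 0 \<Longrightarrow> x \<in> cball c r"
  obtains B where "B \<ge> 0" "\<And>x. \<bar>\<kappa> x\<bar> \<le> B"
proof -
  have "compact (\<kappa> ` cball c r)"
    using assms(1) by (intro compact_continuous_image compact_cball Ck_continuous)
  then obtain B where B: "B > 0" "\<And>x. x \<in> cball c r \<Longrightarrow> norm (\<kappa> x) \<le> B"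
    using bounded_pos[THEN iffD1, OF compact_imp_bounded] by (metis image_eqI)
  then have "\<bar>\<kappa> x\<bar> \<le> B" for x using assms(2)[of x] by (cases "\<kappa> x = 0") auto
  then show ?thesis using that B by (meson less_imp_le)
qed

lemma has_derivative_0_outside:
  assumes "closed S" "\<And>x. f x \<noteq> 0 \<Longrightarrow> x \<in> S" "x \<notin> S"
  shows "(f has_derivative (\<lambda>v. 0)) (at x)"
proof -
  have S: "open (- S)" "x \<in> - S" using assms by auto
  have f: "0 = f y" if "y \<in> - S" for y using assms(2)[of y] that by (cases "f y = 0") auto
  show ?thesis by (rule has_derivative_transform_within_open[OF has_derivative_const S f])
qed

lemma gradient_0_outside:
  fixes f :: "'a::euclidean_space \<Rightarrow> real"
  assumes "closed S" "\<And>x. f x \<noteq> 0 \<Longrightarrow> x \<in> S" "x \<notin> S"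
  shows "gradient f x = 0"
  by (rule gradient_eqI) (use has_derivative_0_outside[OF assms] in simp)

lemma frechet_derivative_0_outside:
  fixes f :: "'a::euclidean_space \<Rightarrow> real"
  assumes "closed S" "\<And>x. f x \<noteq> 0 \<Longrightarrow> x \<in> S" "x \<notin> S"
  shows "frechet_derivative f (at x) v = 0"
  using frechet_derivative_at[OF has_derivative_0_outside[OF assms]] by metis

lemma Ck_bounded_support_gradient_bounded:
  assumes "Ck (Suc 0) (\<kappa> :: 'a::euclidean_space \<Rightarrow> real)" "\<And>x. \<kappa> x \<noteq> 0 \<Longrightarrow> x \<in> cball c r"
  obtains L where "L \<ge> 0" "\<And>x. norm (gradient \<kappa> x) \<le> L"
proof -
  have "compact (gradient \<kappa> ` cball c r)"
    using assms(1) by (intro compact_continuous_image compact_cball Ck_gradient_continuous)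
  then obtain B where B: "B > 0" "\<And>x. x \<in> cball c r \<Longrightarrow> norm (gradient \<kappa> x) \<le> B"
    using bounded_pos[THEN iffD1, OF compact_imp_bounded] by (metis image_eqI)
  have "norm (gradient \<kappa> x) \<le> B" for x
    using B gradient_0_outside[OF closed_cball assms(2)] by (cases "x \<in> cball c r") force+
  then show ?thesis using that B by (meson less_imp_le)
qed

lemma integrable_mult_kernel:
  fixes u :: "'a::euclidean_space \<Rightarrow> real"
  assumes "integrable lborel u" and \<kappa>: "\<kappa> \<in> borel_measurable borel" "\<And>x. \<bar>\<kappa> x\<bar> \<le> B"
  shows "integrable lborel (\<lambda>y. u y * \<kappa> (x - y))"
proof (rule Bochner_Integration.integrable_bound)
  show "integrable lborel (\<lambda>y. B * u y)" using assms by simp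
  have [measurable]: "u \<in> borel_measurable borel" "\<kappa> \<in> borel_measurable borel" using assms by auto
  show "(\<lambda>y. u y * \<kappa> (x - y)) \<in> borel_measurable lborel" by measurable
  have "\<bar>\<kappa> z\<bar> \<le> \<bar>B\<bar>" for z using \<kappa>(2)[of z] by linarith
  then show "AE y in lborel. norm (u y * \<kappa> (x - y)) \<le> norm (B * u y)"
    by (intro AE_I2) (auto simp: abs_mult mult.commute[of "\<bar>B\<bar>"] intro!: mult_left_mono)
qed

text \<open>Differentiation under the integral sign: the first-order remainders of the kernel,
  divided by the length of the increment, are bounded by 2L because the kernel is Lipschitz, so
  dominated convergence applies along every sequence tending to 0.\<close>

lemma conv_has_derivative:
  fixes u \<kappa> :: "'a::euclidean_space \<Rightarrow> real"
  assumes u: "integrable lborel u" and \<kappa>: "Ck (Suc 0) \<kappa>" "\<And>x. \<kappa> x \<noteq> 0 \<Longrightarrow> x \<in> cball c r"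
  shows "(conv u \<kappa> has_derivative (\<lambda>v. (LINT y|lborel. u y *\<^sub>R gradient \<kappa> (x - y)) \<bullet> v)) (at x)"
proof -
  obtain L where L: "L \<ge> 0" "\<And>x. norm (gradient \<kappa> x) \<le> L"
    using Ck_bounded_support_gradient_bounded[OF \<kappa>] by metis
  obtain B where B: "B \<ge> 0" "\<And>x. \<bar>\<kappa> x\<bar> \<le> B"
    using Ck_bounded_support_bounded[OF Ck_Suc_imp[OF \<kappa>(1)] \<kappa>(2)] by metis
  have d: "\<kappa> differentiable (at x)" for x using \<kappa>(1) by simp
  have [measurable]: "u \<in> borel_measurable borel" "\<kappa> \<in> borel_measurable borel" "gradient \<kappa> \<in> borel_measurable borel"
    using u Ck_borel_measurable[OF \<kappa>(1)] Ck_gradient_continuous[OF \<kappa>(1)]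
    by (auto intro: borel_measurable_continuous_onI)
  have iu: "integrable lborel (\<lambda>y. u y * \<kappa> (x - y))" for x
    by (rule integrable_mult_kernel[OF u]) (use B in auto)
  have ig: "integrable lborel (\<lambda>y. u y *\<^sub>R gradient \<kappa> (x - y))" for x
  proof (rule Bochner_Integration.integrable_bound)
    show "integrable lborel (\<lambda>y. L * u y)" using u by simp
    show "AE y in lborel. norm (u y *\<^sub>R gradient \<kappa> (x - y)) \<le> norm (L * u y)"
      using L by (intro AE_I2) (auto simp: abs_mult mult.commute[of L] intro!: mult_left_mono)
  qed simp
  let ?D = "\<lambda>v. (LINT y|lborel. u y *\<^sub>R gradient \<kappa> (x - y)) \<bullet> v"
  have Dv: "?D v = (LINT y|lborel. u y * (gradient \<kappa> (x - y) \<bullet> v))"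
    and igv: "integrable lborel (\<lambda>y. u y * (gradient \<kappa> (x - y) \<bullet> v))" for v
    using integral_inner_left[of v lborel, OF ig] integrable_inner_left[of v lborel, OF ig] by simp_all
  show ?thesis
    unfolding has_derivative_at
  proof
    show "bounded_linear ?D" by (rule bounded_linear_inner_right)
    show "(\<lambda>h. norm (conv u \<kappa> (x + h) - conv u \<kappa> x - ?D h) / norm h) \<midarrow>0\<rightarrow> 0"
      unfolding tendsto_at_iff_sequentially
    proof (intro allI impI)
      fix X :: "nat \<Rightarrow> 'a" assume X0: "\<forall>i. X i \<in> UNIV - {0}" and X: "X \<longlonglongrightarrow> 0"
      define q where "q n w = (\<kappa> (w + X n) - \<kappa> w - gradient \<kappa> w \<bullet> X n) / norm (X n)" for n w
      have [measurable]: "q n \<in> borel_measurable borel" for n unfolding q_def by measurable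
      have nq: "norm (X n) * q n w = \<kappa> (w + X n) - \<kappa> w - gradient \<kappa> w \<bullet> X n" for n w
        using X0 by (simp add: q_def)
      have eq: "conv u \<kappa> (x + X n) - conv u \<kappa> x - ?D (X n) = norm (X n) * (LINT y|lborel. u y * q n (x - y))" for n
      proof -
        have "conv u \<kappa> (x + X n) - conv u \<kappa> x - ?D (X n)
          = (LINT y|lborel. u y * \<kappa> (x + X n - y) - u y * \<kappa> (x - y) - u y * (gradient \<kappa> (x - y) \<bullet> X n))"
          unfolding Dv using iu igv by (simp add: conv_def)
        also have "\<dots> = (LINT y|lborel. norm (X n) * (u y * q n (x - y)))"
          using nq[of n "x - _"]
          by (intro Bochner_Integration.integral_cong) (auto simp: right_diff_distrib add_diff_eq diff_add_eq mult.left_commute[of "norm (X n)"])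
        finally show ?thesis by simp
      qed
      have "(\<lambda>n. LINT y|lborel. u y * q n (x - y)) \<longlonglongrightarrow> (LINT y|(lborel :: 'a measure). 0)"
      proof (rule integral_dominated_convergence[where w = "\<lambda>y. (2 * L) * \<bar>u y\<bar>"])
        show "AE y in lborel. (\<lambda>n. u y * q n (x - y)) \<longlonglongrightarrow> 0"
        proof (intro AE_I2 tendsto_mult_right_zero)
          fix y
          have "(\<lambda>h. norm (\<kappa> (x - y + h) - \<kappa> (x - y) - gradient \<kappa> (x - y) \<bullet> h) / norm h) \<midarrow>0\<rightarrow> 0"
            using has_derivative_gradient[OF d, of "x - y"] by (simp add: has_derivative_at)
          then have "(\<lambda>n. norm (\<kappa> (x - y + X n) - \<kappa> (x - y) - gradient \<kappa> (x - y) \<bullet> X n) / norm (X n)) \<longlonglongrightarrow> 0"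
            using X X0 unfolding tendsto_at_iff_sequentially by (auto simp: o_def)
          then have "(\<lambda>n. \<bar>q n (x - y)\<bar>) \<longlonglongrightarrow> 0" by (simp add: q_def)
          then show "(\<lambda>n. q n (x - y)) \<longlonglongrightarrow> 0" by (rule tendsto_rabs_zero_cancel)
        qed
        show "AE y in lborel. norm (u y * q n (x - y)) \<le> (2 * L) * \<bar>u y\<bar>" for n
        proof (rule AE_I2)
          fix y
          have "\<bar>\<kappa> (x - y + X n) - \<kappa> (x - y)\<bar> \<le> L * norm (X n)"
            using gradient_bound_lipschitz[OF d L(2), of "x - y + X n" "x - y"] by simp
          moreover have "\<bar>gradient \<kappa> (x - y) \<bullet> X n\<bar> \<le> L * norm (X n)"
            by (meson Cauchy_Schwarz_ineq2 L(2) mult_right_mono norm_ge_zero order_trans)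
          ultimately have "\<bar>q n (x - y)\<bar> \<le> 2 * L"
            using X0 by (simp add: q_def field_simps)
          then show "norm (u y * q n (x - y)) \<le> (2 * L) * \<bar>u y\<bar>"
            by (auto simp: abs_mult mult.commute[of "2 * L"] intro!: mult_left_mono)
        qed
      qed (use u in auto)
      then have "(\<lambda>n. \<bar>LINT y|lborel. u y * q n (x - y)\<bar>) \<longlonglongrightarrow> 0"
        by (simp add: tendsto_rabs_zero)
      moreover have "norm (conv u \<kappa> (x + X n) - conv u \<kappa> x - ?D (X n)) / norm (X n) = \<bar>LINT y|lborel. u y * q n (x - y)\<bar>" for n
        unfolding eq using X0 by (simp add: abs_mult)
      ultimately show "((\<lambda>h. norm (conv u \<kappa> (x + h) - conv u \<kappa> x - ?D h) / norm h) \<circ> X) \<longlonglongrightarrow> 0"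
        by (simp add: o_def)
    qed
  qed
qed

text \<open>A directional derivative of the convolution is the convolution with the directional
  derivative of the kernel, which is again smooth and supported in the same ball; hence the
  induction runs with the kernel arbitrary.\<close>

lemma conv_Ck:
  fixes u \<kappa> :: "'a::euclidean_space \<Rightarrow> real"
  assumes u: "integrable lborel u"
  shows "(\<And>k. Ck k \<kappa>) \<Longrightarrow> (\<And>x. \<kappa> x \<noteq> 0 \<Longrightarrow> x \<in> cball c r) \<Longrightarrow> Ck k (conv u \<kappa>)"
proof (induction k arbitrary: \<kappa>)
  case 0
  then have "conv u \<kappa> differentiable (at x)" for x
    using conv_has_derivative[OF u] differentiableI by blast
  then show ?case
    by (auto simp: continuous_on_eq_continuous_within intro!: differentiable_imp_continuous_within)
next
  case (Suc k)
  have der: "(conv u \<kappa> has_derivative (\<lambda>v. (LINT y|lborel. u y *\<^sub>R gradient \<kappa> (x - y)) \<bullet> v)) (at x)" for x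
    using conv_has_derivative[OF u] Suc.prems by blast
  obtain L where L: "L \<ge> 0" "\<And>x. norm (gradient \<kappa> x) \<le> L"
    using Ck_bounded_support_gradient_bounded[of \<kappa> c r] Suc.prems by blast
  have d: "\<kappa> differentiable (at x)" for x using Suc.prems(1)[of "Suc 0"] by simp
  have [measurable]: "u \<in> borel_measurable borel" "gradient \<kappa> \<in> borel_measurable borel"
    using u Ck_gradient_continuous[OF Suc.prems(1)]
    by (auto intro: borel_measurable_continuous_onI)
  have ig: "integrable lborel (\<lambda>y. u y *\<^sub>R gradient \<kappa> (x - y))" for x
  proof (rule Bochner_Integration.integrable_bound)
    show "integrable lborel (\<lambda>y. L * u y)" using u by simp
    show "AE y in lborel. norm (u y *\<^sub>R gradient \<kappa> (x - y)) \<le> norm (L * u y)"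
      using L by (intro AE_I2) (auto simp: abs_mult mult.commute[of L] intro!: mult_left_mono)
  qed simp
  have eq: "frechet_derivative (conv u \<kappa>) (at x) v = conv u (\<lambda>x. frechet_derivative \<kappa> (at x) v) x" for x v
  proof -
    have "frechet_derivative (conv u \<kappa>) (at x) v = (LINT y|lborel. u y *\<^sub>R gradient \<kappa> (x - y)) \<bullet> v"
      using frechet_derivative_at[OF der[of x]] by metis
    also have "\<dots> = (LINT y|lborel. (u y *\<^sub>R gradient \<kappa> (x - y)) \<bullet> v)"
      by (rule integral_inner_left[of v lborel, OF ig, symmetric])
    finally show ?thesis by (simp add: conv_def gradient_inner[OF d])
  qed
  have "Ck k (conv u (\<lambda>x. frechet_derivative \<kappa> (at x) v))" for v
  proof (rule Suc.IH)
    show "Ck j (\<lambda>x. frechet_derivative \<kappa> (at x) v)" for j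
      using Suc.prems(1)[of "Suc j"] by simp
    show "x \<in> cball c r" if "frechet_derivative \<kappa> (at x) v \<noteq> 0" for x
      using that frechet_derivative_0_outside[OF closed_cball Suc.prems(2)] by metis
  qed
  then show ?case using der by (auto simp: eq[abs_def] differentiable_def)
qed

lemma mollifier_support_cball: "r > 0 \<Longrightarrow> mollifier r x \<noteq> 0 \<Longrightarrow> x \<in> cball 0 r"
  using mollifier_support[of r x] by simp

lemma mollifier_bounded:
  obtains B where "B \<ge> 0" "\<And>x::'a::euclidean_space. \<bar>mollifier r x\<bar> \<le> B"
proof (cases "r > 0")
  case True
  from Ck_bounded_support_bounded[OF mollifier_Ck mollifier_support_cball[OF True]] show ?thesis
    using that by metis
next
  case False
  have "\<bar>mollifier r x\<bar> \<le> 1 / \<bar>LINT y|lborel. bump (0::'a) r y\<bar>" for x :: 'a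
    by (auto simp: mollifier_def abs_mult bump_nonneg bump_le_1 intro!: divide_right_mono)
  then show ?thesis using that[of "1 / \<bar>LINT y|lborel. bump (0::'a) r y\<bar>"] by auto
qed

text \<open>The difference is an average of f(y) - f(x) with weights of total mass 1. Jensen and
  Fubini bound the integral of its p-th power by an average of the same integrals for translates of
  \<open>f\<close> by vectors shorter than \<open>r\<close>.\<close>

lemma conv_mollifier_Lp:
  fixes f :: "'a::euclidean_space \<Rightarrow> real"
  assumes f: "integrable lborel f" and p: "p \<ge> 1" and fp: "(\<integral>\<^sup>+x. \<bar>f x\<bar> powr p \<partial>lborel) < \<infinity>"
  shows "((\<lambda>r. \<integral>\<^sup>+x. \<bar>conv f (mollifier r) x - f x\<bar> powr p \<partial>lborel) \<longlongrightarrow> 0) (at_right 0)"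
proof (rule ennreal_tendsto_0I)
  fix e :: real assume e: "e > 0"
  have [measurable]: "f \<in> borel_measurable borel" using f by auto
  obtain d where d: "d > 0" "\<And>z. norm z < d \<Longrightarrow> (\<integral>\<^sup>+x. \<bar>f (x + z) - f x\<bar> powr p \<partial>lborel) \<le> ennreal e"
    using ennreal_tendsto_0D[OF translation_Lp[OF f p fp] e] unfolding eventually_nhds_metric
    by (auto simp: dist_norm)
  have "(\<integral>\<^sup>+x. \<bar>conv f (mollifier r) x - f x\<bar> powr p \<partial>lborel) \<le> ennreal e" if r: "0 < r" "r < d" for r
  proof -
    define m where "m = (mollifier r :: 'a \<Rightarrow> real)"
    have [measurable]: "m \<in> borel_measurable borel" by (simp add: m_def)
    have m0: "m x \<ge> 0" for x using r by (simp add: m_def mollifier_nonneg)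
    have m1: "(\<integral>\<^sup>+y. m (x - y) \<partial>lborel) = 1" for x
      using nn_integral_reflect[of "\<lambda>y. ennreal (m y)" x] mollifier_nn_integral[OF r(1), where 'a = 'a] by (simp add: m_def)
    have mi: "integrable lborel (\<lambda>y. m (x - y))" for x
      using m0 m1[of x] by (intro integrableI_nonneg) auto
    have m1': "(LINT y|lborel. m (x - y)) = 1" for x
      using m0 m1[of x] by (subst integral_eq_nn_integral) auto
    obtain B where "B \<ge> 0" and B: "\<And>x::'a. \<bar>m x\<bar> \<le> B"
      unfolding m_def by (rule mollifier_bounded[of r]) blast
    have "integrable lborel (\<lambda>y. f y * m (x - y))" for x
      by (rule integrable_mult_kernel[OF f _ B]) simp
    then have c: "conv f m x - f x = (LINT y|lborel. m (x - y) * (f y - f x))" for x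
      using mi[of x] m1'[of x] by (simp add: conv_def right_diff_distrib mult.commute)
    have "(\<integral>\<^sup>+x. \<bar>conv f m x - f x\<bar> powr p \<partial>lborel)
        \<le> (\<integral>\<^sup>+x. \<integral>\<^sup>+y. m (x - y) * \<bar>f y - f x\<bar> powr p \<partial>lborel \<partial>lborel)"
      unfolding c using p m0 m1 by (intro nn_integral_mono jensen_powr) auto
    also have "\<dots> = (\<integral>\<^sup>+x. \<integral>\<^sup>+z. m z * \<bar>f (x - z) - f x\<bar> powr p \<partial>lborel \<partial>lborel)"
    proof (rule nn_integral_cong)
      fix x
      show "(\<integral>\<^sup>+y. m (x - y) * \<bar>f y - f x\<bar> powr p \<partial>lborel) = (\<integral>\<^sup>+z. m z * \<bar>f (x - z) - f x\<bar> powr p \<partial>lborel)"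
        using nn_integral_reflect[of "\<lambda>z. ennreal (m z * \<bar>f (x - z) - f x\<bar> powr p)" x] by simp
    qed
    also have "\<dots> = (\<integral>\<^sup>+z. \<integral>\<^sup>+x. m z * \<bar>f (x - z) - f x\<bar> powr p \<partial>lborel \<partial>lborel)"
      by (rule lborel_pair.Fubini') measurable
    also have "\<dots> \<le> (\<integral>\<^sup>+z. ennreal (m z) * ennreal e \<partial>lborel)"
    proof (rule nn_integral_mono)
      fix z
      have "(\<integral>\<^sup>+x. m z * \<bar>f (x - z) - f x\<bar> powr p \<partial>lborel)
          = ennreal (m z) * (\<integral>\<^sup>+x. \<bar>f (x + (- z)) - f x\<bar> powr p \<partial>lborel)"
        using m0 by (subst nn_integral_cmult[symmetric]) (auto simp: ennreal_mult)
      also have "\<dots> \<le> ennreal (m z) * ennreal e"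
      proof (cases "m z = 0")
        case False
        then have "norm (- z) < d" using mollifier_support[OF r(1), of z] r by (simp add: m_def)
        then show ?thesis by (intro mult_left_mono d) auto
      qed simp
      finally show "(\<integral>\<^sup>+x. m z * \<bar>f (x - z) - f x\<bar> powr p \<partial>lborel) \<le> ennreal (m z) * ennreal e" .
    qed
    also have "\<dots> = ennreal e"
      using mollifier_nn_integral[OF r(1), where 'a = 'a] by (subst nn_integral_multc) (auto simp: m_def)
    finally show ?thesis by (simp add: m_def)
  qed
  then show "eventually (\<lambda>r. (\<integral>\<^sup>+x. \<bar>conv f (mollifier r) x - f x\<bar> powr p \<partial>lborel) \<le> ennreal e) (at_right 0)"
    using d(1) unfolding eventually_at_right_field by blast
qed

text \<open>Reduces L^p bounds on vector fields to their components, since \<open>conv\<close> acts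
  on real functions.\<close>

lemma norm_powr_le_sum:
  fixes v :: "'a::euclidean_space"
  assumes "p \<ge> 0"
  shows "norm v powr p \<le> real DIM('a) powr p * (\<Sum>i\<in>Basis. \<bar>v \<bullet> i\<bar> powr p)"
proof -
  obtain j :: 'a where j: "j \<in> Basis" "\<And>i. i \<in> Basis \<Longrightarrow> \<bar>v \<bullet> i\<bar> \<le> \<bar>v \<bullet> j\<bar>"
  proof -
    have "Max ((\<lambda>i. \<bar>v \<bullet> i\<bar>) ` Basis) \<in> (\<lambda>i. \<bar>v \<bullet> i\<bar>) ` Basis" by (intro Max_in) auto
    then obtain j where "j \<in> Basis" "Max ((\<lambda>i. \<bar>v \<bullet> i\<bar>) ` Basis) = \<bar>v \<bullet> j\<bar>" by blast
    then show ?thesis using that[of j] by (metis Max_ge finite_Basis finite_imageI imageI)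
  qed
  have "norm v \<le> (\<Sum>i\<in>Basis. \<bar>v \<bullet> i\<bar>)" by (rule norm_le_l1)
  also have "\<dots> \<le> real DIM('a) * \<bar>v \<bullet> j\<bar>" using sum_bounded_above[of Basis "\<lambda>i. \<bar>v \<bullet> i\<bar>" "\<bar>v \<bullet> j\<bar>"] j by simp
  finally have "norm v powr p \<le> (real DIM('a) * \<bar>v \<bullet> j\<bar>) powr p" using assms by (intro powr_mono2) auto
  also have "\<dots> = real DIM('a) powr p * \<bar>v \<bullet> j\<bar> powr p" by (simp add: powr_mult)
  also have "\<dots> \<le> real DIM('a) powr p * (\<Sum>i\<in>Basis. \<bar>v \<bullet> i\<bar> powr p)"
    using j by (intro mult_left_mono member_le_sum) auto
  finally show ?thesis .
qed

text \<open>For x in the smaller ball and r < R' - R the mollifier centred at x is a test function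
  in \<open>\<Omega>\<close>, so the gradient of the mollified \<open>u\<close> is there the
  mollified weak gradient. Cutting \<open>D\<close> off outside the larger ball gives components
  that are integrable on the whole space, to which the L^p convergence of mollifications
  applies.\<close>

lemma conv_gradient_tendsto:
  fixes u :: "'a::euclidean_space \<Rightarrow> real" and D :: "'a \<Rightarrow> 'a"
  assumes u: "integrable lborel u" and D [measurable]: "D \<in> borel_measurable borel"
    and weak: "\<And>\<phi>. \<phi> \<in> test_functions \<Omega> \<Longrightarrow> (LINT x|lborel. u x *\<^sub>R gradient \<phi> x) = - (LINT x|lborel. \<phi> x *\<^sub>R D x)"
    and sub: "cball c R' \<subseteq> \<Omega>" and R: "R < R'" and p: "p \<ge> 1"
    and Dp: "(\<integral>\<^sup>+x. indicator (cball c R') x * norm (D x) powr p \<partial>lborel) < \<infinity>"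
  shows "((\<lambda>r. \<integral>\<^sup>+x. indicator (cball c R) x * norm (gradient (conv u (mollifier r)) x - D x) powr p \<partial>lborel) \<longlongrightarrow> 0) (at_right 0)"
proof -
  define f where "f i y = indicator (cball c R') y * (D y \<bullet> i)" for i y
  have [measurable]: "cball c R' \<in> sets borel" by simp
  have [measurable]: "f i \<in> borel_measurable borel" for i unfolding f_def by measurable
  have fp: "(\<integral>\<^sup>+x. \<bar>f i x\<bar> powr p \<partial>lborel) < \<infinity>" if "i \<in> Basis" for i
  proof (rule le_less_trans[OF nn_integral_mono Dp])
    show "ennreal (\<bar>f i x\<bar> powr p) \<le> ennreal (indicator (cball c R') x * norm (D x) powr p)" for x
      using p Basis_le_norm[OF that, of "D x"]
      by (intro ennreal_leI) (auto simp: f_def indicator_def intro!: powr_mono2)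
  qed
  have fi: "integrable lborel (f i)" if "i \<in> Basis" for i
  proof (rule integrableI_bounded)
    have "(\<integral>\<^sup>+x. norm (f i x) \<partial>lborel) \<le> (\<integral>\<^sup>+x. indicator (cball c R') x + ennreal (\<bar>f i x\<bar> powr p) \<partial>lborel)"
    proof (rule nn_integral_mono)
      fix x
      show "ennreal (norm (f i x)) \<le> indicator (cball c R') x + ennreal (\<bar>f i x\<bar> powr p)"
      proof (cases "\<bar>f i x\<bar> \<le> 1")
        case True
        then show ?thesis
          by (cases "x \<in> cball c R'") (auto simp: f_def add_increasing2)
      next
        case False
        then have "\<bar>f i x\<bar> powr 1 \<le> \<bar>f i x\<bar> powr p" using p by (intro powr_mono) auto
        then show ?thesis by (intro add_increasing) (auto intro: ennreal_leI)
      qed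
    qed
    also have "\<dots> = emeasure lborel (cball c R') + (\<integral>\<^sup>+x. \<bar>f i x\<bar> powr p \<partial>lborel)"
      by (simp add: nn_integral_add)
    also have "\<dots> < \<infinity>" using fp[OF that] emeasure_bounded_finite[OF bounded_cball] by simp
    finally show "(\<integral>\<^sup>+x. norm (f i x) \<partial>lborel) < \<infinity>" .
  qed simp
  have grad: "gradient (conv u (mollifier r)) x \<bullet> i = conv (f i) (mollifier r) x"
    if r: "0 < r" "r < R' - R" and x: "x \<in> cball c R" and i: "i \<in> Basis" for r x i
  proof -
    let ?m = "mollifier r :: 'a \<Rightarrow> real"
    note supp = mollifier_support_cball[OF r(1)]
    have md: "?m differentiable (at y)" for y by (rule Ck_differentiable[OF mollifier_Ck])
    have sub': "cball x r \<subseteq> cball c R'"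
      using r x by (smt (verit) dist_commute dist_triangle mem_cball subsetI)
    let ?\<phi> = "\<lambda>y. ?m (x - y)"
    have "?\<phi> \<in> test_functions \<Omega>"
    proof (rule test_functionsI)
      \<comment> \<open>The kernel depends on the squared norm, so its reflection about
        \<open>x\<close> is a multiple of \<open>bump x r\<close>.\<close>
      have "?\<phi> = (\<lambda>y. (1 / (LINT y|lborel. bump (0::'a) r y)) * bump x r y)"
        by (simp add: mollifier_def bump_def inner_diff_left inner_diff_right inner_commute algebra_simps)
      then show "Ck k ?\<phi>" for k by (simp only: Ck_mult[OF Ck_const bump_Ck])
      show "y \<in> cball x r" if "?\<phi> y \<noteq> 0" for y
        using supp[OF that] by (simp add: dist_norm norm_minus_commute)
      show "cball x r \<subseteq> \<Omega>" using sub sub' by blast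
    qed
    from weak[OF this] have w: "(LINT y|lborel. u y *\<^sub>R gradient ?\<phi> y) = - (LINT y|lborel. ?\<phi> y *\<^sub>R D y)" .
    have g\<phi>: "gradient ?\<phi> y = - gradient ?m (x - y)" for y
    proof (rule gradient_eqI)
      have "((\<lambda>y. x - y) has_derivative (\<lambda>v. - v)) (at y)" by (auto intro!: derivative_eq_intros)
      from has_derivative_compose[OF this has_derivative_gradient[OF md]]
      show "(?\<phi> has_derivative (\<lambda>v. - gradient ?m (x - y) \<bullet> v)) (at y)" by simp
    qed
    have g: "gradient (conv u ?m) x = (LINT y|lborel. u y *\<^sub>R gradient ?m (x - y))"
      by (rule gradient_eqI, rule conv_has_derivative[OF u mollifier_Ck supp])
    also have "\<dots> = (LINT y|lborel. ?\<phi> y *\<^sub>R D y)" using w by (simp add: g\<phi>)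
    finally have g: "gradient (conv u ?m) x = (LINT y|lborel. ?\<phi> y *\<^sub>R D y)" .
    have phi_eq: "?\<phi> y *\<^sub>R D y = (\<Sum>i\<in>Basis. (f i y * ?m (x - y)) *\<^sub>R i)" for y
    proof (cases "y \<in> cball c R'")
      case True
      have "?\<phi> y *\<^sub>R D y = ?\<phi> y *\<^sub>R (\<Sum>i\<in>Basis. (D y \<bullet> i) *\<^sub>R i)" by (simp add: euclidean_representation)
      then show ?thesis using True by (simp add: f_def scaleR_sum_right mult.commute)
    next
      case False
      then have "y \<notin> cball x r" using sub' by blast
      then have "?m (x - y) = 0" using supp[of "x - y"] by (auto simp: dist_norm norm_minus_commute)
      then show ?thesis by simp
    qed
    obtain B where "B \<ge> 0" and B: "\<And>x::'a. \<bar>?m x\<bar> \<le> B" by (rule mollifier_bounded[of r]) blast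
    have fmi: "integrable lborel (\<lambda>y. f j y * ?m (x - y))" if "j \<in> Basis" for j
      by (rule integrable_mult_kernel[OF fi[OF that] _ B]) simp
    have "(LINT y|lborel. ?\<phi> y *\<^sub>R D y) = (\<Sum>j\<in>Basis. conv (f j) ?m x *\<^sub>R j)"
      unfolding phi_eq conv_def using fmi by (simp add: Bochner_Integration.integral_sum)
    then have "gradient (conv u ?m) x \<bullet> i = (\<Sum>j\<in>Basis. conv (f j) ?m x * (j \<bullet> i))"
      using g by (simp add: inner_sum_left)
    also have "\<dots> = conv (f i) ?m x"
      using i by (simp add: inner_Basis if_distrib cong: if_cong)
    finally show ?thesis .
  qed
  let ?C = "ennreal (real DIM('a) powr p)"
  have "((\<lambda>r. ?C * (\<Sum>i\<in>Basis. \<integral>\<^sup>+x. \<bar>conv (f i) (mollifier r) x - f i x\<bar> powr p \<partial>lborel)) \<longlongrightarrow> ?C * (\<Sum>i\<in>(Basis::'a set). 0)) (at_right 0)"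
    by (intro ennreal_tendsto_cmult tendsto_sum conv_mollifier_Lp fi fp p) auto
  then have lim: "((\<lambda>r. ?C * (\<Sum>i\<in>Basis. \<integral>\<^sup>+x. \<bar>conv (f i) (mollifier r) x - f i x\<bar> powr p \<partial>lborel)) \<longlongrightarrow> 0) (at_right 0)"
    by simp
  have ev: "(\<integral>\<^sup>+x. indicator (cball c R) x * norm (gradient (conv u (mollifier r)) x - D x) powr p \<partial>lborel)
      \<le> ?C * (\<Sum>i\<in>Basis. \<integral>\<^sup>+x. \<bar>conv (f i) (mollifier r) x - f i x\<bar> powr p \<partial>lborel)"
    if r: "0 < r" "r < R' - R" for r
  proof -
    have cc: "conv (f i) (mollifier r) \<in> borel_measurable borel" if "i \<in> Basis" for i
      by (rule Ck_borel_measurable[of 0], rule conv_Ck[OF fi[OF that] mollifier_Ck mollifier_support_cball[OF r(1)]])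
    have "(\<integral>\<^sup>+x. indicator (cball c R) x * norm (gradient (conv u (mollifier r)) x - D x) powr p \<partial>lborel)
      \<le> (\<integral>\<^sup>+x. ?C * (\<Sum>i\<in>Basis. ennreal (\<bar>conv (f i) (mollifier r) x - f i x\<bar> powr p)) \<partial>lborel)"
    proof (rule nn_integral_mono)
      fix x
      show "ennreal (indicator (cball c R) x * norm (gradient (conv u (mollifier r)) x - D x) powr p)
          \<le> ?C * (\<Sum>i\<in>Basis. ennreal (\<bar>conv (f i) (mollifier r) x - f i x\<bar> powr p))"
      proof (cases "x \<in> cball c R")
        case True
        then have xR': "x \<in> cball c R'" using R by auto
        have "norm (gradient (conv u (mollifier r)) x - D x) powr p
            \<le> real DIM('a) powr p * (\<Sum>i\<in>Basis. \<bar>(gradient (conv u (mollifier r)) x - D x) \<bullet> i\<bar> powr p)"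
          using p by (intro norm_powr_le_sum) simp
        also have "(\<Sum>i\<in>Basis. \<bar>(gradient (conv u (mollifier r)) x - D x) \<bullet> i\<bar> powr p)
            = (\<Sum>i\<in>Basis. \<bar>conv (f i) (mollifier r) x - f i x\<bar> powr p)"
          using grad[OF r True] xR' by (intro sum.cong) (auto simp: inner_diff_left f_def)
        finally show ?thesis using True
          by (simp add: ennreal_mult[symmetric] sum_nonneg sum_ennreal ennreal_leI)
      qed simp
    qed
    also have "\<dots> = ?C * (\<Sum>i\<in>Basis. \<integral>\<^sup>+x. \<bar>conv (f i) (mollifier r) x - f i x\<bar> powr p \<partial>lborel)"
      using cc by (simp add: nn_integral_cmult nn_integral_sum del: sum_ennreal)
    finally show ?thesis .
  qed
  show ?thesis
  proof (rule tendsto_sandwich[OF _ _ tendsto_const lim])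
    show "eventually (\<lambda>r. (\<integral>\<^sup>+x. indicator (cball c R) x * norm (gradient (conv u (mollifier r)) x - D x) powr p \<partial>lborel)
      \<le> ?C * (\<Sum>i\<in>Basis. \<integral>\<^sup>+x. \<bar>conv (f i) (mollifier r) x - f i x\<bar> powr p \<partial>lborel)) (at_right 0)"
      using ev R unfolding eventually_at_right_field by (intro exI[of _ "R' - R"]) auto
  qed simp
qed

text \<open>The product of a null set with a sigma-finite space is null. Together with its twin this
  moves almost everywhere statements about a function to pairs of points, both for
  \<open>lborel\<close> and for \<open>lebesgue\<close>.\<close>

lemma (in sigma_finite_measure) AE_pair_fst:
  assumes "AE x in N. P x" shows "AE z in N \<Otimes>\<^sub>M M. P (fst z)"
proof -
  obtain S where S: "{x \<in> space N. \<not> P x} \<subseteq> S" "S \<in> sets N" "emeasure N S = 0"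
    using AE_E[OF assms] by blast
  have "emeasure (N \<Otimes>\<^sub>M M) (S \<times> space M) = 0"
    using S by (subst emeasure_pair_measure_Times) auto
  then show ?thesis
    using S by (intro AE_I[where N = "S \<times> space M"]) (auto simp: space_pair_measure)
qed

lemma (in sigma_finite_measure) AE_pair_snd:
  assumes "AE x in M. P x" shows "AE z in N \<Otimes>\<^sub>M M. P (snd z)"
proof -
  obtain S where S: "{x \<in> space M. \<not> P x} \<subseteq> S" "S \<in> sets M" "emeasure M S = 0"
    using AE_E[OF assms] by blast
  have "emeasure (N \<Otimes>\<^sub>M M) (space N \<times> S) = 0"
    using S by (subst emeasure_pair_measure_Times) auto
  then show ?thesis
    using S by (intro AE_I[where N = "space N \<times> S"]) (auto simp: space_pair_measure)
qed

text \<open>Replaces Hoelder's inequality for lowering exponents on sets of finite measure.\<close>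

lemma powr_le_1_add_powr:
  fixes t q p :: real
  assumes "0 \<le> t" "0 \<le> q" "q \<le> p"
  shows "t powr q \<le> 1 + t powr p"
proof (cases "t \<le> 1")
  case True
  then have "t powr q \<le> 1 powr q" using assms by (intro powr_mono2) auto
  then show ?thesis by (simp add: add_increasing2)
next
  case False
  then have "t powr q \<le> t powr p" using assms by (intro powr_mono) auto
  then show ?thesis by simp
qed

lemma nn_integral_powr_lower_exponent:
  fixes D :: "'a::euclidean_space \<Rightarrow> 'b::euclidean_space"
  assumes [measurable]: "D \<in> borel_measurable borel"
    and q: "0 \<le> q" "q \<le> p" and "(\<integral>\<^sup>+x. indicator (cball c R) x * norm (D x) powr p \<partial>lborel) < \<infinity>"
  shows "(\<integral>\<^sup>+x. indicator (cball c R) x * norm (D x) powr q \<partial>lborel) < \<infinity>"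
proof -
  have [measurable]: "cball c R \<in> sets borel" by simp
  have "(\<integral>\<^sup>+x. indicator (cball c R) x * norm (D x) powr q \<partial>lborel)
      \<le> (\<integral>\<^sup>+x. indicator (cball c R) x + ennreal (indicator (cball c R) x * norm (D x) powr p) \<partial>lborel)"
  proof (rule nn_integral_mono)
    fix x
    have "ennreal (norm (D x) powr q) \<le> ennreal (1 + norm (D x) powr p)"
      using q by (intro ennreal_leI powr_le_1_add_powr) auto
    then show "ennreal (indicator (cball c R) x * norm (D x) powr q)
        \<le> indicator (cball c R) x + ennreal (indicator (cball c R) x * norm (D x) powr p)"
      by (auto simp: indicator_def)
  qed
  also have "\<dots> = emeasure lborel (cball c R) + (\<integral>\<^sup>+x. indicator (cball c R) x * norm (D x) powr p \<partial>lborel)"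
    by (simp add: nn_integral_add)
  also have "\<dots> < \<infinity>" using assms emeasure_bounded_finite[OF bounded_cball] by simp
  finally show ?thesis .
qed

text \<open>The gradients converge along all radii tending to 0, the functions pointwise along a
  subsequence extracted from L^1 convergence. Both exponents are recorded: \<open>p\<close> is for
  the local term, \<open>q\<close> for the Gagliardo seminorm.\<close>

lemma smooth_approximation:
  fixes u :: "'a::euclidean_space \<Rightarrow> real" and D :: "'a \<Rightarrow> 'a"
  assumes u: "integrable lborel u" "\<And>x. u x \<ge> 0" and D [measurable]: "D \<in> borel_measurable borel"
    and weak: "\<And>\<phi>. \<phi> \<in> test_functions \<Omega> \<Longrightarrow> (LINT x|lborel. u x *\<^sub>R gradient \<phi> x) = - (LINT x|lborel. \<phi> x *\<^sub>R D x)"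
    and sub: "cball c R' \<subseteq> \<Omega>" and R: "R < R'" and p: "1 \<le> q" "q \<le> p"
    and Dp: "(\<integral>\<^sup>+x. indicator (cball c R') x * norm (D x) powr p \<partial>lborel) < \<infinity>"
  obtains uk :: "nat \<Rightarrow> 'a \<Rightarrow> real" where "\<And>k j. Ck j (uk k)" "\<And>k x. uk k x \<ge> 0"
    "AE x in lborel. (\<lambda>k. uk k x) \<longlonglongrightarrow> u x"
    "(\<lambda>k. \<integral>\<^sup>+x. indicator (cball c R) x * norm (gradient (uk k) x - D x) powr p \<partial>lborel) \<longlonglongrightarrow> 0"
    "(\<lambda>k. \<integral>\<^sup>+x. indicator (cball c R) x * norm (gradient (uk k) x - D x) powr q \<partial>lborel) \<longlonglongrightarrow> 0"
proof -
  have [measurable]: "u \<in> borel_measurable borel" using u by auto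
  have "(\<integral>\<^sup>+x. ennreal \<bar>u x\<bar> \<partial>lborel) < \<infinity>" using u by (simp add: integrable_iff_bounded)
  then have u1: "((\<lambda>r. \<integral>\<^sup>+x. \<bar>conv u (mollifier r) x - u x\<bar> \<partial>lborel) \<longlongrightarrow> 0) (at_right 0)"
    using conv_mollifier_Lp[OF u(1), of 1] by simp
  then obtain d where d: "d > 0"
    "\<And>r. 0 < r \<Longrightarrow> r < d \<Longrightarrow> (\<integral>\<^sup>+x. \<bar>conv u (mollifier r) x - u x\<bar> \<partial>lborel) \<le> ennreal 1"
    using ennreal_tendsto_0D[OF u1, of 1] unfolding eventually_at_right_field by auto
  \<comment> \<open>The denominator starts at 2, so every radius is strictly below \<open>d\<close>
    and every \<open>v n - u\<close> is integrable, as the extraction of an almost everywhere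
    convergent subsequence demands.\<close>
  define \<rho> where "\<rho> n = d / real (n + 2)" for n :: nat
  have \<rho>: "0 < \<rho> n" "\<rho> n < d" for n using d(1) by (auto simp: \<rho>_def divide_less_eq add_pos_nonneg mult_less_cancel_left1)
  have "\<rho> \<longlonglongrightarrow> 0"
    unfolding \<rho>_def by (rule LIMSEQ_ignore_initial_segment[OF lim_const_over_n])
  then have \<rho>lim: "filterlim \<rho> (at_right 0) sequentially"
    using \<rho>(1) less_imp_neq[OF \<rho>(1)] by (auto simp: filterlim_at dest: sym)
  define v where "v n = conv u (mollifier (\<rho> n))" for n
  have vC: "Ck j (v n)" for j n
    unfolding v_def by (rule conv_Ck[OF u(1) mollifier_Ck mollifier_support_cball[OF \<rho>(1)]])
  then have [measurable]: "v n \<in> borel_measurable borel" for n using Ck_borel_measurable by blast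
  have v0: "v n x \<ge> 0" for n x
    unfolding v_def conv_def by (intro integral_nonneg_AE AE_I2 mult_nonneg_nonneg u mollifier_nonneg \<rho>)
  have vi: "integrable lborel (\<lambda>x. v n x - u x)" for n
    using d(2)[OF \<rho>, of n] by (intro integrableI_bounded) (auto simp: v_def[symmetric] intro: le_less_trans)
  have "(\<lambda>n. \<integral>\<^sup>+x. \<bar>v n x - u x\<bar> \<partial>lborel) \<longlonglongrightarrow> 0"
    using filterlim_compose[OF u1 \<rho>lim] by (simp add: v_def)
  then have "(\<lambda>n. ennreal (LINT x|lborel. norm (v n x - u x))) \<longlonglongrightarrow> ennreal 0"
    using vi by (subst nn_integral_eq_integral[symmetric]) auto
  then have "(\<lambda>n. LINT x|lborel. norm (v n x - u x)) \<longlonglongrightarrow> 0"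
    by (subst (asm) tendsto_ennreal_iff) (auto intro!: integral_nonneg_AE)
  then obtain \<sigma> :: "nat \<Rightarrow> nat" where \<sigma>: "strict_mono \<sigma>" "AE x in lborel. (\<lambda>n. v (\<sigma> n) x - u x) \<longlonglongrightarrow> 0"
    using tendsto_L1_AE_subseq[of lborel "\<lambda>n x. v n x - u x"] vi by blast
  have \<sigma>lim: "filterlim (\<lambda>n. \<rho> (\<sigma> n)) (at_right 0) sequentially"
    using filterlim_compose[OF \<rho>lim filterlim_subseq[OF \<sigma>(1)]] by simp
  have p1: "1 \<le> p" and q0: "0 \<le> q" using p by auto
  have Dq: "(\<integral>\<^sup>+x. indicator (cball c R') x * norm (D x) powr q \<partial>lborel) < \<infinity>"
    by (rule nn_integral_powr_lower_exponent[OF D q0 p(2) Dp])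
  show ?thesis
  proof (rule that[of "\<lambda>k. v (\<sigma> k)"])
    show "AE x in lborel. (\<lambda>k. v (\<sigma> k) x) \<longlonglongrightarrow> u x"
      using \<sigma>(2) by eventually_elim (simp add: LIM_zero_iff)
    show "(\<lambda>k. \<integral>\<^sup>+x. indicator (cball c R) x * norm (gradient (v (\<sigma> k)) x - D x) powr p \<partial>lborel) \<longlonglongrightarrow> 0"
      unfolding v_def
      by (rule filterlim_compose[OF conv_gradient_tendsto[OF u(1) D weak sub R p1 Dp] \<sigma>lim])
    show "(\<lambda>k. \<integral>\<^sup>+x. indicator (cball c R) x * norm (gradient (v (\<sigma> k)) x - D x) powr q \<partial>lborel) \<longlonglongrightarrow> 0"
      unfolding v_def
      by (rule filterlim_compose[OF conv_gradient_tendsto[OF u(1) D weak sub R p(1) Dq] \<sigma>lim])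
  qed (use vC v0 in auto)
qed

text \<open>Both fields are the L^1 limit of the gradients of the same mollifications. This
  identifies the gradient for which the equation is stated, known to be locally integrable, with the
  one that is locally in L^p.\<close>

lemma weak_gradient_unique_cball:
  fixes u :: "'a::euclidean_space \<Rightarrow> real" and D E :: "'a \<Rightarrow> 'a"
  assumes u: "integrable lborel u" and [measurable]: "D \<in> borel_measurable borel" "E \<in> borel_measurable borel"
    and weakD: "\<And>\<phi>. \<phi> \<in> test_functions \<Omega> \<Longrightarrow> (LINT x|lborel. u x *\<^sub>R gradient \<phi> x) = - (LINT x|lborel. \<phi> x *\<^sub>R D x)"
    and weakE: "\<And>\<phi>. \<phi> \<in> test_functions \<Omega> \<Longrightarrow> (LINT x|lborel. u x *\<^sub>R gradient \<phi> x) = - (LINT x|lborel. \<phi> x *\<^sub>R E x)"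
    and sub: "cball c R' \<subseteq> \<Omega>" and R: "R < R'"
    and D1: "(\<integral>\<^sup>+x. indicator (cball c R') x * norm (D x) \<partial>lborel) < \<infinity>"
    and E1: "(\<integral>\<^sup>+x. indicator (cball c R') x * norm (E x) \<partial>lborel) < \<infinity>"
  shows "AE x in lborel. x \<in> cball c R \<longrightarrow> D x = E x"
proof -
  have [measurable]: "cball c R \<in> sets borel" by simp
  let ?I = "\<lambda>r D. \<integral>\<^sup>+x. indicator (cball c R) x * norm (gradient (conv u (mollifier r)) x - D x) \<partial>lborel"
  have "((\<lambda>r. ?I r D) \<longlongrightarrow> 0) (at_right 0)" "((\<lambda>r. ?I r E) \<longlongrightarrow> 0) (at_right 0)"
    using conv_gradient_tendsto[OF u _ weakD sub R, of 1] conv_gradient_tendsto[OF u _ weakE sub R, of 1] D1 E1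
    by simp_all
  then have "((\<lambda>r. ?I r D + ?I r E) \<longlongrightarrow> 0 + 0) (at_right 0)" by (intro tendsto_add)
  moreover have "eventually (\<lambda>r. (\<integral>\<^sup>+x. indicator (cball c R) x * norm (D x - E x) \<partial>lborel) \<le> ?I r D + ?I r E) (at_right 0)"
  proof -
    have "(\<integral>\<^sup>+x. indicator (cball c R) x * norm (D x - E x) \<partial>lborel) \<le> ?I r D + ?I r E" if r: "r > 0" for r
    proof -
      let ?g = "gradient (conv u (mollifier r))"
      have "Ck (Suc 0) (conv u (mollifier r))"
        by (rule conv_Ck[OF u mollifier_Ck mollifier_support_cball[OF r]])
      then have [measurable]: "?g \<in> borel_measurable borel"
        by (intro borel_measurable_continuous_onI Ck_gradient_continuous)
      have "(\<integral>\<^sup>+x. indicator (cball c R) x * norm (D x - E x) \<partial>lborel)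
          \<le> (\<integral>\<^sup>+x. ennreal (indicator (cball c R) x * norm (?g x - D x)) + ennreal (indicator (cball c R) x * norm (?g x - E x)) \<partial>lborel)"
      proof (rule nn_integral_mono)
        fix x
        have "norm (D x - E x) \<le> norm (?g x - D x) + norm (?g x - E x)"
          using norm_triangle_ineq4[of "?g x - E x" "?g x - D x"] by simp
        then show "ennreal (indicator (cball c R) x * norm (D x - E x))
          \<le> ennreal (indicator (cball c R) x * norm (?g x - D x)) + ennreal (indicator (cball c R) x * norm (?g x - E x))"
          by (auto simp: indicator_def simp flip: ennreal_plus)
      qed
      also have "\<dots> = ?I r D + ?I r E" by (rule nn_integral_add) measurable
      finally show ?thesis .
    qed
    then show ?thesis unfolding eventually_at_right_field by (intro exI[of _ 1]) auto
  qed
  ultimately have "(\<integral>\<^sup>+x. indicator (cball c R) x * norm (D x - E x) \<partial>lborel) \<le> 0"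
    by (intro tendsto_lowerbound[where F = "at_right (0::real)"]) auto
  then have "(\<integral>\<^sup>+x. indicator (cball c R) x * norm (D x - E x) \<partial>lborel) = 0" by simp
  then have "AE x in lborel. ennreal (indicator (cball c R) x * norm (D x - E x)) = 0"
    by (subst (asm) nn_integral_0_iff_AE) auto
  then show ?thesis by eventually_elim (auto simp: indicator_def split: if_splits)
qed

section \<open>The nonlocal kernel\<close>

text \<open>The profile that dominates the Gagliardo integrand of a bounded Lipschitz function: for
  a cut-off with values in [0,1] and Lipschitz constant L \<ge> 1, the q-th power of a difference is
  at most L^q min(|z|,1)^q.\<close>

definition Kernel :: "real \<Rightarrow> real \<Rightarrow> 'a::euclidean_space \<Rightarrow> real"
  where "Kernel q s z = min (norm z) 1 powr q / norm z powr (real DIM('a) + s * q)"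

lemma Kernel_borel [measurable]: "Kernel q s \<in> borel_measurable borel"
  unfolding Kernel_def by measurable

lemma dyadic_bracket:
  fixes t :: real
  assumes "t \<ge> 1"
  obtains j :: nat where "2 ^ j \<le> t" "t < 2 ^ Suc j"
proof -
  obtain n where "t < 2 ^ n" using real_arch_pow[of 2 t] by auto
  then have ex: "\<exists>n. t < 2 ^ n" by blast
  define n0 where "n0 = (LEAST n. t < 2 ^ n)"
  have n0: "t < 2 ^ n0" unfolding n0_def using LeastI_ex[OF ex] .
  then obtain j where j: "n0 = Suc j" using assms by (cases n0) auto
  have "\<not> t < 2 ^ j" using not_less_Least[of j "\<lambda>n. t < 2 ^ n"] j by (simp add: n0_def)
  then show ?thesis using that[of j] n0 j by simp
qed

lemma ennreal_le_suminf: "f j \<le> (\<Sum>j. f j)" for f :: "nat \<Rightarrow> ennreal"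
  using sum_le_suminf[of f "{j}"] by auto

text \<open>Dyadic balls replace polar coordinates. Up to constants, the kernel is at most
  2^(j(n+sq-q)) where |z| is about 2^(-j) and at most 2^(-j(n+sq)) where |z| is about 2^j.
  Multiplied by the volumes of the balls these are geometric series with ratios 2^(-(q-sq)) and
  2^(-sq), which converge since 0 < s < 1.\<close>

lemma nn_integral_Kernel_finite:
  assumes q: "1 < q" and s: "0 < s" "s < 1"
  shows "(\<integral>\<^sup>+z. Kernel q s (z :: 'a::euclidean_space) \<partial>lborel) < \<infinity>"
proof -
  define n where "n = real DIM('a)"
  define \<omega> where "\<omega> = unit_ball_vol n"
  have n: "n > 0" by (simp add: n_def)
  have \<omega>: "\<omega> \<ge> 0" using n by (simp add: \<omega>_def unit_ball_vol_nonneg)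
  define A :: "nat \<Rightarrow> real" where "A j = (1/2) powr (real j * (q - s * q) - (real j + 1) * n)" for j
  define B :: "nat \<Rightarrow> real" where "B j = (1/2) powr (real j * (n + s * q))" for j
  have vol: "emeasure lborel (ball (0::'a) r) = ennreal (\<omega> * r powr n)" if "r > 0" for r
    using emeasure_ball[of r "0::'a"] that by (simp add: \<omega>_def n_def powr_realpow)
  have le: "ennreal (Kernel q s z) \<le> (\<Sum>j. ennreal (A j) * indicator (ball 0 ((1/2) ^ j)) z)
      + (\<Sum>j. ennreal (B j) * indicator (ball 0 (2 ^ Suc j)) z)" for z :: 'a
  proof -
    consider "z = 0" | "0 < norm z" "norm z < 1" | "norm z \<ge> 1" by fastforce
    then show ?thesis
    proof cases
      case 2
      then have "1 / norm z \<ge> 1" by simp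
      then obtain j0 where "2 ^ j0 \<le> 1 / norm z" "1 / norm z < 2 ^ Suc j0" by (rule dyadic_bracket)
      then have j0: "norm z \<le> (1/2) ^ j0" "(1/2) ^ Suc j0 < norm z"
        using 2 by (auto simp: field_simps)
      \<comment> \<open>The bracket for 1/|z| allows equality in the upper bound for |z|, while the
        ball is open; if |z| equals 2^(-j0), the index is lowered by one.\<close>
      obtain j where j: "norm z < (1/2) ^ j" "(1/2) ^ Suc j \<le> norm z"
      proof (cases "norm z = (1/2) ^ j0")
        case True
        then have "j0 \<noteq> 0" using 2 by (intro notI) simp
        then obtain i where "j0 = Suc i" by (cases j0) auto
        then show ?thesis using that[of i] True by (simp add: power_strict_decreasing)
      next
        case False
        then show ?thesis using that[of j0] j0 by simp
      qed
      have z: "(1/2) powr (real j + 1) \<le> norm z" "norm z \<le> (1/2) powr (real j)"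
        using j by (simp_all add: powr_realpow powr_add)
      have "Kernel q s z = norm z powr (q - s * q) / norm z powr n"
        using 2 by (simp add: Kernel_def n_def powr_diff powr_add field_simps)
      also have "\<dots> \<le> ((1/2) powr (real j)) powr (q - s * q) / ((1/2) powr (real j + 1)) powr n"
        using 2 z q s n by (intro frac_le powr_mono2) auto
      also have "\<dots> = A j" by (simp only: A_def powr_powr powr_diff[symmetric])
      finally have "ennreal (Kernel q s z) \<le> ennreal (A j) * indicator (ball 0 ((1/2) ^ j)) z"
        using j by (simp add: ennreal_leI)
      also have "\<dots> \<le> (\<Sum>j. ennreal (A j) * indicator (ball 0 ((1/2) ^ j)) z)"
        by (rule ennreal_le_suminf)
      finally show ?thesis by (simp add: add_increasing2)
    next
      case 3
      then obtain j where j: "2 ^ j \<le> norm z" "norm z < 2 ^ Suc j" by (rule dyadic_bracket)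
      have "Kernel q s z = 1 / norm z powr (n + s * q)"
        using 3 by (simp add: Kernel_def n_def min_def)
      also have "\<dots> \<le> 1 / (2 powr (real j)) powr (n + s * q)"
        using 3 j n q s by (intro frac_le powr_mono2) (auto simp: powr_realpow)
      also have "\<dots> = B j" by (simp add: B_def powr_powr powr_divide)
      finally have "ennreal (Kernel q s z) \<le> ennreal (B j) * indicator (ball 0 (2 ^ Suc j)) z"
        using j by (simp add: ennreal_leI)
      also have "\<dots> \<le> (\<Sum>j. ennreal (B j) * indicator (ball 0 (2 ^ Suc j)) z)"
        by (rule ennreal_le_suminf)
      finally show ?thesis by (simp add: add_increasing)
    qed (simp add: Kernel_def)
  qed
  have geo: "(\<Sum>j. ennreal (C * (a powr - e) ^ j)) < \<infinity>" if "C \<ge> 0" "e > 0" "a = 2" for C a e :: real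
  proof -
    have "a powr - e < 1" using that by (simp add: powr_less_one)
    then have "summable (\<lambda>j. C * (a powr - e) ^ j)" by (intro summable_mult summable_geometric) auto
    then show ?thesis using that by (subst suminf_ennreal2) auto
  qed
  have pw: "(2 powr - e) ^ j = 2 powr (- (real j * e))" for e :: real and j :: nat
    by (subst powr_realpow[symmetric]) (simp_all add: powr_powr mult.commute)
  have half: "(1/2) powr x = 2 powr (- x)" for x :: real by (simp add: powr_divide powr_minus_divide)
  have "(\<integral>\<^sup>+z. Kernel q s (z :: 'a) \<partial>lborel)
      \<le> (\<integral>\<^sup>+z. (\<Sum>j. ennreal (A j) * indicator (ball 0 ((1/2) ^ j)) z)
      + (\<Sum>j. ennreal (B j) * indicator (ball 0 (2 ^ Suc j)) z) \<partial>(lborel :: 'a measure))"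
    by (rule nn_integral_mono) (rule le)
  also have "\<dots> = (\<Sum>j. ennreal (A j) * emeasure lborel (ball (0::'a) ((1/2) ^ j)))
      + (\<Sum>j. ennreal (B j) * emeasure lborel (ball (0::'a) (2 ^ Suc j)))"
  proof -
    have [measurable]: "ball (0::'a) r \<in> sets borel" for r by simp
    have m: "(\<lambda>z::'a. \<Sum>j. ennreal (A j) * indicator (ball 0 ((1/2) ^ j)) z) \<in> borel_measurable lborel"
      "(\<lambda>z::'a. \<Sum>j. ennreal (B j) * indicator (ball 0 (2 ^ Suc j)) z) \<in> borel_measurable lborel"
      by (intro borel_measurable_suminf_order; measurable)+
    show ?thesis
      unfolding nn_integral_add[OF m]
      by (subst (1 2) nn_integral_suminf) (simp_all add: nn_integral_cmult_indicator)
  qed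
  also have "(\<lambda>j. ennreal (A j) * emeasure lborel (ball (0::'a) ((1/2) ^ j)))
      = (\<lambda>j. ennreal ((\<omega> * 2 powr n) * (2 powr - (q - s * q)) ^ j))"
  proof
    fix j :: nat
    have "A j * (\<omega> * ((1/2) ^ j) powr n) = (\<omega> * 2 powr n) * (2 powr - (q - s * q)) ^ j"
    proof -
      have "((1/2::real) ^ j) powr n = 2 powr (- (real j * n))"
        by (subst powr_realpow[symmetric]) (simp_all add: powr_powr half)
      moreover have "(2 powr - (q - s * q)) ^ j = 2 powr (- (real j * (q - s * q)))"
        by (rule pw)
      moreover have "A j = 2 powr (- (real j * (q - s * q)) + real j * n + n)"
        unfolding A_def half by (simp add: algebra_simps)
      ultimately have "A j * (\<omega> * ((1/2) ^ j) powr n) = \<omega> *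
          (2 powr (- (real j * (q - s * q)) + real j * n + n) * 2 powr (- (real j * n)))"
        and "(\<omega> * 2 powr n) * (2 powr - (q - s * q)) ^ j = \<omega> * (2 powr n * 2 powr (- (real j * (q - s * q))))"
        by simp_all
      then show ?thesis by (simp only: powr_add[symmetric]) (simp add: algebra_simps)
    qed
    then show "ennreal (A j) * emeasure lborel (ball (0::'a) ((1/2) ^ j)) = ennreal ((\<omega> * 2 powr n) * (2 powr - (q - s * q)) ^ j)"
      by (subst vol) (auto simp: ennreal_mult[symmetric] A_def \<omega>)
  qed
  also have "(\<lambda>j. ennreal (B j) * emeasure lborel (ball (0::'a) (2 ^ Suc j)))
      = (\<lambda>j. ennreal ((\<omega> * 2 powr n) * (2 powr - (s * q)) ^ j))"
  proof
    fix j :: nat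
    have "B j * (\<omega> * (2 ^ Suc j) powr n) = (\<omega> * 2 powr n) * (2 powr - (s * q)) ^ j"
    proof -
      have "((2::real) ^ Suc j) powr n = 2 powr (real j * n) * 2 powr n"
        by (subst powr_realpow[symmetric]) (simp_all add: powr_powr powr_add[symmetric] algebra_simps)
      moreover have "(2 powr - (s * q)) ^ j = 2 powr (- (real j * (s * q)))"
        by (rule pw)
      moreover have "B j = 2 powr (- (real j * (s * q)) - real j * n)"
        unfolding B_def half by (rule arg_cong[where f = "\<lambda>x. 2 powr x"]) (simp add: algebra_simps)
      ultimately have "B j * (\<omega> * (2 ^ Suc j) powr n) = \<omega> *
          (2 powr (- (real j * (s * q)) - real j * n) * (2 powr (real j * n) * 2 powr n))"
        and "(\<omega> * 2 powr n) * (2 powr - (s * q)) ^ j = \<omega> * (2 powr n * 2 powr (- (real j * (s * q))))"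
        by simp_all
      then show ?thesis by (simp only: powr_add[symmetric]) (simp add: algebra_simps)
    qed
    then show "ennreal (B j) * emeasure lborel (ball (0::'a) (2 ^ Suc j)) = ennreal ((\<omega> * 2 powr n) * (2 powr - (s * q)) ^ j)"
      by (subst vol) (auto simp: ennreal_mult[symmetric] B_def \<omega>)
  qed
  also have "(\<Sum>j. ennreal ((\<omega> * 2 powr n) * (2 powr - (q - s * q)) ^ j))
      + (\<Sum>j. ennreal ((\<omega> * 2 powr n) * (2 powr - (s * q)) ^ j)) < \<infinity>"
  proof -
    have "0 \<le> \<omega> * 2 powr n" "q - s * q > 0" "s * q > 0" using \<omega> q s by auto
    then show ?thesis using geo by (simp only: infinity_ennreal_def ennreal_add_less_top)
  qed
  finally show ?thesis .
qed

section \<open>Pointwise inequalities\<close>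

lemma powr_minus_1_mult: "(a::real) \<ge> 0 \<Longrightarrow> a powr (p - 1) * a = a powr p"
  using powr_mult_base[of a "p - 1"] by (simp add: mult.commute)

text \<open>Either m L \<le> \<psi> a and the left side is absorbed by the first term, or \<psi> a
  is below m L and, as \<psi> \<le> 1 and m \<ge> p, the left side is at most (m L)^p. The absorbed
  term has coefficient exactly 1, the one with which differentiating exp(-u) supplies it.\<close>

lemma young_cutoff:
  fixes a \<psi> L p :: real
  assumes a: "a \<ge> 0" and \<psi>: "0 \<le> \<psi>" "\<psi> \<le> 1" and L: "L \<ge> 0" and p: "1 < p" "p \<le> real m"
  shows "a powr (p - 1) * (real m * \<psi> ^ (m - 1) * L) \<le> \<psi> ^ m * a powr p + (real m * L) powr p"
proof (cases "real m * L \<le> \<psi> * a")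
  case True
  have m: "m = Suc (m - 1)" using p by (cases m) auto
  have "a powr (p - 1) * (real m * \<psi> ^ (m - 1) * L) = (a powr (p - 1) * \<psi> ^ (m - 1)) * (real m * L)"
    by simp
  also have "\<dots> \<le> (a powr (p - 1) * \<psi> ^ (m - 1)) * (\<psi> * a)"
    using \<psi> by (intro mult_left_mono True) auto
  also have "\<dots> = \<psi> ^ Suc (m - 1) * (a powr (p - 1) * a)" by simp
  also have "\<dots> = \<psi> ^ m * a powr p" using m a by (simp add: powr_minus_1_mult)
  finally show ?thesis by (simp add: add_increasing2)
next
  case False
  have "\<psi> ^ (m - 1) \<le> \<psi> powr (p - 1)"
  proof (cases "\<psi> = 0")
    case True
    then show ?thesis using p by (cases "m - 1") auto
  next
    case False
    then have "\<psi> ^ (m - 1) = \<psi> powr (real m - 1)"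
      using \<psi> p by (subst powr_realpow[symmetric]) (auto simp: of_nat_diff)
    also have "\<dots> \<le> \<psi> powr (p - 1)" using \<psi> p by (intro powr_mono') auto
    finally show ?thesis .
  qed
  then have "a powr (p - 1) * \<psi> ^ (m - 1) \<le> a powr (p - 1) * \<psi> powr (p - 1)"
    by (intro mult_left_mono) auto
  also have "\<dots> = (\<psi> * a) powr (p - 1)" by (simp add: powr_mult mult.commute)
  also have "\<dots> \<le> (real m * L) powr (p - 1)" using False \<psi> a p by (intro powr_mono2) auto
  finally have "(a powr (p - 1) * \<psi> ^ (m - 1)) * (real m * L) \<le> (real m * L) powr (p - 1) * (real m * L)"
    using L by (intro mult_right_mono) auto
  also have "\<dots> = (real m * L) powr p" using L by (intro powr_minus_1_mult) auto
  finally show ?thesis using \<psi> by (simp add: add_increasing mult_ac)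
qed

text \<open>A consequence of (1 + t/m)^m \<le> exp t, which bounds t^m by m^m exp t.\<close>

lemma powr_exp_minus_le:
  fixes t r :: real
  assumes "t \<ge> 0" "0 \<le> r" "r \<le> real m" "m > 0"
  shows "t powr r * exp (- t) \<le> 1 + real m ^ m"
proof -
  have "(t / real m) ^ m \<le> (1 + t / real m) ^ m" using assms by (intro power_mono) auto
  also have "\<dots> \<le> exp t" using assms by (intro exp_ge_one_plus_x_over_n_power_n) auto
  finally have tm: "t ^ m \<le> real m ^ m * exp t" using assms by (simp add: power_divide field_simps)
  have "t powr r \<le> 1 + t powr real m" using assms by (intro powr_le_1_add_powr) auto
  also have "t powr real m = t ^ m" using assms by (intro powr_realpow') auto
  also have "1 + t ^ m \<le> (1 + real m ^ m) * exp t"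
    using tm assms by (simp add: distrib_right add_mono)
  finally show ?thesis by (simp add: exp_minus field_simps)
qed

text \<open>The summands belong to the two regimes of the pointwise inequality for cut-off values Y
  < X: the first to Y \<le> X/2, the second to Y > X/2.\<close>

definition nonlocal_const :: "real \<Rightarrow> nat \<Rightarrow> real"
  where "nonlocal_const q m = (1 + real m ^ m) * 2 powr q + (real m * 2 ^ m) powr (q - 1) * real m"

text \<open>The exponential weight makes the nonlocal form nonpositive up to a term that only involves
  the cut-off: if \<open>a - b\<close> is large compared with \<open>(X - Y) / X\<close>, the decay of \<open>exp (- t)\<close> wins.\<close>

lemma nonlocal_pointwise_ordered:
  fixes a b X Y q :: real
  assumes ab: "0 \<le> b" "b < a" and X: "0 \<le> X" "X \<le> 1" and Y: "0 \<le> Y" "Y \<le> 1"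
    and q: "1 < q" "q \<le> real m"
  shows "(a - b) powr (q - 1) * (X ^ m * exp (- a) - Y ^ m * exp (- b)) \<le> nonlocal_const q m * \<bar>X - Y\<bar> powr q"
proof (cases "X \<le> Y")
  case True
  have "X ^ m * exp (- a) \<le> Y ^ m * exp (- b)"
    using True X ab by (intro mult_mono power_mono) auto
  then have "(a - b) powr (q - 1) * (X ^ m * exp (- a) - Y ^ m * exp (- b)) \<le> 0"
    by (intro mult_nonneg_nonpos) auto
  also have "\<dots> \<le> nonlocal_const q m * \<bar>X - Y\<bar> powr q" by (simp add: nonlocal_const_def)
  finally show ?thesis .
next
  case False
  define d where "d = a - b"
  define E where "E = X - Y"
  have d: "d > 0" "d \<le> a" and E: "E > 0" "\<bar>X - Y\<bar> = E" using ab False by (auto simp: d_def E_def)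
  have m: "m > 0" using q by (cases m) auto
  have Xp: "X > 0" using False Y by auto
  have ed: "exp (- a) \<le> exp (- d)" using d by simp
  show ?thesis
  proof (cases "Y \<le> X / 2")
    case True
    \<comment> \<open>Here X is comparable to X - Y: boundedness of d^(q-1) exp(-d) leaves X^m \<le>
      X^q, which the right side pays for.\<close>
    then have X2: "X \<le> 2 * E" by (simp add: E_def)
    have "d powr (q - 1) * (X ^ m * exp (- a) - Y ^ m * exp (- b)) \<le> d powr (q - 1) * (X ^ m * exp (- d))"
    proof (intro mult_left_mono)
      have "0 \<le> Y ^ m * exp (- b)" using Y by simp
      moreover have "X ^ m * exp (- a) \<le> X ^ m * exp (- d)" using ed X by (intro mult_left_mono) auto
      ultimately show "X ^ m * exp (- a) - Y ^ m * exp (- b) \<le> X ^ m * exp (- d)" by linarith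
    qed simp
    also have "\<dots> = (d powr (q - 1) * exp (- d)) * X ^ m" by simp
    also have "\<dots> \<le> (1 + real m ^ m) * X powr q"
    proof (intro mult_mono)
      show "d powr (q - 1) * exp (- d) \<le> 1 + real m ^ m"
        using d q m by (intro powr_exp_minus_le) auto
      have "X ^ m = X powr real m" using Xp by (simp add: powr_realpow)
      also have "\<dots> \<le> X powr q" using Xp X q by (intro powr_mono') auto
      finally show "X ^ m \<le> X powr q" .
    qed (use X in auto)
    also have "\<dots> \<le> (1 + real m ^ m) * (2 * E) powr q"
      using X X2 q by (intro mult_left_mono powr_mono2) auto
    also have "\<dots> = ((1 + real m ^ m) * 2 powr q) * E powr q" using E by (simp add: powr_mult)
    also have "\<dots> \<le> nonlocal_const q m * E powr q"
      unfolding nonlocal_const_def by (intro mult_right_mono) auto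
    finally show ?thesis by (simp add: E d_def)
  next
    case False
    \<comment> \<open>Chosen so that \<open>d * X \<ge> K * E\<close> makes the gain d (X/2)^m
      outweigh the loss m E X^(m-1); in the opposite case d X is bounded by K E.\<close>
    define K where "K = real m * 2 ^ m"
    have K: "K > 0" using m by (simp add: K_def)
    \<comment> \<open>The weight enters here: exp(-b) exceeds exp(-a) by the factor exp d, which is
      at least 1 + d, and the surplus d is the gain.\<close>
    have "1 + d \<le> exp d" by simp
    also have "exp d = exp (- b) * exp a" by (simp add: d_def exp_diff exp_minus divide_inverse)
    finally have eb: "(1 + d) * exp (- a) \<le> exp (- b)" by (simp add: exp_minus field_simps)
    have diff: "X ^ m - Y ^ m \<le> E * (real m * X ^ (m - 1))"
    proof -
      have "X ^ m - Y ^ m = (X - Y) * (\<Sum>i<m. Y ^ (m - Suc i) * X ^ i)"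
        by (rule power_diff_sumr2)
      also have "(\<Sum>i<m. Y ^ (m - Suc i) * X ^ i) \<le> (\<Sum>i<m. X ^ (m - 1))"
      proof (rule sum_mono)
        fix i assume i: "i \<in> {..<m}"
        have "Y ^ (m - Suc i) * X ^ i \<le> X ^ (m - Suc i) * X ^ i"
          using X Y E by (intro mult_right_mono power_mono) (auto simp: E_def)
        also have "\<dots> = X ^ (m - 1)" using i by (simp add: power_add[symmetric])
        finally show "Y ^ (m - Suc i) * X ^ i \<le> X ^ (m - 1)" .
      qed
      then show ?thesis using calculation E by (simp add: E_def mult_left_mono)
    qed
    have "X ^ m * exp (- a) - Y ^ m * exp (- b) \<le> X ^ m * exp (- a) - Y ^ m * ((1 + d) * exp (- a))"
      using eb Y by (intro diff_left_mono mult_left_mono) auto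
    also have "\<dots> = exp (- a) * ((X ^ m - Y ^ m) - d * Y ^ m)" by (simp add: algebra_simps)
    also have "\<dots> \<le> exp (- a) * (E * (real m * X ^ (m - 1)) - d * (X / 2) ^ m)"
      using diff False d Xp by (intro mult_left_mono diff_mono power_mono) auto
    finally have 1: "X ^ m * exp (- a) - Y ^ m * exp (- b) \<le> exp (- a) * (E * (real m * X ^ (m - 1)) - d * (X / 2) ^ m)" .
    have Xm: "X ^ m = X * X ^ (m - 1)" using m by (cases m) auto
    show ?thesis
    proof (cases "d * X \<ge> K * E")
      case True
      have "E * (real m * X ^ (m - 1)) = (K * E) * (X ^ (m - 1) / 2 ^ m)" by (simp add: K_def)
      also have "\<dots> \<le> (d * X) * (X ^ (m - 1) / 2 ^ m)" using True Xp by (intro mult_right_mono) auto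
      also have "\<dots> = d * (X / 2) ^ m" by (simp add: power_divide Xm)
      finally have "exp (- a) * (E * (real m * X ^ (m - 1)) - d * (X / 2) ^ m) \<le> 0"
        by (intro mult_nonneg_nonpos) auto
      then have "d powr (q - 1) * (X ^ m * exp (- a) - Y ^ m * exp (- b)) \<le> 0"
        using 1 by (intro mult_nonneg_nonpos) auto
      also have "\<dots> \<le> nonlocal_const q m * \<bar>X - Y\<bar> powr q" by (simp add: nonlocal_const_def)
      finally show ?thesis by (simp add: d_def)
    next
      case False
      have "exp (- a) * (E * (real m * X ^ (m - 1)) - d * (X / 2) ^ m) \<le> exp (- a) * (E * (real m * X ^ (m - 1)))"
        using d Xp by (intro mult_left_mono) auto
      also have "\<dots> \<le> 1 * (E * (real m * X ^ (m - 1)))"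
        using E Xp ab by (intro mult_right_mono) auto
      finally have "d powr (q - 1) * (X ^ m * exp (- a) - Y ^ m * exp (- b)) \<le> d powr (q - 1) * (E * (real m * X ^ (m - 1)))"
        using 1 by (intro mult_left_mono) auto
      also have "\<dots> = real m * E * (d powr (q - 1) * X ^ (m - 1))" by simp
      also have "\<dots> \<le> real m * E * (d powr (q - 1) * X powr (q - 1))"
      proof (intro mult_left_mono)
        have "X ^ (m - 1) = X powr (real m - 1)"
          using Xp m by (subst powr_realpow[symmetric]) (auto simp: of_nat_diff)
        also have "\<dots> \<le> X powr (q - 1)" using Xp X q by (intro powr_mono') auto
        finally show "X ^ (m - 1) \<le> X powr (q - 1)" .
      qed (use E in auto)
      also have "d powr (q - 1) * X powr (q - 1) = (d * X) powr (q - 1)" by (simp add: powr_mult)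
      also have "real m * E * (d * X) powr (q - 1) \<le> real m * E * (K * E) powr (q - 1)"
        using False d Xp q E by (intro mult_left_mono powr_mono2) auto
      also have "\<dots> = K powr (q - 1) * real m * (E powr (q - 1) * E)" using K E by (simp add: powr_mult)
      also have "\<dots> = K powr (q - 1) * real m * E powr q" using E by (simp add: powr_minus_1_mult)
      also have "\<dots> \<le> nonlocal_const q m * E powr q"
        unfolding nonlocal_const_def K_def by (intro mult_right_mono) auto
      finally show ?thesis by (simp add: E d_def)
    qed
  qed
qed

text \<open>The left side is unchanged when (a, X) and (b, Y) are exchanged, so the ordered case
  suffices; at a = b it is 0.\<close>

lemma nonlocal_pointwise:
  fixes a b X Y q :: real
  assumes ab: "0 \<le> a" "0 \<le> b" and X: "0 \<le> X" "X \<le> 1" and Y: "0 \<le> Y" "Y \<le> 1"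
    and q: "1 < q" "q \<le> real m"
  shows "\<bar>a - b\<bar> powr (q - 2) * (a - b) * (X ^ m * exp (- a) - Y ^ m * exp (- b))
    \<le> nonlocal_const q m * \<bar>X - Y\<bar> powr q"
proof -
  have pw: "d powr (q - 2) * d = d powr (q - 1)" if "d \<ge> 0" for d :: real
    using powr_minus_1_mult[OF that, of "q - 1"] by simp
  consider "a = b" | "b < a" | "a < b" by linarith
  then show ?thesis
  proof cases
    case 2
    then show ?thesis using nonlocal_pointwise_ordered[OF ab(2) 2 X Y q] pw[of "a - b"] by simp
  next
    case 3
    have "\<bar>a - b\<bar> powr (q - 2) * (a - b) * (X ^ m * exp (- a) - Y ^ m * exp (- b))
        = ((b - a) powr (q - 2) * (b - a)) * (Y ^ m * exp (- b) - X ^ m * exp (- a))"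
      using 3 by (simp add: algebra_simps)
    also have "\<dots> = (b - a) powr (q - 1) * (Y ^ m * exp (- b) - X ^ m * exp (- a))"
      using pw[of "b - a"] 3 by simp
    also have "\<dots> \<le> nonlocal_const q m * \<bar>Y - X\<bar> powr q"
      by (rule nonlocal_pointwise_ordered[OF ab(1) 3 Y X q])
    finally show ?thesis by (simp add: abs_minus_commute)
  qed (simp add: nonlocal_const_def)
qed

lemma abs_exp_minus_diff_le:
  fixes a b :: real
  assumes "0 \<le> a" "0 \<le> b"
  shows "\<bar>exp (- a) - exp (- b)\<bar> \<le> \<bar>a - b\<bar>"
proof -
  have *: "exp (- b) - exp (- a) \<le> a - b" if "0 \<le> b" "b \<le> a" for a b :: real
  proof -
    have "exp (- b) - exp (- a) = exp (- b) * (1 - exp (- (a - b)))"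
      by (simp add: right_diff_distrib exp_add[symmetric])
    also have "\<dots> \<le> 1 * (a - b)"
    proof (intro mult_mono)
      show "1 - exp (- (a - b)) \<le> a - b" using exp_ge_add_one_self[of "- (a - b)"] by linarith
    qed (use that in auto)
    finally show ?thesis by simp
  qed
  show ?thesis using *[of a b] *[of b a] assms by (cases "a \<le> b") (auto simp: abs_if)
qed

text \<open>If one of the cut-off values is 0, the difference is at most |X - Y| whatever the
  weights. Hence pairs of points that are not both in the support of the cut-off contribute no
  difference of the exponents.\<close>

lemma cutoff_exp_diff_le:
  fixes a b X Y :: real
  assumes ab: "0 \<le> a" "0 \<le> b" and X: "0 \<le> X" and Y: "0 \<le> Y" "X \<le> 1" "Y \<le> 1"
  shows "\<bar>X * exp (- a) - Y * exp (- b)\<bar> \<le> \<bar>X - Y\<bar> + (if X = 0 \<or> Y = 0 then 0 else \<bar>a - b\<bar>)"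
proof -
  have *: "\<bar>X * exp (- a) - Y * exp (- b)\<bar> \<le> \<bar>X - Y\<bar> + X * \<bar>a - b\<bar>"
    if "0 \<le> a" "0 \<le> b" "0 \<le> X" for a b X Y :: real
  proof -
    have "X * exp (- a) - Y * exp (- b) = (X - Y) * exp (- b) + X * (exp (- a) - exp (- b))"
      by (simp add: algebra_simps)
    then have "\<bar>X * exp (- a) - Y * exp (- b)\<bar> \<le> \<bar>X - Y\<bar> * exp (- b) + X * \<bar>exp (- a) - exp (- b)\<bar>"
      using that by (simp add: abs_mult order_trans[OF abs_triangle_ineq])
    also have "\<dots> \<le> \<bar>X - Y\<bar> * 1 + X * \<bar>a - b\<bar>"
      using that by (intro add_mono mult_left_mono abs_exp_minus_diff_le) auto
    finally show ?thesis by simp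
  qed
  have "X * \<bar>a - b\<bar> \<le> \<bar>a - b\<bar>" "Y * \<bar>a - b\<bar> \<le> \<bar>a - b\<bar>"
    using assms by (auto intro: mult_left_le_one_le)
  then show ?thesis
    using *[OF ab X, of Y] *[OF ab(2,1) Y(1), of X] by (auto simp: abs_minus_commute)
qed

section \<open>Limits of integrals with a vanishing error\<close>

lemma young_epsilon:
  fixes a b e p :: real
  assumes "a \<ge> 0" "b \<ge> 0" "e > 0" "p > 1"
  shows "a powr (p - 1) * b \<le> e * a powr p + (1 / e) powr (p - 1) * b powr p"
proof (cases "b \<le> e * a")
  case True
  then have "a powr (p - 1) * b \<le> a powr (p - 1) * (e * a)" by (intro mult_left_mono) auto
  also have "\<dots> = e * a powr p" using assms powr_minus_1_mult[of a p] by simp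
  finally show ?thesis by (simp add: add_increasing2)
next
  case False
  then have "a powr (p - 1) * b \<le> (1 / e * b) powr (p - 1) * b"
    using assms by (intro mult_right_mono powr_mono2) (auto simp: field_simps)
  also have "\<dots> = (1 / e) powr (p - 1) * (b powr (p - 1) * b)" using assms by (subst powr_mult) auto
  also have "\<dots> = (1 / e) powr (p - 1) * b powr p" using assms by (simp add: powr_minus_1_mult)
  finally show ?thesis using assms by (simp add: add_increasing)
qed

text \<open>Young's inequality with a parameter takes the place of Hoelder's: \<open>e\<close> is
  chosen small against the integral of a^p, and afterwards the integral of the p-th power of
  \<open>b k\<close> is small against the constant that depends on \<open>e\<close>.\<close>

lemma nn_integral_powr_mult_tendsto_0:
  fixes a :: "'a \<Rightarrow> real" and b :: "nat \<Rightarrow> 'a \<Rightarrow> real"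
  assumes [measurable]: "a \<in> borel_measurable M" "\<And>k. b k \<in> borel_measurable M"
    and pos: "\<And>x. a x \<ge> 0" "\<And>k x. b k x \<ge> 0" and p: "p > 1"
    and a: "(\<integral>\<^sup>+x. a x powr p \<partial>M) < \<infinity>"
    and b: "(\<lambda>k. \<integral>\<^sup>+x. b k x powr p \<partial>M) \<longlonglongrightarrow> 0"
  shows "(\<lambda>k. \<integral>\<^sup>+x. a x powr (p - 1) * b k x \<partial>M) \<longlonglongrightarrow> 0"
proof (rule ennreal_tendsto_0I)
  fix \<epsilon> :: real assume \<epsilon>: "\<epsilon> > 0"
  obtain A where A: "(\<integral>\<^sup>+x. a x powr p \<partial>M) = ennreal A" "A \<ge> 0" using a by (auto simp: less_top_ennreal)
  define e where "e = \<epsilon> / (2 * (A + 1))"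
  have e: "e > 0" using \<epsilon> A by (simp add: e_def)
  define C where "C = (1 / e) powr (p - 1)"
  have C: "C \<ge> 0" by (simp add: C_def)
  have "\<epsilon> / (2 * (C + 1)) > 0" using C \<epsilon> by simp
  from ennreal_tendsto_0D[OF b this]
  show "eventually (\<lambda>k. (\<integral>\<^sup>+x. a x powr (p - 1) * b k x \<partial>M) \<le> ennreal \<epsilon>) sequentially"
  proof eventually_elim
    case (elim k)
    have "(\<integral>\<^sup>+x. a x powr (p - 1) * b k x \<partial>M)
        \<le> (\<integral>\<^sup>+x. ennreal e * ennreal (a x powr p) + ennreal C * ennreal (b k x powr p) \<partial>M)"
      using young_epsilon[OF pos e p] e C
      by (intro nn_integral_mono) (simp add: C_def ennreal_mult[symmetric] ennreal_plus[symmetric] ennreal_leI del: ennreal_plus)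
    also have "\<dots> = ennreal e * (\<integral>\<^sup>+x. a x powr p \<partial>M) + ennreal C * (\<integral>\<^sup>+x. b k x powr p \<partial>M)"
      by (simp add: nn_integral_add nn_integral_cmult)
    also have "\<dots> \<le> ennreal e * ennreal A + ennreal C * ennreal (\<epsilon> / (2 * (C + 1)))"
      unfolding A(1) by (intro add_mono mult_left_mono elim) auto
    also have "\<dots> = ennreal (e * A + C * (\<epsilon> / (2 * (C + 1))))"
      using e A C \<epsilon> by (simp add: ennreal_mult[symmetric] ennreal_plus[symmetric] del: ennreal_plus)
    also have "\<dots> \<le> ennreal \<epsilon>"
    proof (rule ennreal_leI)
      have "e * A \<le> \<epsilon> / 2" using A \<epsilon> by (simp add: e_def field_simps)
      moreover have "C * (\<epsilon> / (2 * (C + 1))) \<le> \<epsilon> / 2" using C \<epsilon> by (simp add: field_simps)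
      ultimately show "e * A + C * (\<epsilon> / (2 * (C + 1))) \<le> \<epsilon>" by linarith
    qed
    finally show ?case .
  qed
qed

text \<open>Dominated convergence with a moving majorant, whose excess over \<open>G\<close>
  vanishes in L^1. Clamping \<open>h k\<close> to [-G, G] gives a fixed majorant and changes the
  integral by at most that of \<open>e k\<close>; the limit lies in [-G, G], so it is not
  affected.\<close>

lemma integral_tendsto_dominated_error:
  fixes h :: "nat \<Rightarrow> 'a \<Rightarrow> real"
  assumes hk: "\<And>k. integrable M (h k)" and h [measurable]: "h0 \<in> borel_measurable M"
    and lim: "AE x in M. (\<lambda>k. h k x) \<longlonglongrightarrow> h0 x"
    and e [measurable]: "\<And>k. e k \<in> borel_measurable M" and e0: "\<And>k x. e k x \<ge> 0"
    and elim: "(\<lambda>k. \<integral>\<^sup>+x. e k x \<partial>M) \<longlonglongrightarrow> 0"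
    and G: "integrable M G" and dom: "\<And>k x. \<bar>h k x\<bar> \<le> G x + e k x" "\<And>x. \<bar>h0 x\<bar> \<le> G x"
  shows "(\<lambda>k. LINT x|M. h k x) \<longlonglongrightarrow> (LINT x|M. h0 x)" and "integrable M h0"
proof -
  have [measurable]: "G \<in> borel_measurable M" "\<And>k. h k \<in> borel_measurable M" using G hk by auto
  have G0: "G x \<ge> 0" for x using dom(2)[of x] by linarith
  show h0i: "integrable M h0" by (rule Bochner_Integration.integrable_bound[OF G]) (use dom(2) G0 in auto)
  define c where "c k x = max (- G x) (min (G x) (h k x))" for k x
  have [measurable]: "c k \<in> borel_measurable M" for k unfolding c_def by measurable
  have cb: "\<bar>c k x\<bar> \<le> G x" for k x
    unfolding c_def using G0[of x] by linarith
  have ci: "integrable M (c k)" for k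
    by (rule Bochner_Integration.integrable_bound[OF G]) (use cb G0 in auto)
  have c: "(\<lambda>k. LINT x|M. c k x) \<longlonglongrightarrow> (LINT x|M. h0 x)"
  proof (rule integral_dominated_convergence[where w = G])
    show "AE x in M. (\<lambda>k. c k x) \<longlonglongrightarrow> h0 x"
      using lim
    proof eventually_elim
      case (elim x)
      have "(\<lambda>k. c k x) \<longlonglongrightarrow> max (- G x) (min (G x) (h0 x))"
        unfolding c_def by (intro tendsto_intros elim)
      moreover have "max (- G x) (min (G x) (h0 x)) = h0 x" using dom(2)[of x] by linarith
      ultimately show ?case by simp
    qed
    show "AE x in M. norm (c k x) \<le> G x" for k using cb by simp
  qed (use G in auto)
  have "(\<lambda>k. (LINT x|M. h k x) - (LINT x|M. c k x)) \<longlonglongrightarrow> 0"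
  proof -
    have bound: "ennreal \<bar>(LINT x|M. h k x) - (LINT x|M. c k x)\<bar> \<le> (\<integral>\<^sup>+x. e k x \<partial>M)" for k
    proof -
      have "\<bar>(LINT x|M. h k x) - (LINT x|M. c k x)\<bar> = norm (LINT x|M. h k x - c k x)"
        using hk ci by simp
      also have "ennreal \<dots> \<le> (\<integral>\<^sup>+x. norm (h k x - c k x) \<partial>M)"
        using hk ci by (intro integral_norm_bound_ennreal) auto
      also have "\<dots> \<le> (\<integral>\<^sup>+x. e k x \<partial>M)"
      proof (intro nn_integral_mono ennreal_leI)
        fix x
        show "norm (h k x - c k x) \<le> e k x" unfolding c_def real_norm_def using dom(1)[of k x] G0[of x] e0[of k x] by linarith
      qed
      finally show ?thesis .
    qed
    have "(\<lambda>k. ennreal \<bar>(LINT x|M. h k x) - (LINT x|M. c k x)\<bar>) \<longlonglongrightarrow> ennreal 0"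
      using ennreal_tendsto_0_le[OF elim bound] by simp
    then have "(\<lambda>k. \<bar>(LINT x|M. h k x) - (LINT x|M. c k x)\<bar>) \<longlonglongrightarrow> 0"
      by (subst (asm) tendsto_ennreal_iff) auto
    then show ?thesis by (rule tendsto_rabs_zero_cancel)
  qed
  from tendsto_add[OF this c] show "(\<lambda>k. LINT x|M. h k x) \<longlonglongrightarrow> (LINT x|M. h0 x)" by simp
qed

section \<open>The Gagliardo seminorm\<close>

text \<open>The \<open>q\<close>-th power of \<open>diff_quot\<close> is the Gagliardo integrand of \<open>v\<close> on \<open>S \<times> S\<close>.\<close>

definition diff_quot :: "real \<Rightarrow> real \<Rightarrow> 'a::euclidean_space set \<Rightarrow> ('a \<Rightarrow> real) \<Rightarrow> 'a \<times> 'a \<Rightarrow> real"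
  where "diff_quot q s S v z = indicator S (fst z) * indicator S (snd z) * \<bar>v (fst z) - v (snd z)\<bar>
    / norm (fst z - snd z) powr ((real DIM('a) + s * q) / q)"

lemma diff_quot_nonneg: "diff_quot q s S v z \<ge> 0"
  by (simp add: diff_quot_def)

lemma diff_quot_borel [measurable]:
  assumes [measurable]: "S \<in> sets borel" "v \<in> borel_measurable borel"
  shows "diff_quot q s S v \<in> borel_measurable (lborel \<Otimes>\<^sub>M lborel)"
  unfolding diff_quot_def by measurable

lemma diff_quot_powr:
  fixes v :: "'a::euclidean_space \<Rightarrow> real"
  assumes "q > 0"
  shows "diff_quot q s S v z powr q = indicator S (fst z) * indicator S (snd z) * \<bar>v (fst z) - v (snd z)\<bar> powr q
    / norm (fst z - snd z) powr (real DIM('a) + s * q)"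
  using assms by (auto simp: diff_quot_def indicator_def powr_divide powr_powr)

text \<open>The power n + sq of the distance is split in the proportion (q-1)/q to 1/q, so that the
  mixed nonlocal integrand becomes a product of the form handled by Young's inequality with exponent
  q.\<close>

lemma diff_quot_powr_mult:
  fixes v w :: "'a::euclidean_space \<Rightarrow> real"
  assumes "q > 1"
  shows "diff_quot q s S v z powr (q - 1) * diff_quot q s S w z
    = indicator S (fst z) * indicator S (snd z) * (\<bar>v (fst z) - v (snd z)\<bar> powr (q - 1) * \<bar>w (fst z) - w (snd z)\<bar>)
    / norm (fst z - snd z) powr (real DIM('a) + s * q)"
proof -
  let ?e = "(real DIM('a) + s * q) / q"
  have "?e * (q - 1) + ?e = real DIM('a) + s * q" using assms by (simp add: field_simps)
  then have "norm (fst z - snd z) powr (?e * (q - 1)) * norm (fst z - snd z) powr ?e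
      = norm (fst z - snd z) powr (real DIM('a) + s * q)"
    by (simp add: powr_add[symmetric])
  then show ?thesis
    by (auto simp: diff_quot_def indicator_def powr_divide powr_powr)
qed

text \<open>The embedding of W^{1,q} into the fractional space on a ball, with an explicit constant.
  After substituting y = x + z the translation estimate applies for each z, convexity keeping the
  segments in the ball. The diameter is at most 1, so |z| \<le> 1, where the factor |z|^q /
  |z|^(n+sq) is exactly \<open>Kernel\<close>.\<close>

lemma nn_integral_diff_quot_le:
  fixes w :: "'a::euclidean_space \<Rightarrow> real"
  assumes w: "Ck (Suc 0) w" and q: "q > 1" and R: "R \<le> 1 / 2"
  shows "(\<integral>\<^sup>+z. diff_quot q s (cball c R) w z powr q \<partial>(lborel \<Otimes>\<^sub>M lborel))
    \<le> (\<integral>\<^sup>+z. Kernel q s (z :: 'a) \<partial>lborel) * (\<integral>\<^sup>+x. indicator (cball c R) x * norm (gradient w x) powr q \<partial>lborel)"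
proof -
  define S where "S = cball c R"
  have [measurable]: "S \<in> sets borel" by (simp add: S_def)
  have [measurable]: "w \<in> borel_measurable borel" by (rule Ck_borel_measurable[OF w])
  define \<nu> where "\<nu> = real DIM('a) + s * q"
  define I where "I = (\<integral>\<^sup>+x. indicator S x * norm (gradient w x) powr q \<partial>lborel)"
  let ?g = "\<lambda>x z. indicator S x * indicator S (z + x) * \<bar>w (z + x) - w x\<bar> powr q / norm z powr \<nu>"
  have "(\<integral>\<^sup>+z. diff_quot q s S w z powr q \<partial>(lborel \<Otimes>\<^sub>M lborel))
      = (\<integral>\<^sup>+x. \<integral>\<^sup>+y. diff_quot q s S w (x, y) powr q \<partial>lborel \<partial>lborel)"
    by (rule lborel.nn_integral_fst[symmetric]) measurable
  also have "\<dots> = (\<integral>\<^sup>+x. \<integral>\<^sup>+z. ?g x z \<partial>lborel \<partial>lborel)"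
  proof (rule nn_integral_cong)
    fix x
    have "(\<integral>\<^sup>+y. diff_quot q s S w (x, y) powr q \<partial>lborel)
        = (\<integral>\<^sup>+z. diff_quot q s S w (x, z + x) powr q \<partial>lborel)"
      by (rule nn_integral_translate[symmetric, where f = "\<lambda>y. ennreal (diff_quot q s S w (x, y) powr q)"]) measurable
    then show "(\<integral>\<^sup>+y. diff_quot q s S w (x, y) powr q \<partial>lborel) = (\<integral>\<^sup>+z. ?g x z \<partial>lborel)"
      using q by (simp add: diff_quot_powr \<nu>_def abs_minus_commute)
  qed
  also have "\<dots> = (\<integral>\<^sup>+z. \<integral>\<^sup>+x. ?g x z \<partial>lborel \<partial>lborel)"
    by (rule lborel_pair.Fubini') measurable
  also have "\<dots> \<le> (\<integral>\<^sup>+z. ennreal (Kernel q s (z :: 'a)) * I \<partial>lborel)"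
  proof (rule nn_integral_mono)
    fix z :: 'a
    show "(\<integral>\<^sup>+x. ?g x z \<partial>lborel) \<le> ennreal (Kernel q s z) * I"
    proof (cases "norm z \<le> 1")
      case False
      have z0: "?g x z = 0" for x
      proof (rule ccontr)
        assume "?g x z \<noteq> 0"
        then have "x \<in> S" "z + x \<in> S" by (auto simp: indicator_def split: if_splits)
        then have "dist x (z + x) \<le> R + R"
          using dist_triangle_le[of x c "z + x" "R + R"] by (auto simp: S_def dist_commute)
        then show False using False R by (simp add: dist_norm)
      qed
      show ?thesis by (simp only: z0) simp
    next
      case True
      define A where "A = S \<inter> (\<lambda>x. x + z) -` S"
      have [measurable]: "A \<in> sets borel"
        unfolding A_def using measurable_sets[of "\<lambda>x. x + z" borel borel S] by auto
      have "(\<integral>\<^sup>+x. ?g x z \<partial>lborel)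
          = (\<integral>\<^sup>+x. ennreal (1 / norm z powr \<nu>) * (indicator A x * ennreal (\<bar>w (x + z) - w x\<bar> powr q)) \<partial>lborel)"
        by (intro nn_integral_cong) (auto simp: A_def indicator_def add.commute simp flip: ennreal_mult)
      also have "\<dots> = ennreal (1 / norm z powr \<nu>) * (\<integral>\<^sup>+x. indicator A x * ennreal (\<bar>w (x + z) - w x\<bar> powr q) \<partial>lborel)"
        by (rule nn_integral_cmult) measurable
      also have "\<dots> \<le> ennreal (1 / norm z powr \<nu>) * (ennreal (norm z powr q) *
          (\<integral>\<^sup>+x. indicator S x * ennreal (norm (gradient w x) powr q) \<partial>lborel))"
      proof (intro mult_left_mono translation_estimate w)
        fix x t assume x: "x \<in> A" and t: "t \<in> {0..1::real}"
        have "(1 - t) *\<^sub>R x + t *\<^sub>R (x + z) \<in> cball c R"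
          using x t by (intro convexD[OF convex_cball]) (auto simp: A_def S_def)
        moreover have "(1 - t) *\<^sub>R x + t *\<^sub>R (x + z) = x + t *\<^sub>R z" by (simp add: algebra_simps)
        ultimately show "x + t *\<^sub>R z \<in> S" by (simp add: S_def)
      qed (use q in auto)
      also have "\<dots> = ennreal (Kernel q s z) * (\<integral>\<^sup>+x. indicator S x * ennreal (norm (gradient w x) powr q) \<partial>lborel)"
        using True by (simp add: mult.assoc[symmetric] ennreal_mult[symmetric] Kernel_def \<nu>_def min_def)
      also have "(\<integral>\<^sup>+x. indicator S x * ennreal (norm (gradient w x) powr q) \<partial>lborel) = I"
        unfolding I_def by (intro nn_integral_cong) (auto simp: indicator_def)
      finally show ?thesis .
    qed
  qed
  also have "\<dots> = (\<integral>\<^sup>+z. Kernel q s (z :: 'a) \<partial>lborel) * I" by (rule nn_integral_multc) measurable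
  finally show ?thesis by (simp add: S_def I_def)
qed

text \<open>Fatou's lemma on the product space. It is applied to the approximations themselves and,
  with k fixed, to the differences of the k-th and the j-th one as j tends to infinity; the latter
  turns Cauchy bounds on gradients into convergence of the seminorm.\<close>

lemma nn_integral_diff_quot_liminf:
  fixes v :: "nat \<Rightarrow> 'a::euclidean_space \<Rightarrow> real"
  assumes v: "\<And>j. Ck (Suc 0) (v j)" and v0 [measurable]: "v0 \<in> borel_measurable borel"
    and lim: "AE x in lborel. (\<lambda>j. v j x) \<longlonglongrightarrow> v0 x" and q: "q > 1" and R: "R \<le> 1 / 2"
    and bound: "eventually (\<lambda>j. (\<integral>\<^sup>+x. indicator (cball c R) x * norm (gradient (v j) x) powr q \<partial>lborel) \<le> B) sequentially"
  shows "(\<integral>\<^sup>+z. diff_quot q s (cball c R) v0 z powr q \<partial>(lborel \<Otimes>\<^sub>M lborel))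
    \<le> (\<integral>\<^sup>+z. Kernel q s (z :: 'a) \<partial>lborel) * B"
proof -
  define S where "S = cball c R"
  have [measurable]: "S \<in> sets borel" by (simp add: S_def)
  have [measurable]: "v j \<in> borel_measurable borel" for j by (rule Ck_borel_measurable[OF v])
  let ?P = "lborel \<Otimes>\<^sub>M lborel :: ('a \<times> 'a) measure"
  have "(\<integral>\<^sup>+z. diff_quot q s S v0 z powr q \<partial>?P) = (\<integral>\<^sup>+z. liminf (\<lambda>j. ennreal (diff_quot q s S (v j) z powr q)) \<partial>?P)"
  proof (rule nn_integral_cong_AE)
    show "AE z in ?P. ennreal (diff_quot q s S v0 z powr q) = liminf (\<lambda>j. ennreal (diff_quot q s S (v j) z powr q))"
      using lborel.AE_pair_fst[OF lim] lborel.AE_pair_snd[OF lim, where N = lborel]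
    proof eventually_elim
      case (elim z)
      have "(\<lambda>j. \<bar>v j (fst z) - v j (snd z)\<bar> powr q) \<longlonglongrightarrow> \<bar>v0 (fst z) - v0 (snd z)\<bar> powr q"
        using q by (intro tendsto_powr' tendsto_intros elim) auto
      then have "(\<lambda>j. ennreal (diff_quot q s S (v j) z powr q)) \<longlonglongrightarrow> ennreal (diff_quot q s S v0 z powr q)"
        using q unfolding divide_inverse
        by (auto simp: diff_quot_powr divide_inverse intro!: tendsto_ennrealI tendsto_mult_left tendsto_mult_right)
      then show ?case by (intro lim_imp_Liminf[symmetric]) auto
    qed
  qed
  also have "\<dots> \<le> liminf (\<lambda>j. \<integral>\<^sup>+z. diff_quot q s S (v j) z powr q \<partial>?P)"
    by (rule nn_integral_liminf) measurable
  also have "\<dots> \<le> (\<integral>\<^sup>+z. Kernel q s (z :: 'a) \<partial>lborel) * B"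
  proof -
    have "eventually (\<lambda>j. (\<integral>\<^sup>+z. diff_quot q s S (v j) z powr q \<partial>?P) \<le> (\<integral>\<^sup>+z. Kernel q s (z :: 'a) \<partial>lborel) * B) sequentially"
      using bound
    proof eventually_elim
      case (elim j)
      show ?case
        unfolding S_def by (rule order_trans[OF nn_integral_diff_quot_le[OF v q R] mult_left_mono[OF elim]]) simp
    qed
    then have "liminf (\<lambda>j. \<integral>\<^sup>+z. diff_quot q s S (v j) z powr q \<partial>?P)
        \<le> liminf (\<lambda>j::nat. (\<integral>\<^sup>+z. Kernel q s (z :: 'a) \<partial>lborel) * B)"
      by (rule Liminf_mono)
    then show ?thesis by (simp add: Liminf_const)
  qed
  finally show ?thesis by (simp add: S_def)
qed

text \<open>A difference of cut-off values vanishes unless one of the two points lies in the support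
  \<open>S\<close>; so this bounds the Gagliardo integral of a cut-off over the whole product
  space.\<close>

lemma nn_integral_cutoff_kernel_le:
  fixes S :: "'a::euclidean_space set"
  assumes [measurable]: "S \<in> sets borel"
  shows "(\<integral>\<^sup>+z. (indicator S (fst z) + indicator S (snd z)) * Kernel q s (fst z - snd z) \<partial>(lborel \<Otimes>\<^sub>M lborel))
    \<le> 2 * emeasure lborel S * (\<integral>\<^sup>+z. Kernel q s (z :: 'a) \<partial>lborel)"
proof -
  let ?A = "\<integral>\<^sup>+z. Kernel q s (z :: 'a) \<partial>lborel"
  let ?P = "lborel \<Otimes>\<^sub>M lborel :: ('a \<times> 'a) measure"
  have K0: "Kernel q s z \<ge> 0" for z :: 'a by (simp add: Kernel_def)
  have Ks: "Kernel q s (x - y) = Kernel q s (y - x)" for x y :: 'a by (simp add: Kernel_def norm_minus_commute)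
  have r: "(\<integral>\<^sup>+y. Kernel q s (x - y) \<partial>lborel) = ?A" for x :: 'a
    by (rule nn_integral_reflect[where f = "\<lambda>z. ennreal (Kernel q s z)"]) simp
  have "(\<integral>\<^sup>+z. indicator S (fst z) * ennreal (Kernel q s (fst z - snd z)) \<partial>?P)
      = (\<integral>\<^sup>+x. \<integral>\<^sup>+y. indicator S x * ennreal (Kernel q s (x - y)) \<partial>lborel \<partial>lborel)"
  proof -
    have [measurable]: "(\<lambda>z. indicator S (fst z) * ennreal (Kernel q s (fst z - snd z))) \<in> borel_measurable ?P"
      by measurable
    show ?thesis by (subst lborel.nn_integral_fst[symmetric]) simp_all
  qed
  also have "\<dots> = (\<integral>\<^sup>+x. indicator S x * ?A \<partial>lborel)"
    by (intro nn_integral_cong) (simp add: nn_integral_cmult r)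
  also have "\<dots> = emeasure lborel S * ?A" by (simp add: nn_integral_multc)
  finally have 1: "(\<integral>\<^sup>+z. indicator S (fst z) * ennreal (Kernel q s (fst z - snd z)) \<partial>?P) = emeasure lborel S * ?A" .
  have "(\<integral>\<^sup>+z. indicator S (snd z) * ennreal (Kernel q s (fst z - snd z)) \<partial>?P)
      = (\<integral>\<^sup>+y. \<integral>\<^sup>+x. indicator S y * ennreal (Kernel q s (x - y)) \<partial>lborel \<partial>lborel)"
  proof -
    have [measurable]: "(\<lambda>z. indicator S (snd z) * ennreal (Kernel q s (fst z - snd z))) \<in> borel_measurable ?P"
      by measurable
    show ?thesis by (subst lborel_pair.nn_integral_snd[symmetric]) simp_all
  qed
  also have "\<dots> = (\<integral>\<^sup>+y. indicator S y * ?A \<partial>lborel)"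
    using r by (intro nn_integral_cong) (simp add: nn_integral_cmult Ks)
  also have "\<dots> = emeasure lborel S * ?A" by (simp add: nn_integral_multc)
  finally have 2: "(\<integral>\<^sup>+z. indicator S (snd z) * ennreal (Kernel q s (fst z - snd z)) \<partial>?P) = emeasure lborel S * ?A" .
  have "(\<integral>\<^sup>+z. (indicator S (fst z) + indicator S (snd z)) * Kernel q s (fst z - snd z) \<partial>?P)
      = (\<integral>\<^sup>+z. indicator S (fst z) * ennreal (Kernel q s (fst z - snd z))
        + indicator S (snd z) * ennreal (Kernel q s (fst z - snd z)) \<partial>?P)"
    using K0 by (intro nn_integral_cong) (auto simp: indicator_def simp flip: ennreal_plus)
  also have "\<dots> = emeasure lborel S * ?A + emeasure lborel S * ?A"
    using 1 2 by (subst nn_integral_add) auto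
  finally show ?thesis by (simp add: mult_2 distrib_right)
qed

section \<open>The Caccioppoli inequality\<close>

lemma gradient_cutoff_exp:
  fixes \<psi> v :: "'a::euclidean_space \<Rightarrow> real"
  assumes "\<psi> differentiable (at x)" "v differentiable (at x)"
  shows "gradient (\<lambda>x. \<psi> x ^ m * exp (- v x)) x
    = (real m * \<psi> x ^ (m - 1) * exp (- v x)) *\<^sub>R gradient \<psi> x - (\<psi> x ^ m * exp (- v x)) *\<^sub>R gradient v x"
proof (rule gradient_eqI)
  show "((\<lambda>x. \<psi> x ^ m * exp (- v x)) has_derivative (\<lambda>w. ((real m * \<psi> x ^ (m - 1) * exp (- v x)) *\<^sub>R gradient \<psi> x
      - (\<psi> x ^ m * exp (- v x)) *\<^sub>R gradient v x) \<bullet> w)) (at x)"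
    by (auto intro!: derivative_eq_intros has_derivative_gradient[OF assms(1)] has_derivative_gradient[OF assms(2)]
        simp: algebra_simps)
qed

lemma ennreal_mult_plus:
  "a \<ge> 0 \<Longrightarrow> b \<ge> 0 \<Longrightarrow> c \<ge> 0 \<Longrightarrow> ennreal a * (ennreal b + ennreal c) = ennreal (a * (b + c))"
  by (simp add: ennreal_mult)

text \<open>In the local term the mollified test function leaves the error |D|^(p-1) |gradient u_k -
  D|, which vanishes in L^1. In the nonlocal term the sign structure requires the same function in
  both factors, so the pointwise inequality is applied only after the limit, to
  \<open>\<Phi>0\<close>, which need not be a test function.\<close>

lemma caccioppoli:
  fixes u F :: "'a::euclidean_space \<Rightarrow> real" and D :: "'a \<Rightarrow> 'a"
  assumes u: "integrable lborel u" "\<And>x. u x \<ge> 0" and D [measurable]: "D \<in> borel_measurable borel"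
    and weak: "\<And>\<phi>. \<phi> \<in> test_functions \<Omega> \<Longrightarrow> (LINT x|lborel. u x *\<^sub>R gradient \<phi> x) = - (LINT x|lborel. \<phi> x *\<^sub>R D x)"
    and sub: "cball c R' \<subseteq> \<Omega>" and R: "0 < R" "R < R'" "R \<le> 1 / 2"
    and q: "1 < q" "q \<le> p" and pm: "p \<le> real m" and s: "0 < s" "s < 1"
    and Dp: "(\<integral>\<^sup>+x. indicator (cball c R') x * norm (D x) powr p \<partial>lborel) < \<infinity>"
    and F: "integrable lborel (\<lambda>x. indicator (cball c R) x * F x)"
    and eqn: "\<And>\<phi>. \<phi> \<in> test_functions \<Omega> \<Longrightarrow> integrable (lborel \<Otimes>\<^sub>M lborel) (nonlocal_integrand q s u \<phi>) \<and>
        (LINT x|lborel. norm (D x) powr (p - 2) * (D x \<bullet> gradient \<phi> x))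
        + (LINT z|(lborel \<Otimes>\<^sub>M lborel). nonlocal_integrand q s u \<phi> z) = (LINT x|lborel. F x * \<phi> x)"
    and L: "L \<ge> 1" "\<And>x. norm (gradient (bump c R) x) \<le> L"
    and A: "(\<integral>\<^sup>+z. Kernel q s (z :: 'a) \<partial>lborel) = ennreal A" "A \<ge> 0"
  shows "(LINT x|lborel. F x * (bump c R x ^ m * exp (- u x)))
    \<le> measure lborel (cball c R) * ((real m * L) powr p + 2 * nonlocal_const q m * A * L powr q)"
proof -
  define S where "S = cball c R"
  define \<psi> where "\<psi> = bump c R"
  define V where "V = measure lborel S"
  have [measurable]: "S \<in> sets borel" by (simp add: S_def)
  have [measurable]: "u \<in> borel_measurable borel" using u by auto
  have [measurable]: "\<psi> \<in> borel_measurable borel" unfolding \<psi>_def by (rule Ck_borel_measurable[OF bump_Ck])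
  have \<psi>d: "\<psi> differentiable (at x)" for x unfolding \<psi>_def by (rule Ck_differentiable[OF bump_Ck])
  have \<psi>01: "0 \<le> \<psi> x" "\<psi> x \<le> 1" for x by (simp_all add: \<psi>_def bump_nonneg bump_le_1)
  have \<psi>S: "x \<in> S" if "\<psi> x \<noteq> 0" for x
    using that bump_eq_0_iff[OF R(1), of c x] by (auto simp: \<psi>_def S_def dist_norm norm_minus_commute)
  have m: "m > 0" "real m \<ge> 1" using q pm by (cases m; simp)+
  have S\<Omega>: "S \<subseteq> \<Omega>" using sub R by (auto simp: S_def)
  have VS: "emeasure lborel S = ennreal V" "V \<ge> 0"
    unfolding V_def using emeasure_bounded_finite[OF bounded_cball[of c R]] by (simp_all add: S_def emeasure_eq_ennreal_measure less_top)
  obtain uk :: "nat \<Rightarrow> 'a \<Rightarrow> real" where uk: "\<And>k j. Ck j (uk k)" "\<And>k x. uk k x \<ge> 0"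
    and uk_lim: "AE x in lborel. (\<lambda>k. uk k x) \<longlonglongrightarrow> u x"
    and gp': "(\<lambda>k. \<integral>\<^sup>+x. indicator (cball c R) x * norm (gradient (uk k) x - D x) powr p \<partial>lborel) \<longlonglongrightarrow> 0"
    and gq': "(\<lambda>k. \<integral>\<^sup>+x. indicator (cball c R) x * norm (gradient (uk k) x - D x) powr q \<partial>lborel) \<longlonglongrightarrow> 0"
    by (rule smooth_approximation[OF u D weak sub R(2) less_imp_le[OF q(1)] q(2) Dp], assumption) (rule that)
  note gp = gp'[folded S_def] and gq = gq'[folded S_def]
  have [measurable]: "uk k \<in> borel_measurable borel" for k by (rule Ck_borel_measurable[OF uk(1)])
  have ukd: "uk k differentiable (at x)" for k x by (rule Ck_differentiable[OF uk(1)])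
  have [measurable]: "gradient (uk k) \<in> borel_measurable borel" for k
    by (rule borel_measurable_continuous_onI[OF Ck_gradient_continuous[OF uk(1)]])
  define \<Phi> where "\<Phi> k x = \<psi> x ^ m * exp (- uk k x)" for k x
  define \<Phi>0 where "\<Phi>0 x = \<psi> x ^ m * exp (- u x)" for x
  have [measurable]: "\<Phi> k \<in> borel_measurable borel" for k unfolding \<Phi>_def by measurable
  have [measurable]: "\<Phi>0 \<in> borel_measurable borel" unfolding \<Phi>0_def by measurable
  have \<Phi>S: "x \<in> S" if "\<Phi> k x \<noteq> 0" for k x using that \<psi>S[of x] m by (auto simp: \<Phi>_def)
  have \<Phi>t: "\<Phi> k \<in> test_functions \<Omega>" for k
  proof (rule test_functionsI)
    show "Ck j (\<Phi> k)" for j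
      unfolding \<Phi>_def \<psi>_def by (intro Ck_mult Ck_power bump_Ck Ck_exp_minus uk)
    show "x \<in> cball c R" if "\<Phi> k x \<noteq> 0" for x using \<Phi>S[OF that] by (simp add: S_def)
    show "cball c R \<subseteq> \<Omega>" using S\<Omega> by (simp add: S_def)
  qed
  have \<psi>t: "(\<lambda>x. \<psi> x ^ m) \<in> test_functions \<Omega>"
  proof (rule test_functionsI)
    show "Ck j (\<lambda>x. \<psi> x ^ m)" for j unfolding \<psi>_def by (intro Ck_power bump_Ck)
    show "x \<in> cball c R" if "\<psi> x ^ m \<noteq> 0" for x using that \<psi>S[of x] m by (auto simp: S_def)
    show "cball c R \<subseteq> \<Omega>" using S\<Omega> by (simp add: S_def)
  qed
  let ?P = "lborel \<Otimes>\<^sub>M lborel :: ('a \<times> 'a) measure"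
  define I where "I k = (LINT x|lborel. norm (D x) powr (p - 2) * (D x \<bullet> gradient (\<Phi> k) x))" for k
  define N where "N k = (LINT z|?P. nonlocal_integrand q s u (\<Phi> k) z)" for k
  define N0 where "N0 = (LINT z|?P. nonlocal_integrand q s u \<Phi>0 z)"

  have rhs: "(\<lambda>k. LINT x|lborel. F x * \<Phi> k x) \<longlonglongrightarrow> (LINT x|lborel. F x * \<Phi>0 x)"
  proof -
    \<comment> \<open>\<open>F\<close> is known to be integrable on the ball; the cut-off vanishes
      outside it, so the indicator can be inserted.\<close>
    have eq: "(indicator S x * F x) * (\<psi> x ^ m * e) = F x * (\<psi> x ^ m * e)" for x e
      using \<psi>S[of x] m by (cases "\<psi> x = 0") auto
    have "(\<lambda>k. LINT x|lborel. (indicator S x * F x) * \<Phi> k x) \<longlonglongrightarrow> (LINT x|lborel. (indicator S x * F x) * \<Phi>0 x)"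
    proof (rule integral_dominated_convergence[where w = "\<lambda>x. \<bar>indicator S x * F x\<bar>"])
      show "AE x in lborel. (\<lambda>k. (indicator S x * F x) * \<Phi> k x) \<longlonglongrightarrow> (indicator S x * F x) * \<Phi>0 x"
        using uk_lim
      proof eventually_elim
        case (elim x)
        then show ?case unfolding \<Phi>_def \<Phi>0_def by (intro tendsto_intros)
      qed
      show "AE x in lborel. norm ((indicator S x * F x) * \<Phi> k x) \<le> \<bar>indicator S x * F x\<bar>" for k
      proof (rule AE_I2)
        fix x
        have "\<bar>\<Phi> k x\<bar> \<le> 1"
          using \<psi>01[of x] uk(2)[of k x] by (auto simp: \<Phi>_def abs_mult power_le_one intro!: mult_le_one)
        then show "norm ((indicator S x * F x) * \<Phi> k x) \<le> \<bar>indicator S x * F x\<bar>"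
          unfolding real_norm_def abs_mult[of "indicator S x * F x"] by (rule mult_left_le) simp
      qed
      show "integrable lborel (\<lambda>x. \<bar>indicator S x * F x\<bar>)" using F unfolding S_def by (rule integrable_abs)
      have [measurable]: "(\<lambda>x. indicator S x * F x) \<in> borel_measurable lborel"
        using F unfolding S_def by (rule borel_measurable_integrable)
      show "(\<lambda>x. (indicator S x * F x) * \<Phi>0 x) \<in> borel_measurable lborel"
        "(\<lambda>x. (indicator S x * F x) * \<Phi> k x) \<in> borel_measurable lborel" for k
        by (rule borel_measurable_times; measurable)+
    qed
    then show ?thesis unfolding \<Phi>_def \<Phi>0_def eq .
  qed

  \<comment> \<open>An upper bound up to \<open>e\<close> is enough; this spares the identification
    of the limit of the local term.\<close>
  have I_le: "eventually (\<lambda>k. I k \<le> (real m * L) powr p * V + e) sequentially" if e: "e > 0" for e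
  proof -
    have "(\<integral>\<^sup>+x. (indicator S x * norm (D x)) powr p \<partial>lborel) < \<infinity>"
    proof (rule le_less_trans[OF nn_integral_mono Dp])
      show "ennreal ((indicator S x * norm (D x)) powr p) \<le> ennreal (indicator (cball c R') x * norm (D x) powr p)" for x
        using R by (intro ennreal_leI) (auto simp: S_def indicator_def)
    qed
    moreover have "(\<lambda>k. \<integral>\<^sup>+x. (indicator S x * norm (gradient (uk k) x - D x)) powr p \<partial>lborel) \<longlonglongrightarrow> 0"
    proof -
      have "(indicator S x * t) powr p = indicator S x * t powr p" for x and t :: real
        by (simp add: indicator_def)
      then show ?thesis using gp by simp
    qed
    ultimately have "(\<lambda>k. \<integral>\<^sup>+x. (indicator S x * norm (D x)) powr (p - 1) * (indicator S x * norm (gradient (uk k) x - D x)) \<partial>lborel) \<longlonglongrightarrow> 0"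
      using q by (intro nn_integral_powr_mult_tendsto_0) auto
    from ennreal_tendsto_0D[OF this e] show ?thesis
    proof eventually_elim
      case (elim k)
      define W where "W x = (indicator S x * norm (D x)) powr (p - 1) * (indicator S x * norm (gradient (uk k) x - D x))" for x
      have W0: "W x \<ge> 0" for x by (simp add: W_def)
      have [measurable]: "W \<in> borel_measurable borel" unfolding W_def by measurable
      have Wi: "integrable lborel W"
        using elim W0 by (intro integrableI_nonneg) (auto simp: W_def[symmetric] intro: le_less_trans)
      have "ennreal (LINT x|lborel. W x) \<le> ennreal e"
        using elim W0 Wi by (subst nn_integral_eq_integral[symmetric]) (auto simp: W_def)
      then have We: "(LINT x|lborel. W x) \<le> e" using e by simp
      have Si: "integrable lborel (\<lambda>x. (real m * L) powr p * indicator S x)"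
        using VS by (intro integrable_mult_right integrable_real_indicator) auto
      have "I k \<le> (LINT x|lborel. (real m * L) powr p * indicator S x + W x)"
        unfolding I_def
      proof (rule integral_mono')
        show "integrable lborel (\<lambda>x. (real m * L) powr p * indicator S x + W x)" using Si Wi by simp
        fix x
        show "0 \<le> (real m * L) powr p * indicator S x + W x" using W0 by simp
        show "norm (D x) powr (p - 2) * (D x \<bullet> gradient (\<Phi> k) x) \<le> (real m * L) powr p * indicator S x + W x"
        proof (cases "x \<in> S")
          case False
          then have "gradient (\<Phi> k) x = 0"
            using gradient_0_outside[of S "\<Phi> k" x] \<Phi>S by (auto simp: S_def)
          then show ?thesis using W0 by simp
        next
          case True
          define a where "a = norm (D x)"
          define w where "w = gradient (uk k) x - D x"
          define E where "E = exp (- uk k x)"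
          have a: "a \<ge> 0" and E: "0 < E" "E \<le> 1" using uk(2)[of k x] by (auto simp: a_def E_def)
          have a1: "a powr (p - 2) * a = a powr (p - 1)" using powr_minus_1_mult[OF a, of "p - 1"] by simp
          have a2: "a powr (p - 2) * (a * a) = a powr p" using powr_minus_1_mult[OF a, of p] a1 by (simp add: mult.assoc[symmetric])
          \<comment> \<open>Writing the gradient of \<open>uk k\<close> as D + w isolates the square
            |D|^2 that absorbs the gradient of the cut-off; \<open>w\<close> is the mollification
            error.\<close>
          have dw: "D x \<bullet> gradient (uk k) x = a * a + D x \<bullet> w"
            by (simp add: w_def inner_diff_right a_def dot_square_norm power2_eq_square)
          have g: "D x \<bullet> gradient (\<Phi> k) x = real m * \<psi> x ^ (m - 1) * E * (D x \<bullet> gradient \<psi> x)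
              - \<psi> x ^ m * E * (a * a + D x \<bullet> w)"
            unfolding \<Phi>_def gradient_cutoff_exp[OF \<psi>d ukd]
            by (simp add: inner_diff_right E_def dw)
          have "D x \<bullet> gradient \<psi> x \<le> a * L"
            using norm_cauchy_schwarz[of "D x" "gradient \<psi> x"] L(2)[of x] mult_left_mono[OF L(2)[of x] a]
            by (simp add: a_def \<psi>_def)
          then have 1: "real m * \<psi> x ^ (m - 1) * E * (D x \<bullet> gradient \<psi> x) \<le> real m * \<psi> x ^ (m - 1) * E * (a * L)"
            using \<psi>01[of x] E by (intro mult_left_mono) auto
          have "- (D x \<bullet> w) \<le> a * norm w"
            using Cauchy_Schwarz_ineq2[of "D x" w] by (simp add: a_def)
          then have 2: "\<psi> x ^ m * E * (- (D x \<bullet> w)) \<le> \<psi> x ^ m * E * (a * norm w)"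
            using \<psi>01[of x] E by (intro mult_left_mono) auto
          have "\<psi> x ^ m * E \<le> 1" using \<psi>01[of x] E by (intro mult_le_one) (auto simp: power_le_one)
          then have 3: "\<psi> x ^ m * E * (a * norm w) \<le> 1 * (a * norm w)"
            using a by (intro mult_right_mono) auto
          have "D x \<bullet> gradient (\<Phi> k) x \<le> real m * \<psi> x ^ (m - 1) * E * (a * L) - \<psi> x ^ m * E * (a * a) + a * norm w"
            unfolding g using 1 2 3 by (simp add: algebra_simps)
          then have "a powr (p - 2) * (D x \<bullet> gradient (\<Phi> k) x)
              \<le> a powr (p - 2) * (real m * \<psi> x ^ (m - 1) * E * (a * L) - \<psi> x ^ m * E * (a * a) + a * norm w)"
            by (intro mult_left_mono) auto
          also have "\<dots> = E * ((a powr (p - 2) * a) * (real m * \<psi> x ^ (m - 1) * L) - \<psi> x ^ m * (a powr (p - 2) * (a * a)))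
              + (a powr (p - 2) * a) * norm w"
            by (simp add: algebra_simps)
          also have "\<dots> = E * (a powr (p - 1) * (real m * \<psi> x ^ (m - 1) * L) - \<psi> x ^ m * a powr p) + a powr (p - 1) * norm w"
            by (simp only: a1 a2)
          \<comment> \<open>The negative term \<psi>^m |D|^p, which comes from differentiating
            exp(-u_k), cancels the one produced by Young's inequality.\<close>
          also have "\<dots> \<le> E * (real m * L) powr p + a powr (p - 1) * norm w"
          proof -
            have "a powr (p - 1) * (real m * \<psi> x ^ (m - 1) * L) - \<psi> x ^ m * a powr p \<le> (real m * L) powr p"
              using young_cutoff[OF a \<psi>01[of x], of L p m] L(1) q pm by simp
            then show ?thesis using E by (intro add_right_mono mult_left_mono) auto
          qed
          also have "\<dots> \<le> 1 * (real m * L) powr p + a powr (p - 1) * norm w"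
            using E by (intro add_right_mono mult_right_mono) auto
          finally show ?thesis using True by (simp add: a_def W_def w_def)
        qed
      qed
      also have "\<dots> = (real m * L) powr p * V + (LINT x|lborel. W x)"
        using Si Wi by (simp add: V_def)
      finally show ?case using We by linarith
    qed
  qed

  \<comment> \<open>Both claims come from gradients by the embedding on the ball, where R \<le> 1/2
    enters; the gradients of \<open>uk k\<close> are eventually bounded in L^q because they converge
    to \<open>D\<close> there.\<close>
  have seminorm_finite: "(\<integral>\<^sup>+z. diff_quot q s S u z powr q \<partial>?P) < \<infinity>"
    and seminorm_lim: "(\<lambda>k. \<integral>\<^sup>+z. diff_quot q s S (\<lambda>x. uk k x - u x) z powr q \<partial>?P) \<longlonglongrightarrow> 0"
  proof -
    define C where "C = (2::real) powr q"
    have C: "C > 0" by (simp add: C_def)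
    define G where "G k = (\<integral>\<^sup>+x. indicator S x * norm (gradient (uk k) x - D x) powr q \<partial>lborel)" for k
    have G0: "G \<longlonglongrightarrow> 0" using gq by (simp add: G_def[abs_def])
    have split: "(\<integral>\<^sup>+x. indicator S x * norm (f x + g x) powr q \<partial>lborel)
        \<le> ennreal C * ((\<integral>\<^sup>+x. indicator S x * norm (f x) powr q \<partial>lborel) + (\<integral>\<^sup>+x. indicator S x * norm (g x) powr q \<partial>lborel))"
      if [measurable]: "f \<in> borel_measurable borel" "g \<in> borel_measurable borel" for f g :: "'a \<Rightarrow> 'a"
    proof -
      have i: "norm (indicator S x *\<^sub>R v) powr q = indicator S x * norm v powr q" for x and v :: 'a
        by (simp add: indicator_def)
      have "(\<integral>\<^sup>+x. norm (indicator S x *\<^sub>R f x + indicator S x *\<^sub>R g x) powr q \<partial>lborel)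
        \<le> ennreal C * ((\<integral>\<^sup>+x. norm (indicator S x *\<^sub>R f x) powr q \<partial>lborel) + (\<integral>\<^sup>+x. norm (indicator S x *\<^sub>R g x) powr q \<partial>lborel))"
        unfolding C_def using q by (intro nn_integral_norm_add_powr_le) auto
      then show ?thesis by (simp only: scaleR_add_right[symmetric] i)
    qed
    have Dq: "(\<integral>\<^sup>+x. indicator (cball c R') x * norm (D x) powr q \<partial>lborel) < \<infinity>"
      using q by (intro nn_integral_powr_lower_exponent[OF D _ _ Dp]) auto
    have "(\<integral>\<^sup>+x. indicator S x * norm (D x) powr q \<partial>lborel) < \<infinity>"
    proof (rule le_less_trans[OF nn_integral_mono Dq])
      show "ennreal (indicator S x * norm (D x) powr q) \<le> ennreal (indicator (cball c R') x * norm (D x) powr q)" for x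
        using R by (intro ennreal_leI) (auto simp: S_def indicator_def)
    qed
    then obtain d where d: "(\<integral>\<^sup>+x. indicator S x * norm (D x) powr q \<partial>lborel) = ennreal d" "d \<ge> 0"
      by (auto simp: less_top_ennreal)
    have "eventually (\<lambda>k. (\<integral>\<^sup>+x. indicator S x * norm (gradient (uk k) x) powr q \<partial>lborel) \<le> ennreal (C * (1 + d))) sequentially"
      using ennreal_tendsto_0D[OF G0 zero_less_one]
    proof eventually_elim
      case (elim k)
      have "(\<integral>\<^sup>+x. indicator S x * norm (gradient (uk k) x) powr q \<partial>lborel) \<le> ennreal C * (G k + ennreal d)"
        using split[of "\<lambda>x. gradient (uk k) x - D x" D] by (simp add: G_def d)
      also have "\<dots> \<le> ennreal C * (ennreal 1 + ennreal d)" by (intro mult_left_mono add_right_mono elim) auto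
      also have "\<dots> = ennreal (C * (1 + d))" using C d by (subst ennreal_mult_plus) auto
      finally show ?case .
    qed
    from nn_integral_diff_quot_liminf[OF uk(1) _ uk_lim q(1) R(3) this[unfolded S_def], of s]
    have "(\<integral>\<^sup>+z. diff_quot q s S u z powr q \<partial>?P) \<le> ennreal A * ennreal (C * (1 + d))"
      by (simp add: A S_def)
    also have "\<dots> < \<infinity>" by (simp add: ennreal_mult_less_top)
    finally show "(\<integral>\<^sup>+z. diff_quot q s S u z powr q \<partial>?P) < \<infinity>" .
    show "(\<lambda>k. \<integral>\<^sup>+z. diff_quot q s S (\<lambda>x. uk k x - u x) z powr q \<partial>?P) \<longlonglongrightarrow> 0"
    proof (rule ennreal_tendsto_0I)
      fix e :: real assume e: "e > 0"
      \<comment> \<open>Makes A C (2 e1) equal to e A/(A+1), which is at most e, also when A =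
        0.\<close>
      define e1 where "e1 = e / (2 * C * (A + 1))"
      have e1: "e1 > 0" using e C A by (simp add: e1_def)
      have ev: "eventually (\<lambda>j. G j \<le> ennreal e1) sequentially" by (rule ennreal_tendsto_0D[OF G0 e1])
      then show "eventually (\<lambda>k. (\<integral>\<^sup>+z. diff_quot q s S (\<lambda>x. uk k x - u x) z powr q \<partial>?P) \<le> ennreal e) sequentially"
      proof eventually_elim
        case (elim k)
        \<comment> \<open>Inserting \<open>D\<close> expresses the gradient of the difference by two
          errors that are both small for large indices.\<close>
        have gd: "gradient (\<lambda>x. uk k x - uk j x) x = (gradient (uk k) x - D x) + (- (gradient (uk j) x - D x))" for j x
        proof (rule gradient_eqI)
          show "((\<lambda>x. uk k x - uk j x) has_derivative (\<lambda>v. ((gradient (uk k) x - D x) + (- (gradient (uk j) x - D x))) \<bullet> v)) (at x)"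
            by (rule has_derivative_eq_rhs[OF has_derivative_diff[OF has_derivative_gradient[OF ukd] has_derivative_gradient[OF ukd]]])
              (simp add: fun_eq_iff inner_diff_left inner_add_left)
        qed
        have h1: "eventually (\<lambda>j. (\<integral>\<^sup>+x. indicator S x * norm (gradient (\<lambda>x. uk k x - uk j x) x) powr q \<partial>lborel) \<le> ennreal (C * (2 * e1))) sequentially"
          using ev
        proof eventually_elim
          case (elim j)
          have "(\<integral>\<^sup>+x. indicator S x * norm (gradient (\<lambda>x. uk k x - uk j x) x) powr q \<partial>lborel) \<le> ennreal C * (G k + G j)"
            unfolding gd G_def using split[of "\<lambda>x. gradient (uk k) x - D x" "\<lambda>x. - (gradient (uk j) x - D x)"]
            by (simp add: norm_minus_commute)
          also have "\<dots> \<le> ennreal C * (ennreal e1 + ennreal e1)"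
            by (intro mult_left_mono add_mono elim \<open>G k \<le> ennreal e1\<close>) auto
          also have "\<dots> = ennreal (C * (2 * e1))" using C e1 by (subst ennreal_mult_plus) auto
          finally show ?case .
        qed
        have h2: "Ck (Suc 0) (\<lambda>x. uk k x - uk j x)" for j
        proof -
          have "Ck (Suc 0) (\<lambda>x. uk k x + (- 1) * uk j x)" by (intro Ck_add Ck_mult Ck_const uk)
          then show ?thesis by simp
        qed
        have h3: "AE x in lborel. (\<lambda>j. uk k x - uk j x) \<longlonglongrightarrow> uk k x - u x"
          using uk_lim by eventually_elim (intro tendsto_intros)
        have h4: "(\<lambda>x. uk k x - u x) \<in> borel_measurable borel" by measurable
        have "(\<integral>\<^sup>+z. diff_quot q s S (\<lambda>x. uk k x - u x) z powr q \<partial>?P) \<le> ennreal A * ennreal (C * (2 * e1))"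
          using nn_integral_diff_quot_liminf[OF h2 h4 h3 q(1) R(3) h1[unfolded S_def], of s]
          by (simp only: A S_def)
        also have "\<dots> = ennreal (A * (C * (2 * e1)))" using A C e1 by (simp add: ennreal_mult)
        also have "A * (C * (2 * e1)) = e * (A / (A + 1))" using C by (simp add: e1_def)
        also have "ennreal (e * (A / (A + 1))) \<le> ennreal e"
          using e A by (intro ennreal_leI mult_left_le) auto
        finally show ?case .
      qed
    qed
  qed

  \<comment> \<open>The integrand tested with \<psi>^m is integrable because \<psi>^m is itself a
    test function; the remaining term lives on the product of the ball with itself. So this is a
    majorant that involves no tail estimate for \<open>u\<close>.\<close>
  have nl_split: "\<bar>nonlocal_integrand q s u (\<lambda>x. \<psi> x ^ m * exp (- v x)) z\<bar>
      \<le> \<bar>nonlocal_integrand q s u (\<lambda>x. \<psi> x ^ m) z\<bar> + diff_quot q s S u z powr (q - 1) * diff_quot q s S v z"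
    if v: "\<And>x. v x \<ge> 0" for v z
  proof -
    obtain x y where z: "z = (x, y)" by fastforce
    define \<nu> where "\<nu> = norm (x - y) powr (real DIM('a) + s * q)"
    define J where "J = \<bar>u x - u y\<bar> powr (q - 2) * (u x - u y)"
    have J: "\<bar>J\<bar> = \<bar>u x - u y\<bar> powr (q - 1)"
      using powr_minus_1_mult[of "\<bar>u x - u y\<bar>" "q - 1"] by (simp add: J_def abs_mult)
    have \<nu>: "\<nu> \<ge> 0" by (simp add: \<nu>_def)
    have "\<bar>\<psi> x ^ m * exp (- v x) - \<psi> y ^ m * exp (- v y)\<bar>
        \<le> \<bar>\<psi> x ^ m - \<psi> y ^ m\<bar> + (if \<psi> x ^ m = 0 \<or> \<psi> y ^ m = 0 then 0 else \<bar>v x - v y\<bar>)"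
      using \<psi>01 v by (intro cutoff_exp_diff_le) (auto simp: power_le_one)
    also have "\<dots> \<le> \<bar>\<psi> x ^ m - \<psi> y ^ m\<bar> + indicator S x * indicator S y * \<bar>v x - v y\<bar>"
      using \<psi>S[of x] \<psi>S[of y] m by (auto simp: indicator_def)
    finally have "\<bar>J\<bar> * \<bar>\<psi> x ^ m * exp (- v x) - \<psi> y ^ m * exp (- v y)\<bar> / \<nu>
        \<le> \<bar>J\<bar> * (\<bar>\<psi> x ^ m - \<psi> y ^ m\<bar> + indicator S x * indicator S y * \<bar>v x - v y\<bar>) / \<nu>"
      using \<nu> by (intro divide_right_mono mult_left_mono) auto
    also have "\<dots> = \<bar>J\<bar> * \<bar>\<psi> x ^ m - \<psi> y ^ m\<bar> / \<nu> + indicator S x * indicator S y * (\<bar>J\<bar> * \<bar>v x - v y\<bar>) / \<nu>"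
      by (simp add: algebra_simps add_divide_distrib)
    also have "indicator S x * indicator S y * (\<bar>J\<bar> * \<bar>v x - v y\<bar>) / \<nu> = diff_quot q s S u z powr (q - 1) * diff_quot q s S v z"
      unfolding diff_quot_powr_mult[OF q(1)] J \<nu>_def by (simp add: z)
    finally show ?thesis
      using \<nu> by (simp add: nonlocal_integrand_def z J_def \<nu>_def abs_mult)
  qed

  have N_lim: "N \<longlonglongrightarrow> N0" and N0i: "integrable ?P (nonlocal_integrand q s u \<Phi>0)"
  proof -
    define G where "G z = \<bar>nonlocal_integrand q s u (\<lambda>x. \<psi> x ^ m) z\<bar> + diff_quot q s S u z powr q" for z
    define e where "e k z = diff_quot q s S u z powr (q - 1) * diff_quot q s S (\<lambda>x. uk k x - u x) z" for k z
    have dqq: "diff_quot q s S u z powr (q - 1) * diff_quot q s S u z = diff_quot q s S u z powr q" for z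
      by (rule powr_minus_1_mult[OF diff_quot_nonneg])
    have tri: "diff_quot q s S (uk k) z \<le> diff_quot q s S u z + diff_quot q s S (\<lambda>x. uk k x - u x) z" for k z
      unfolding diff_quot_def add_divide_distrib[symmetric] distrib_left[symmetric]
      by (intro divide_right_mono mult_left_mono) (auto simp: indicator_def)
    have dom: "\<bar>nonlocal_integrand q s u (\<Phi> k) z\<bar> \<le> G z + e k z" for k z
    proof -
      have "\<bar>nonlocal_integrand q s u (\<Phi> k) z\<bar>
          \<le> \<bar>nonlocal_integrand q s u (\<lambda>x. \<psi> x ^ m) z\<bar> + diff_quot q s S u z powr (q - 1) * diff_quot q s S (uk k) z"
        using nl_split[of "uk k" z] uk(2) unfolding \<Phi>_def by blast
      also have "diff_quot q s S u z powr (q - 1) * diff_quot q s S (uk k) z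
          \<le> diff_quot q s S u z powr (q - 1) * (diff_quot q s S u z + diff_quot q s S (\<lambda>x. uk k x - u x) z)"
        by (intro mult_left_mono tri) auto
      finally show ?thesis by (simp add: G_def e_def distrib_left dqq)
    qed
    have dom0: "\<bar>nonlocal_integrand q s u \<Phi>0 z\<bar> \<le> G z" for z
      using nl_split[of u z] u(2) unfolding \<Phi>0_def G_def by (simp add: dqq)
    have Gi: "integrable ?P G"
      unfolding G_def
    proof (intro Bochner_Integration.integrable_add integrable_abs)
      show "integrable ?P (nonlocal_integrand q s u (\<lambda>x. \<psi> x ^ m))" using eqn[OF \<psi>t] by simp
      show "integrable ?P (\<lambda>z. diff_quot q s S u z powr q)"
        using seminorm_finite by (intro integrableI_nonneg) auto
    qed
    have elim: "(\<lambda>k. \<integral>\<^sup>+z. e k z \<partial>?P) \<longlonglongrightarrow> 0"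
      unfolding e_def using q seminorm_finite seminorm_lim
      by (intro nn_integral_powr_mult_tendsto_0) (auto simp: diff_quot_nonneg)
    have e0: "e k z \<ge> 0" for k z by (simp add: e_def diff_quot_nonneg)
    have em: "e k \<in> borel_measurable ?P" for k unfolding e_def by measurable
    have nm: "nonlocal_integrand q s u \<Phi>0 \<in> borel_measurable ?P" unfolding nonlocal_integrand_def by measurable
    have lim: "AE z in ?P. (\<lambda>k. nonlocal_integrand q s u (\<Phi> k) z) \<longlonglongrightarrow> nonlocal_integrand q s u \<Phi>0 z"
      using lborel.AE_pair_fst[OF uk_lim] lborel.AE_pair_snd[OF uk_lim, where N = lborel]
    proof eventually_elim
      case (elim z)
      then show ?case
        unfolding nonlocal_integrand_def \<Phi>_def \<Phi>0_def case_prod_beta divide_inverse by (intro tendsto_intros)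
    qed
    have hk: "integrable ?P (nonlocal_integrand q s u (\<Phi> k))" for k using eqn[OF \<Phi>t] by simp
    show "N \<longlonglongrightarrow> N0" "integrable ?P (nonlocal_integrand q s u \<Phi>0)"
      unfolding N_def N0_def
      using integral_tendsto_dominated_error[OF hk nm lim em e0 elim Gi dom dom0] by simp_all
  qed

  have N0_le: "N0 \<le> nonlocal_const q m * L powr q * (2 * V * A)"
  proof -
    define H where "H z = (indicator S (fst z) + indicator S (snd z)) * Kernel q s (fst z - snd z)" for z :: "'a \<times> 'a"
    have H0: "H z \<ge> 0" for z by (simp add: H_def Kernel_def)
    have [measurable]: "H \<in> borel_measurable ?P" unfolding H_def by measurable
    have "(\<integral>\<^sup>+z. H z \<partial>?P) \<le> 2 * emeasure lborel S * ennreal A"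
      unfolding H_def using nn_integral_cutoff_kernel_le[of S q s] by (simp add: A)
    also have "\<dots> = ennreal (2 * V * A)" using VS A by (simp add: ennreal_mult)
    finally have Hn: "(\<integral>\<^sup>+z. H z \<partial>?P) \<le> ennreal (2 * V * A)" .
    then have Hi: "integrable ?P H" using H0 by (intro integrableI_nonneg) (auto intro: le_less_trans)
    have "ennreal (LINT z|?P. H z) \<le> ennreal (2 * V * A)"
      using Hn H0 Hi by (subst nn_integral_eq_integral[symmetric]) auto
    then have HV: "(LINT z|?P. H z) \<le> 2 * V * A" using VS A by simp
    have nc: "nonlocal_const q m \<ge> 0" by (simp add: nonlocal_const_def)
    have "N0 \<le> (LINT z|?P. nonlocal_const q m * L powr q * H z)"
      unfolding N0_def
    proof (rule integral_mono)
      show "integrable ?P (\<lambda>z. nonlocal_const q m * L powr q * H z)" using Hi by simp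
      fix z :: "'a \<times> 'a"
      obtain x y where z: "z = (x, y)" by fastforce
      define \<nu> where "\<nu> = norm (x - y) powr (real DIM('a) + s * q)"
      have \<nu>: "\<nu> \<ge> 0" by (simp add: \<nu>_def)
      have "\<bar>\<psi> x - \<psi> y\<bar> powr q \<le> L powr q * ((indicator S x + indicator S y) * min (norm (x - y)) 1 powr q)"
      proof (cases "x \<in> S \<or> y \<in> S")
        case False
        then have "\<psi> x = 0" "\<psi> y = 0" using \<psi>S by blast+
        then show ?thesis by simp
      next
        case True
        have "\<bar>\<psi> x - \<psi> y\<bar> \<le> L * norm (x - y)"
          using \<psi>d L(2) by (intro gradient_bound_lipschitz) (auto simp: \<psi>_def)
        \<comment> \<open>By \<open>L \<ge> 1\<close> one constant covers both the Lipschitz bound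
          and the bound by 1, which yields the minimum in \<open>Kernel\<close>.\<close>
        moreover have "\<bar>\<psi> x - \<psi> y\<bar> \<le> L * 1" using \<psi>01[of x] \<psi>01[of y] L(1) by linarith
        ultimately have "\<bar>\<psi> x - \<psi> y\<bar> \<le> L * min (norm (x - y)) 1" by (simp add: min_def)
        then have "\<bar>\<psi> x - \<psi> y\<bar> powr q \<le> (L * min (norm (x - y)) 1) powr q"
          using q by (intro powr_mono2) auto
        also have "\<dots> = L powr q * (1 * min (norm (x - y)) 1 powr q)" using L by (simp add: powr_mult)
        also have "\<dots> \<le> L powr q * ((indicator S x + indicator S y) * min (norm (x - y)) 1 powr q)"
          using True by (intro mult_left_mono mult_right_mono) (auto simp: indicator_def)
        finally show ?thesis .
      qed
      then have "nonlocal_const q m * \<bar>\<psi> x - \<psi> y\<bar> powr q / \<nu>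
          \<le> nonlocal_const q m * (L powr q * ((indicator S x + indicator S y) * min (norm (x - y)) 1 powr q)) / \<nu>"
        using \<nu> nc by (intro divide_right_mono mult_left_mono) auto
      moreover have "nonlocal_integrand q s u \<Phi>0 z \<le> nonlocal_const q m * \<bar>\<psi> x - \<psi> y\<bar> powr q / \<nu>"
        unfolding nonlocal_integrand_def z \<Phi>0_def prod.case \<nu>_def
        using u(2) \<psi>01 q pm by (intro divide_right_mono nonlocal_pointwise) auto
      ultimately show "nonlocal_integrand q s u \<Phi>0 z \<le> nonlocal_const q m * L powr q * H z"
        by (simp add: H_def Kernel_def z \<nu>_def mult.assoc)
    qed (rule N0i)
    also have "\<dots> = nonlocal_const q m * L powr q * (LINT z|?P. H z)" by simp
    also have "\<dots> \<le> nonlocal_const q m * L powr q * (2 * V * A)"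
      using HV nc by (intro mult_left_mono) auto
    finally show ?thesis .
  qed

  have "(LINT x|lborel. F x * \<Phi>0 x) \<le> (real m * L) powr p * V + N0"
  proof (rule field_le_epsilon)
    fix e :: real assume e: "e > 0"
    have "eventually (\<lambda>k. (LINT x|lborel. F x * \<Phi> k x) \<le> (real m * L) powr p * V + e + N k) sequentially"
      using I_le[OF e]
    proof eventually_elim
      case (elim k)
      have "(LINT x|lborel. F x * \<Phi> k x) = I k + N k" using eqn[OF \<Phi>t[of k]] by (simp add: I_def N_def)
      then show ?case using elim by simp
    qed
    moreover have "(\<lambda>k. (real m * L) powr p * V + e + N k) \<longlonglongrightarrow> (real m * L) powr p * V + e + N0"
      by (intro tendsto_intros N_lim)
    ultimately have "(LINT x|lborel. F x * \<Phi>0 x) \<le> (real m * L) powr p * V + e + N0"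
      using rhs by (intro tendsto_le[OF _ _ rhs]) auto
    then show "(LINT x|lborel. F x * \<Phi>0 x) \<le> (real m * L) powr p * V + N0 + e" by simp
  qed
  also have "\<dots> \<le> (real m * L) powr p * V + nonlocal_const q m * L powr q * (2 * V * A)"
    using N0_le by simp
  finally show ?thesis by (simp add: \<Phi>0_def \<psi>_def V_def S_def algebra_simps)
qed

section \<open>Boundary strips\<close>

lemma emeasure_translate:
  fixes z :: "'a::euclidean_space"
  assumes "A \<in> sets borel"
  shows "emeasure lborel {y. y + z \<in> A} = emeasure lborel A"
proof -
  have m: "{y. y + z \<in> A} \<in> sets borel"
    using measurable_sets[of "\<lambda>x. x + z" borel borel A] assms by (simp add: vimage_def)
  have "(\<integral>\<^sup>+y. indicator A (y + z) \<partial>lborel) = (\<integral>\<^sup>+y. indicator A y \<partial>lborel)"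
    using assms by (intro nn_integral_translate) auto
  moreover have "indicator A (y + z) = (indicator {y. y + z \<in> A} y :: ennreal)" for y by (simp add: indicator_def)
  ultimately show ?thesis using assms m by simp
qed

text \<open>Continuity bounds the gradient on compact sets, and convexity of the ball allows the
  mean value inequality there.\<close>

lemma Ck_lipschitz_cball:
  fixes f :: "'a::euclidean_space \<Rightarrow> real"
  assumes f: "Ck (Suc 0) f"
  obtains L where "L \<ge> 0" "\<And>x y. x \<in> cball c r \<Longrightarrow> y \<in> cball c r \<Longrightarrow> \<bar>f x - f y\<bar> \<le> L * norm (x - y)"
proof -
  have "compact (gradient f ` cball c r)"
    by (intro compact_continuous_image compact_cball Ck_gradient_continuous f)
  then obtain L where L: "L > 0" "\<And>x. x \<in> cball c r \<Longrightarrow> norm (gradient f x) \<le> L"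
    using bounded_pos[THEN iffD1, OF compact_imp_bounded] by (metis image_eqI)
  have der: "(f has_derivative (\<lambda>v. gradient f z \<bullet> v)) (at z within cball c r)" for z
    by (rule has_derivative_at_withinI[OF has_derivative_gradient[OF Ck_differentiable[OF f]]])
  have on: "onorm (\<lambda>v. gradient f z \<bullet> v) \<le> L" if "z \<in> cball c r" for z
  proof (rule onorm_bound)
    fix v
    have "\<bar>gradient f z \<bullet> v\<bar> \<le> norm (gradient f z) * norm v" by (rule Cauchy_Schwarz_ineq2)
    also have "\<dots> \<le> L * norm v" by (intro mult_right_mono L(2)[OF that] norm_ge_zero)
    finally show "norm (gradient f z \<bullet> v) \<le> L * norm v" by simp
  qed (use L in simp)
  have "norm (f x - f y) \<le> L * norm (x - y)" if "x \<in> cball c r" "y \<in> cball c r" for x y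
    by (rule differentiable_bound[OF convex_cball der on that])
  then show ?thesis using that[of L] L by simp
qed

text \<open>The strip consists of the points of a cylinder whose height \<open>H\<close> above the
  graph lies in [\<epsilon>, 2\<epsilon>). Translation along \<open>e\<close> changes
  \<open>H\<close> by exactly the shift, so a number of translates of order 1/\<epsilon> covers a
  fixed open set; this yields the volume bound without flattening the boundary. Moving by at most
  \<epsilon>/(2\<Lambda>) changes \<open>H\<close> by at most \<epsilon>/2, so that 0 < H <
  3\<epsilon> on the whole ball and a shift by 3\<epsilon> leaves \<open>\<Omega>\<close>.\<close>

lemma boundary_strip:
  fixes \<Omega> :: "'a::euclidean_space set"
  assumes \<Omega>: "open \<Omega>" "Ck_boundary 2 \<Omega>" and x0: "x0 \<in> frontier \<Omega>"
  obtains e :: 'a and \<Lambda> \<epsilon>0 c :: real and T :: "real \<Rightarrow> 'a set"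
  where "norm e = 1" "\<Lambda> \<ge> 1" "\<epsilon>0 > 0" "c > 0" "\<And>\<epsilon>. T \<epsilon> \<in> sets borel"
    "\<And>\<epsilon>. 0 < \<epsilon> \<Longrightarrow> \<epsilon> < \<epsilon>0 \<Longrightarrow> ennreal (c * \<epsilon>) \<le> emeasure lborel (T \<epsilon>)"
    "\<And>\<epsilon> y z. 0 < \<epsilon> \<Longrightarrow> \<epsilon> < \<epsilon>0 \<Longrightarrow> y \<in> T \<epsilon> \<Longrightarrow> z \<in> cball y (\<epsilon> / (2 * \<Lambda>)) \<Longrightarrow>
       z \<in> \<Omega> \<and> infdist z (frontier \<Omega>) \<le> 3 * \<epsilon> \<and> z - (3 * \<epsilon>) *\<^sub>R e \<notin> \<Omega>"
proof -
  obtain r e h where r: "r > 0" and e: "norm e = 1" and h: "Ck 2 h"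
    and chart: "\<Omega> \<inter> ball x0 r = {x \<in> ball x0 r. h (x - (x \<bullet> e) *\<^sub>R e) < x \<bullet> e}"
    using \<Omega>(2) x0 unfolding Ck_boundary_def by blast
  define P where "P x = x - (x \<bullet> e) *\<^sub>R e" for x
  define H where "H x = x \<bullet> e - h (P x)" for x
  have ee: "e \<bullet> e = 1" using e by (simp add: dot_square_norm)
  have Pe: "P (x + t *\<^sub>R e) = P x" for x t
    by (simp add: P_def inner_add_left ee algebra_simps)
  have He: "H (x + t *\<^sub>R e) = H x + t" for x t
    by (simp add: H_def Pe inner_add_left ee)
  have norm_e: "norm (t *\<^sub>R e) = \<bar>t\<bar>" for t using e by simp
  have in_\<Omega>: "x \<in> \<Omega> \<longleftrightarrow> H x > 0" if "x \<in> ball x0 r" for x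
    using that chart[unfolded set_eq_iff, rule_format, of x] by (simp add: H_def P_def)
  have h1: "Ck (Suc 0) h" using h Ck_Suc_imp[of "Suc 0" h] by (simp add: numeral_2_eq_2)
  have hc: "continuous_on UNIV h" by (rule Ck_continuous[OF h])
  have Pc: "continuous_on UNIV P" unfolding P_def by (intro continuous_intros)
  have Hc: "continuous_on UNIV H"
    unfolding H_def by (intro continuous_intros continuous_on_compose2[OF hc Pc]) auto
  have [measurable]: "H \<in> borel_measurable borel" "P \<in> borel_measurable borel"
    using Hc Pc by (auto intro: borel_measurable_continuous_onI)
  have Pn: "norm (P x - P y) \<le> 2 * norm (x - y)" for x y
  proof -
    have "P x - P y = (x - y) - ((x - y) \<bullet> e) *\<^sub>R e" by (simp add: P_def inner_diff_left algebra_simps)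
    also have "norm \<dots> \<le> norm (x - y) + norm (((x - y) \<bullet> e) *\<^sub>R e)" by (rule norm_triangle_ineq4)
    also have "\<dots> \<le> norm (x - y) + norm (x - y)"
      using Cauchy_Schwarz_ineq2[of "x - y" e] e by simp
    finally show ?thesis by simp
  qed
  \<comment> \<open>\<open>P\<close> is 2-Lipschitz and maps the ball of radius \<open>r\<close>
    into the ball of radius \<open>2 * r\<close>, on which \<open>h\<close> is Lipschitz. In the
    constant \<Lambda> = 1 + 2 Lh the 1 accounts for the coordinate along \<open>e\<close>.\<close>
  obtain Lh where Lh: "Lh \<ge> 0"
    "\<And>x y. x \<in> cball (P x0) (2 * r) \<Longrightarrow> y \<in> cball (P x0) (2 * r) \<Longrightarrow> \<bar>h x - h y\<bar> \<le> Lh * norm (x - y)"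
    by (rule Ck_lipschitz_cball[OF h1]) (rule that)
  define \<Lambda> where "\<Lambda> = 1 + 2 * Lh"
  have \<Lambda>: "\<Lambda> \<ge> 1" using Lh by (simp add: \<Lambda>_def)
  have Hlip: "\<bar>H x - H y\<bar> \<le> \<Lambda> * norm (x - y)" if "x \<in> ball x0 r" "y \<in> ball x0 r" for x y
  proof -
    have "P x \<in> cball (P x0) (2 * r)" "P y \<in> cball (P x0) (2 * r)"
      using that Pn[of x0 x] Pn[of x0 y] by (auto simp: dist_norm)
    then have "\<bar>h (P x) - h (P y)\<bar> \<le> Lh * norm (P x - P y)" by (rule Lh)
    also have "\<dots> \<le> Lh * (2 * norm (x - y))" using Lh Pn by (intro mult_left_mono) auto
    finally have "\<bar>h (P x) - h (P y)\<bar> \<le> Lh * (2 * norm (x - y))" .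
    moreover have "\<bar>x \<bullet> e - y \<bullet> e\<bar> \<le> norm (x - y)"
      using Cauchy_Schwarz_ineq2[of "x - y" e] e by (simp add: inner_diff_left)
    moreover have "H x - H y = (x \<bullet> e - y \<bullet> e) - (h (P x) - h (P y))" by (simp add: H_def)
    ultimately have "\<bar>H x - H y\<bar> \<le> norm (x - y) + Lh * (2 * norm (x - y))" by linarith
    then show ?thesis by (simp add: \<Lambda>_def algebra_simps)
  qed
  have x0n: "x0 \<notin> \<Omega>" using x0 \<Omega>(1) by (simp add: frontier_def interior_open)
  have H0: "H x0 = 0"
  proof -
    have "\<not> H x0 > 0" using in_\<Omega>[of x0] x0n r by auto
    \<comment> \<open>If \<open>H x0\<close> were negative, a neighbourhood of \<open>x0\<close>
      would miss \<open>\<Omega>\<close>, although \<open>x0\<close> is in its closure.\<close>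
    moreover have "\<not> H x0 < 0"
    proof
      assume "H x0 < 0"
      let ?W = "{x. H x < 0} \<inter> ball x0 r"
      have "open ?W"
        by (intro open_Int open_ball open_Collect_less Hc continuous_on_const)
      moreover have "x0 \<in> ?W \<inter> closure \<Omega>" using x0 \<open>H x0 < 0\<close> r by (simp add: frontier_def)
      ultimately have "?W \<inter> \<Omega> \<noteq> {}" using open_Int_closure_eq_empty[of ?W \<Omega>] by blast
      then obtain x where "x \<in> \<Omega>" "H x < 0" "x \<in> ball x0 r" by blast
      then show False using in_\<Omega>[of x] by simp
    qed
    ultimately show ?thesis by linarith
  qed
  obtain d where d: "d > 0" "\<And>w. norm (w - P x0) < d \<Longrightarrow> \<bar>h w - h (P x0)\<bar> < r / 8"
  proof -
    have "r / 8 > 0" using r by simp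
    then show ?thesis
      using hc that unfolding continuous_on_iff dist_norm real_norm_def by (meson UNIV_I)
  qed
  \<comment> \<open>In the cylinder the horizontal distance, the height and the oscillation of the
    graph are each at most r/8, so it stays within 3r/8 of \<open>x0\<close>.\<close>
  define \<kappa> where "\<kappa> = min d (r / 8)"
  have \<kappa>: "\<kappa> > 0" "\<kappa> \<le> d" "\<kappa> \<le> r / 8" using d r by (auto simp: \<kappa>_def)
  have cyl: "y \<in> ball x0 (r / 2)" if "norm (P y - P x0) < \<kappa>" "\<bar>H y\<bar> < \<kappa>" for y
  proof -
    have "y - x0 = (P y - P x0) + (y \<bullet> e - x0 \<bullet> e) *\<^sub>R e" by (simp add: P_def algebra_simps)
    then have "norm (y - x0) \<le> norm (P y - P x0) + \<bar>y \<bullet> e - x0 \<bullet> e\<bar>"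
      using norm_triangle_ineq[of "P y - P x0"] norm_e by metis
    moreover have "y \<bullet> e - x0 \<bullet> e = H y + (h (P y) - h (P x0))" using H0 by (simp add: H_def)
    moreover have "\<bar>h (P y) - h (P x0)\<bar> < r / 8" using that \<kappa> by (intro d) simp
    ultimately have "norm (y - x0) < r / 2" using that \<kappa> by linarith
    then show ?thesis by (simp add: dist_norm norm_minus_commute)
  qed
  define T where "T \<epsilon> = {y. norm (P y - P x0) < \<kappa> \<and> \<epsilon> \<le> H y \<and> H y < 2 * \<epsilon>}" for \<epsilon>
  define U where "U = {y. norm (P y - P x0) < \<kappa> \<and> 0 < H y \<and> H y < \<kappa>}"
  have Tm: "T \<epsilon> \<in> sets borel" for \<epsilon>
  proof -
    have "{y \<in> space borel. norm (P y - P x0) < \<kappa> \<and> \<epsilon> \<le> H y \<and> H y < 2 * \<epsilon>} \<in> sets borel" by measurable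
    then show ?thesis by (simp add: T_def)
  qed
  have Uo: "open U"
    unfolding U_def by (intro open_Collect_conj open_Collect_less continuous_intros Hc Pc)
  have "x0 + (\<kappa> / 2) *\<^sub>R e \<in> U" using \<kappa> by (simp add: U_def Pe He H0)
  then obtain \<rho> where \<rho>: "\<rho> > 0" "ball (x0 + (\<kappa> / 2) *\<^sub>R e) \<rho> \<subseteq> U"
    using Uo openE by blast
  have "U \<subseteq> ball x0 (r / 2)" using cyl by (auto simp: U_def)
  then have Ufin: "emeasure lborel U < \<infinity>" by (meson bounded_ball bounded_subset emeasure_bounded_finite)
  define \<mu> where "\<mu> = measure lborel U"
  have \<mu>1: "emeasure lborel U = ennreal \<mu>"
    using Ufin by (simp add: \<mu>_def emeasure_eq_ennreal_measure)
  have "0 < measure lborel (ball (x0 + (\<kappa> / 2) *\<^sub>R e) \<rho>)" using \<rho> by (simp add: content_ball_pos)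
  also have "\<dots> \<le> \<mu>"
    unfolding \<mu>_def using Uo Ufin by (intro measure_mono_fmeasurable \<rho> fmeasurableI) auto
  finally have \<mu>: "emeasure lborel U = ennreal \<mu>" "\<mu> > 0" using \<mu>1 by auto
  \<comment> \<open>At most 2\<kappa>/\<epsilon> translates of the strip cover \<open>U\<close>, so
    each has measure at least \<mu>\<epsilon>/(2\<kappa>).\<close>
  define c where "c = \<mu> / (2 * \<kappa>)"
  have c: "c > 0" using \<mu> \<kappa> by (simp add: c_def)
  have Tvol: "ennreal (c * \<epsilon>) \<le> emeasure lborel (T \<epsilon>)" if \<epsilon>: "0 < \<epsilon>" "\<epsilon> \<le> \<kappa>" for \<epsilon>
  proof (cases "emeasure lborel (T \<epsilon>) = \<infinity>")
    case False
    define N where "N = nat \<lceil>\<kappa> / \<epsilon>\<rceil>"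
    have N: "\<kappa> / \<epsilon> \<le> real N" "real N \<le> 2 * \<kappa> / \<epsilon>"
    proof -
      have "1 \<le> \<kappa> / \<epsilon>" using \<epsilon> by simp
      then show "\<kappa> / \<epsilon> \<le> real N" "real N \<le> 2 * \<kappa> / \<epsilon>" unfolding N_def by linarith+
    qed
    \<comment> \<open>Shifting by (1 - j)\<epsilon> carries the layer j\<epsilon> \<le> H <
      (j+1)\<epsilon> into the strip, whose lower edge is at \<epsilon> and not at 0.\<close>
    let ?Tj = "\<lambda>j. {y. y + ((1 - real j) * \<epsilon>) *\<^sub>R e \<in> T \<epsilon>}"
    have Tjm: "?Tj j \<in> sets borel" for j
      using measurable_sets[of "\<lambda>x. x + ((1 - real j) * \<epsilon>) *\<^sub>R e" borel borel "T \<epsilon>"] Tm by (simp add: vimage_def)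
    have "U \<subseteq> (\<Union>j<N. ?Tj j)"
    proof
      fix y assume y: "y \<in> U"
      define j where "j = nat \<lfloor>H y / \<epsilon>\<rfloor>"
      have Hy: "0 < H y / \<epsilon>" using y \<epsilon> by (simp add: U_def)
      then have j: "real j \<le> H y / \<epsilon>" "H y / \<epsilon> < real j + 1" unfolding j_def by linarith+
      have "H y / \<epsilon> < \<kappa> / \<epsilon>" using y \<epsilon> by (simp add: U_def divide_strict_right_mono)
      then have "real j < real N" using j N by linarith
      then have "j < N" by simp
      moreover have "real j * \<epsilon> \<le> H y" "H y < (real j + 1) * \<epsilon>" using j \<epsilon> by (simp_all add: field_simps)
      then have "y \<in> ?Tj j" using y unfolding T_def U_def mem_Collect_eq Pe He by (simp add: algebra_simps)
      ultimately show "y \<in> (\<Union>j<N. ?Tj j)" by blast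
    qed
    then have "emeasure lborel U \<le> emeasure lborel (\<Union>j<N. ?Tj j)"
      using Tjm by (intro emeasure_mono) auto
    also have "\<dots> \<le> (\<Sum>j<N. emeasure lborel (?Tj j))"
      using Tjm by (intro emeasure_subadditive_finite) auto
    also have "\<dots> = (\<Sum>j<N. emeasure lborel (T \<epsilon>))"
      by (intro sum.cong refl emeasure_translate Tm)
    also have "\<dots> = ennreal (real N * measure lborel (T \<epsilon>))"
      using False by (simp add: emeasure_eq_ennreal_measure ennreal_mult ennreal_of_nat_eq_real_of_nat)
    finally have "\<mu> \<le> real N * measure lborel (T \<epsilon>)" unfolding \<mu>(1) by (simp add: ennreal_le_iff)
    also have "\<dots> \<le> (2 * \<kappa> / \<epsilon>) * measure lborel (T \<epsilon>)" using N by (intro mult_right_mono) auto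
    finally have "c * \<epsilon> \<le> measure lborel (T \<epsilon>)" using \<epsilon> \<kappa> by (simp add: c_def field_simps)
    then show ?thesis using False by (simp add: emeasure_eq_ennreal_measure ennreal_leI)
  qed simp
  show ?thesis
  proof (rule that[OF e \<Lambda> _ c Tm])
    \<comment> \<open>With \<epsilon> below \<kappa>/8, hence below r/64, all points z + t e with
      |t| \<le> 3\<epsilon> stay in the chart, as \<epsilon>/2 + r/2 + 3\<epsilon> < r.\<close>
    show "\<kappa> / 8 > 0" using \<kappa> by simp
    show "ennreal (c * \<epsilon>) \<le> emeasure lborel (T \<epsilon>)" if "0 < \<epsilon>" "\<epsilon> < \<kappa> / 8" for \<epsilon>
      using that by (intro Tvol) auto
    fix \<epsilon> y z assume \<epsilon>: "0 < \<epsilon>" "\<epsilon> < \<kappa> / 8" and y: "y \<in> T \<epsilon>" and z: "z \<in> cball y (\<epsilon> / (2 * \<Lambda>))"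
    have zy: "norm (z - y) \<le> \<epsilon> / (2 * \<Lambda>)" using z by (simp add: dist_norm norm_minus_commute)
    have "\<epsilon> / (2 * \<Lambda>) \<le> \<epsilon> / 2" using \<epsilon> \<Lambda> by (intro divide_left_mono) auto
    then have zy2: "norm (z - y) \<le> \<epsilon> / 2" using zy by linarith
    have yb: "norm (y - x0) < r / 2" using cyl[of y] y \<epsilon> by (auto simp: T_def dist_norm norm_minus_commute)
    have ball: "z + t *\<^sub>R e \<in> ball x0 r" if "\<bar>t\<bar> \<le> 3 * \<epsilon>" for t
    proof -
      have "norm (z + t *\<^sub>R e - x0) = norm ((z - y) + (y - x0) + t *\<^sub>R e)"
        by (simp add: algebra_simps)
      then have "norm (z + t *\<^sub>R e - x0) \<le> norm (z - y) + norm (y - x0) + \<bar>t\<bar>"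
        using norm_e[of t] norm_triangle_ineq[of "(z - y) + (y - x0)" "t *\<^sub>R e"] norm_triangle_ineq[of "z - y" "y - x0"]
        by linarith
      also have "\<dots> < r" using zy2 yb that \<epsilon> \<kappa> by linarith
      finally show ?thesis by (simp add: dist_norm norm_minus_commute)
    qed
    have zb: "z \<in> ball x0 r" using ball[of 0] \<epsilon> by simp
    have "y \<in> ball x0 r" using yb r by (simp add: dist_norm norm_minus_commute)
    then have "\<bar>H z - H y\<bar> \<le> \<Lambda> * norm (z - y)" using zb by (intro Hlip)
    also have "\<dots> \<le> \<Lambda> * (\<epsilon> / (2 * \<Lambda>))" using zy \<Lambda> by (intro mult_left_mono) auto
    also have "\<dots> = \<epsilon> / 2" using \<Lambda> by simp
    finally have "\<bar>H z - H y\<bar> \<le> \<epsilon> / 2" .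
    moreover have "\<epsilon> \<le> H y" "H y < 2 * \<epsilon>" using y by (simp_all add: T_def)
    ultimately have Hz: "0 < H z" "H z \<le> 5 / 2 * \<epsilon>" using \<epsilon> by linarith+
    have z1: "z \<in> \<Omega>" using in_\<Omega>[OF zb] Hz by simp
    have z2: "z - (3 * \<epsilon>) *\<^sub>R e \<notin> \<Omega>"
      using in_\<Omega>[OF ball[of "- (3 * \<epsilon>)"]] \<epsilon> Hz He[of z "- (3 * \<epsilon>)"] by simp
    \<comment> \<open>The foot of \<open>z\<close> on the graph along \<open>e\<close>, at distance
      \<open>H z\<close>. It is a boundary point, being outside the open set \<open>\<Omega>\<close>
      and a limit of points just above the graph.\<close>
    define w where "w = z + (- H z) *\<^sub>R e"
    have wb: "w \<in> ball x0 r" unfolding w_def using Hz \<epsilon> by (intro ball) auto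
    have Hw: "H w = 0" unfolding w_def He by simp
    then have "w \<notin> \<Omega>" using in_\<Omega>[OF wb] by simp
    moreover have "w \<in> closure \<Omega>"
    proof -
      have "(\<lambda>n. w + (\<epsilon> / real (Suc n)) *\<^sub>R e) \<longlonglongrightarrow> w + 0 *\<^sub>R e"
        by (intro tendsto_intros LIMSEQ_Suc[OF lim_const_over_n])
      then have lim: "(\<lambda>n. w + (\<epsilon> / real (Suc n)) *\<^sub>R e) \<longlonglongrightarrow> w" by simp
      have "w + (\<epsilon> / real (Suc n)) *\<^sub>R e \<in> \<Omega>" for n
      proof -
        have n1: "\<epsilon> / real (Suc n) \<le> \<epsilon>" using \<epsilon> by (simp add: field_simps)
        have n2: "0 < \<epsilon> / real (Suc n)" using \<epsilon> by simp
        have "\<bar>- H z + \<epsilon> / real (Suc n)\<bar> \<le> 3 * \<epsilon>" using n1 n2 Hz \<epsilon> by linarith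
        then have "z + (- H z + \<epsilon> / real (Suc n)) *\<^sub>R e \<in> ball x0 r"
          by (rule ball)
        moreover have "w + (\<epsilon> / real (Suc n)) *\<^sub>R e = z + (- H z + \<epsilon> / real (Suc n)) *\<^sub>R e"
          by (simp only: w_def scaleR_add_left add.assoc)
        ultimately show ?thesis using in_\<Omega>[of "w + (\<epsilon> / real (Suc n)) *\<^sub>R e"] \<epsilon> by (simp add: He Hw)
      qed
      then show ?thesis
        unfolding closure_sequential using lim by (intro exI[of _ "\<lambda>n. w + (\<epsilon> / real (Suc n)) *\<^sub>R e"]) auto
    qed
    ultimately have "w \<in> frontier \<Omega>" using \<Omega>(1) by (simp add: frontier_def interior_open)
    then have "infdist z (frontier \<Omega>) \<le> dist z w" by (rule infdist_le)
    also have "\<dots> = H z" using Hz norm_e[of "H z"] by (simp add: w_def dist_norm)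
    finally have "infdist z (frontier \<Omega>) \<le> 3 * \<epsilon>" using Hz \<epsilon> by linarith
    then show "z \<in> \<Omega> \<and> infdist z (frontier \<Omega>) \<le> 3 * \<epsilon> \<and> z - (3 * \<epsilon>) *\<^sub>R e \<notin> \<Omega>"
      using z1 z2 by blast
  qed
qed

section \<open>Lower bounds on Whitney balls\<close>

text \<open>The cut-off has gradient at most L0/R, so the upper estimate is of size R^(-p) times the
  volume, and the lower bound on \<open>F\<close> carries the same R^(-p); they cancel and the bound
  is uniform in R. In the condition on \<open>C\<close>, 2^n is the ratio of the volumes of the
  balls of radii R and R/2, and exp(4m/3) compensates the lower bound of the m-th power of the bump
  on the smaller one.\<close>

lemma ball_lower_bound:
  fixes u F :: "'a::euclidean_space \<Rightarrow> real" and D :: "'a \<Rightarrow> 'a"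
  assumes u: "integrable lborel u" "\<And>x. u x \<ge> 0" and D [measurable]: "D \<in> borel_measurable borel"
    and F [measurable]: "F \<in> borel_measurable borel" and F0: "AE x in lborel. F x \<ge> 0"
    and weak: "\<And>\<phi>. \<phi> \<in> test_functions \<Omega> \<Longrightarrow> (LINT x|lborel. u x *\<^sub>R gradient \<phi> x) = - (LINT x|lborel. \<phi> x *\<^sub>R D x)"
    and sub: "cball y R' \<subseteq> \<Omega>" and R: "0 < R" "R < R'" "R \<le> 1 / 2"
    and q: "1 < q" "q \<le> p" and pm: "p \<le> real m" and s: "0 < s" "s < 1"
    and Dp: "(\<integral>\<^sup>+x. indicator (cball y R') x * norm (D x) powr p \<partial>lborel) < \<infinity>"
    and Fi: "integrable lborel (\<lambda>x. indicator (cball y R) x * F x)"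
    and eqn: "\<And>\<phi>. \<phi> \<in> test_functions \<Omega> \<Longrightarrow> integrable (lborel \<Otimes>\<^sub>M lborel) (nonlocal_integrand q s u \<phi>) \<and>
        (LINT x|lborel. norm (D x) powr (p - 2) * (D x \<bullet> gradient \<phi> x))
        + (LINT z|(lborel \<Otimes>\<^sub>M lborel). nonlocal_integrand q s u \<phi> z) = (LINT x|lborel. F x * \<phi> x)"
    and L0: "L0 \<ge> 1" "\<And>(c::'a) r x. r > 0 \<Longrightarrow> norm (gradient (bump c r) x) \<le> L0 / r"
    and A: "(\<integral>\<^sup>+z. Kernel q s (z :: 'a) \<partial>lborel) = ennreal A" "A \<ge> 0"
    and K: "K > 0" "AE x in lborel. x \<in> cball y (R / 2) \<longrightarrow> K * R powr (- p) * u x powr (- \<delta>) \<le> F x"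
    and C: "C \<ge> 2 ^ DIM('a) * ((real m * L0) powr p + 2 * nonlocal_const q m * A * L0 powr p) * exp (4 / 3 * real m) / K"
  shows "(\<integral>\<^sup>+x. indicator (cball y (R / 2)) x * (u x powr (- \<delta>) * exp (- u x)) \<partial>lborel)
    \<le> ennreal (C * measure lborel (cball y (R / 2)))"
proof -
  define B where "B = cball y (R / 2)"
  define k where "k = K * R powr (- p) * exp (- (4 / 3 * real m))"
  define C1 where "C1 = (real m * L0) powr p + 2 * nonlocal_const q m * A * L0 powr p"
  have k: "k > 0" using K R by (simp add: k_def)
  have nc: "nonlocal_const q m \<ge> 0" by (simp add: nonlocal_const_def)
  have [measurable]: "u \<in> borel_measurable borel" using u by auto
  have [measurable]: "bump y R \<in> borel_measurable borel" by (rule Ck_borel_measurable[OF bump_Ck])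
  have [measurable]: "B \<in> sets borel" by (simp add: B_def)
  let ?g = "\<lambda>x. F x * (bump y R x ^ m * exp (- u x))"
  have m0: "m > 0" using q pm by (cases m) auto
  have L1: "L0 / R \<ge> 1" using L0 R by simp
  have "(LINT x|lborel. ?g x)
      \<le> measure lborel (cball y R) * ((real m * (L0 / R)) powr p + 2 * nonlocal_const q m * A * (L0 / R) powr q)"
    by (rule caccioppoli[OF u D weak sub R q pm s Dp Fi eqn L1 L0(2)[OF R(1)] A])
  also have "\<dots> \<le> measure lborel (cball y R) * (C1 * R powr (- p))"
  proof (intro mult_left_mono)
    \<comment> \<open>As L0/R \<ge> 1 and q \<le> p, the nonlocal contribution is brought to the
      scale of the local one.\<close>
    have "(L0 / R) powr q \<le> (L0 / R) powr p" using q L1 by (intro powr_mono) auto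
    then have "2 * nonlocal_const q m * A * (L0 / R) powr q \<le> 2 * nonlocal_const q m * A * (L0 / R) powr p"
      using nc A by (intro mult_left_mono) auto
    moreover have "(L0 / R) powr p = L0 powr p * R powr (- p)"
      using L0 R by (simp add: powr_divide powr_minus_divide)
    moreover have "(real m * (L0 / R)) powr p = (real m * L0) powr p * R powr (- p)"
      using L0 R by (simp add: powr_divide[of "real m * L0" R] powr_minus_divide)
    ultimately show "(real m * (L0 / R)) powr p + 2 * nonlocal_const q m * A * (L0 / R) powr q \<le> C1 * R powr (- p)"
      by (simp add: C1_def algebra_simps)
  qed simp
  also have "measure lborel (cball y R) = 2 ^ DIM('a) * measure lborel B"
    using R by (simp add: B_def content_cball power_divide)
  also have "2 ^ DIM('a) * measure lborel B * (C1 * R powr (- p))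
      = (2 ^ DIM('a) * C1 * exp (4 / 3 * real m) / K) * measure lborel B * k"
    using K by (simp add: k_def exp_minus field_simps)
  also have "\<dots> \<le> C * measure lborel B * k"
    using C k by (intro mult_right_mono) (auto simp: C1_def)
  finally have J: "(LINT x|lborel. ?g x) \<le> C * measure lborel B * k" .
  have gi: "integrable lborel ?g"
  proof (rule Bochner_Integration.integrable_bound[OF Fi])
    show "AE x in lborel. norm (?g x) \<le> norm (indicator (cball y R) x * F x)"
    proof (rule AE_I2)
      fix x
      show "norm (?g x) \<le> norm (indicator (cball y R) x * F x)"
      proof (cases "x \<in> cball y R")
        case False
        then have "bump y R x = 0" using R by (auto simp: bump_eq_0_iff dist_norm norm_minus_commute)
        then show ?thesis using m0 by (simp add: power_0_left)
      next
        case True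
        have "bump y R x ^ m * exp (- u x) \<le> 1"
          using u(2)[of x] by (intro mult_le_one) (auto simp: bump_nonneg bump_le_1 power_le_one)
        then show ?thesis using True
          by (auto simp: abs_mult bump_nonneg intro!: mult_left_le)
      qed
    qed
  qed measurable
  have g0: "AE x in lborel. 0 \<le> ?g x"
    using F0 by eventually_elim (auto intro!: mult_nonneg_nonneg simp: bump_nonneg)
  have "ennreal k * (\<integral>\<^sup>+x. indicator B x * (u x powr (- \<delta>) * exp (- u x)) \<partial>lborel)
      = (\<integral>\<^sup>+x. ennreal k * ennreal (indicator B x * (u x powr (- \<delta>) * exp (- u x))) \<partial>lborel)"
    by (rule nn_integral_cmult[symmetric]) measurable
  also have "\<dots> \<le> (\<integral>\<^sup>+x. ennreal (?g x) \<partial>lborel)"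
  proof (rule nn_integral_mono_AE)
    show "AE x in lborel. ennreal k * ennreal (indicator B x * (u x powr (- \<delta>) * exp (- u x))) \<le> ennreal (?g x)"
      using K(2) g0
    proof eventually_elim
      case (elim x)
      show ?case
      proof (cases "x \<in> B")
        case True
        then have Fx: "K * R powr (- p) * u x powr (- \<delta>) \<le> F x" using elim by (simp add: B_def)
        have "exp (- (4 / 3 * real m)) = exp (- (4 / 3)) ^ m" by (simp add: exp_of_nat_mult[symmetric] mult.commute)
        also have "\<dots> \<le> bump y R x ^ m"
          using True R by (intro power_mono bump_lower) (auto simp: B_def dist_norm norm_minus_commute)
        finally have bm: "exp (- (4 / 3 * real m)) \<le> bump y R x ^ m" .
        have "k * (u x powr (- \<delta>) * exp (- u x)) = (K * R powr (- p) * u x powr (- \<delta>)) * (exp (- (4 / 3 * real m)) * exp (- u x))"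
          by (simp add: k_def)
        also have "\<dots> \<le> F x * (bump y R x ^ m * exp (- u x))"
          using K bm by (intro mult_mono Fx mult_right_mono order_trans[OF _ Fx]) auto
        finally show ?thesis using True k by (simp add: ennreal_mult[symmetric] ennreal_leI)
      qed (use elim in simp)
    qed
  qed
  also have "\<dots> = ennreal (LINT x|lborel. ?g x)" by (rule nn_integral_eq_integral[OF gi g0])
  also have "\<dots> \<le> ennreal (k * (C * measure lborel B))" using J by (intro ennreal_leI) (simp add: mult_ac)
  also have "\<dots> = ennreal k * ennreal (C * measure lborel B)" using k by (simp add: ennreal_mult')
  finally have "(\<integral>\<^sup>+x. indicator B x * (u x powr (- \<delta>) * exp (- u x)) \<partial>lborel) \<le> ennreal (C * measure lborel B)"
    using k by (subst (asm) ennreal_mult_le_mult_iff) auto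
  then show ?thesis by (simp add: B_def)
qed

text \<open>A Chebyshev-type argument: where u \<le> t the weight is at least 2C, and where u > t
  the power u^a is at least t^a. So 1 is at most weight/(2C) + (u/t)^a almost everywhere on
  \<open>B\<close>; after integration the first term takes at most half of the measure.\<close>

lemma ball_mass_bound:
  fixes u :: "'a::euclidean_space \<Rightarrow> real"
  assumes [measurable]: "u \<in> borel_measurable borel" "B \<in> sets borel"
    and u: "AE x in lborel. x \<in> B \<longrightarrow> 0 < u x" and B: "emeasure lborel B < \<infinity>"
    and w: "(\<integral>\<^sup>+x. indicator B x * (u x powr (- \<delta>) * exp (- u x)) \<partial>lborel) \<le> ennreal (C * measure lborel B)"
    and C: "C > 0" and \<delta>: "\<delta> > 0" and a: "a \<ge> 0"
    and t: "0 < t" "t \<le> 1" "2 * C \<le> t powr (- \<delta>) * exp (- 1)"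
  shows "ennreal (t powr a / 2 * measure lborel B) \<le> (\<integral>\<^sup>+x. indicator B x * u x powr a \<partial>lborel)"
proof (cases "(\<integral>\<^sup>+x. indicator B x * u x powr a \<partial>lborel) = \<infinity>")
  case False
  then obtain I where I: "(\<integral>\<^sup>+x. indicator B x * u x powr a \<partial>lborel) = ennreal I" "I \<ge> 0"
    by (cases "(\<integral>\<^sup>+x. indicator B x * u x powr a \<partial>lborel)") auto
  have lin: "ennreal (a * b + c * d) = ennreal a * ennreal b + ennreal c * ennreal d"
    if "a \<ge> 0" "b \<ge> 0" "c \<ge> 0" "d \<ge> 0" for a b c d
    using that by (simp add: ennreal_mult)
  have "emeasure lborel B = (\<integral>\<^sup>+x. indicator B x \<partial>lborel)" by simp
  also have "\<dots> \<le> (\<integral>\<^sup>+x. ennreal (1 / (2 * C)) * ennreal (indicator B x * (u x powr (- \<delta>) * exp (- u x)))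
      + ennreal (t powr (- a)) * ennreal (indicator B x * u x powr a) \<partial>lborel)"
  proof (rule nn_integral_mono_AE)
    show "AE x in lborel. indicator B x \<le> ennreal (1 / (2 * C)) * ennreal (indicator B x * (u x powr (- \<delta>) * exp (- u x)))
      + ennreal (t powr (- a)) * ennreal (indicator B x * u x powr a)"
      using u
    proof eventually_elim
      case (elim x)
      show ?case
      proof (cases "x \<in> B")
        case True
        then have ux: "0 < u x" using elim by simp
        have "1 \<le> 1 / (2 * C) * (u x powr (- \<delta>) * exp (- u x)) + t powr (- a) * u x powr a"
        proof (cases "u x \<le> t")
          case True
          have "t powr (- \<delta>) * exp (- 1) \<le> u x powr (- \<delta>) * exp (- u x)"
            using True ux t \<delta> by (intro mult_mono powr_mono2') auto
          then have "2 * C \<le> u x powr (- \<delta>) * exp (- u x)" using t by linarith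
          then have "1 \<le> 1 / (2 * C) * (u x powr (- \<delta>) * exp (- u x))" using C by (simp add: field_simps)
          then show ?thesis by (simp add: add_increasing2)
        next
          case False
          have "t powr (- a) * t powr a \<le> t powr (- a) * u x powr a"
            using False t a by (intro mult_left_mono powr_mono2) auto
          moreover have "t powr (- a) * t powr a = 1" using t by (simp add: powr_add[symmetric])
          ultimately show ?thesis using C by (simp add: add_increasing)
        qed
        then have "ennreal 1 \<le> ennreal (1 / (2 * C) * (u x powr (- \<delta>) * exp (- u x)) + t powr (- a) * u x powr a)"
          by (rule ennreal_leI)
        also have "\<dots> = ennreal (1 / (2 * C)) * ennreal (u x powr (- \<delta>) * exp (- u x)) + ennreal (t powr (- a)) * ennreal (u x powr a)"
          by (rule lin) (use C in auto)
        finally show ?thesis using True by simp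
      qed simp
    qed
  qed
  also have "\<dots> = ennreal (1 / (2 * C)) * (\<integral>\<^sup>+x. indicator B x * (u x powr (- \<delta>) * exp (- u x)) \<partial>lborel)
      + ennreal (t powr (- a)) * (\<integral>\<^sup>+x. indicator B x * u x powr a \<partial>lborel)"
    by (simp add: nn_integral_add nn_integral_cmult)
  also have "\<dots> \<le> ennreal (1 / (2 * C)) * ennreal (C * measure lborel B) + ennreal (t powr (- a)) * ennreal I"
    unfolding I(1) by (intro add_right_mono mult_left_mono w) auto
  also have "\<dots> = ennreal (1 / (2 * C) * (C * measure lborel B) + t powr (- a) * I)"
    by (rule lin[symmetric]) (use C I in auto)
  also have "1 / (2 * C) * (C * measure lborel B) = measure lborel B / 2" using C by simp
  finally have "ennreal (measure lborel B) \<le> ennreal (measure lborel B / 2 + t powr (- a) * I)"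
    using B by (simp add: emeasure_eq_ennreal_measure)
  then have "measure lborel B \<le> measure lborel B / 2 + t powr (- a) * I"
    using I by (subst (asm) ennreal_le_iff) auto
  then have "t powr a * (measure lborel B / 2) \<le> t powr a * (t powr (- a) * I)" by (intro mult_left_mono) auto
  also have "\<dots> = I" using t by (simp add: mult.assoc[symmetric] powr_add[symmetric])
  finally show ?thesis unfolding I(1) by (intro ennreal_leI) simp
qed simp

lemma small_powr_exists:
  fixes a b p \<epsilon>1 :: real
  assumes "p > 1" "a > 0" "b \<ge> 0" "\<epsilon>1 > 0"
  obtains \<epsilon> where "0 < \<epsilon>" "\<epsilon> < \<epsilon>1" "b * \<epsilon> powr p < a * \<epsilon>"
proof -
  have "((\<lambda>x::real. b * x powr (p - 1)) \<longlongrightarrow> b * 0 powr (p - 1)) (at_right 0)"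
    using assms by (intro tendsto_intros tendsto_powr') (auto simp: eventually_at_right_field intro!: exI[of _ 1])
  then have "((\<lambda>x::real. b * x powr (p - 1)) \<longlongrightarrow> 0) (at_right 0)" by simp
  from order_tendstoD(2)[OF this assms(2)]
  obtain d where d: "d > 0" "\<And>x. 0 < x \<Longrightarrow> x < d \<Longrightarrow> b * x powr (p - 1) < a"
    unfolding eventually_at_right_field by auto
  define \<epsilon> where "\<epsilon> = min d \<epsilon>1 / 2"
  have \<epsilon>: "0 < \<epsilon>" "\<epsilon> < d" "\<epsilon> < \<epsilon>1" using d assms by (auto simp: \<epsilon>_def)
  have "b * \<epsilon> powr (p - 1) * \<epsilon> < a * \<epsilon>" using d(2)[OF \<epsilon>(1,2)] \<epsilon>(1) by (intro mult_strict_right_mono)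
  moreover have "\<epsilon> powr (p - 1) * \<epsilon> = \<epsilon> powr p" using \<epsilon> by (intro powr_minus_1_mult) auto
  ultimately show ?thesis using that[of \<epsilon>] \<epsilon> by (simp add: mult.assoc)
qed

lemma threshold_exists:
  fixes C \<delta> :: real
  assumes "C > 0" "\<delta> > 0"
  obtains t where "0 < t" "t \<le> 1" "2 * C \<le> t powr (- \<delta>) * exp (- 1)"
proof -
  \<comment> \<open>The equation t^(-\<delta>) = K is solved for t; the maximum with 1 ensures t
    \<le> 1.\<close>
  define K where "K = max 1 (2 * C * exp 1)"
  define t where "t = K powr (- 1 / \<delta>)"
  have K: "K \<ge> 1" "2 * C * exp 1 \<le> K" by (auto simp: K_def)
  have "t powr (- \<delta>) = K" using assms K by (simp add: t_def powr_powr)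
  then have "2 * C \<le> t powr (- \<delta>) * exp (- 1)" using K by (simp add: exp_minus field_simps)
  moreover have "t \<le> 1"
    using powr_mono[of "- 1 / \<delta>" 0 K] assms K by (simp add: t_def)
  ultimately show ?thesis using that[of t] K by (simp add: t_def)
qed

text \<open>Fubini over centres y in \<open>T\<close> and offsets w in the ball of radius
  \<open>r\<close> takes the place of a covering by balls: for fixed y the integral over w is the
  mass of the ball around y, for fixed w the integral over y is the mass on the translate of
  \<open>T\<close> by w.\<close>

lemma nn_integral_strip_le:
  fixes V :: "'a::euclidean_space \<Rightarrow> ennreal"
  assumes [measurable]: "V \<in> borel_measurable borel" "T \<in> sets borel"
    and low: "\<And>y. y \<in> T \<Longrightarrow> k * emeasure lborel (cball (0::'a) r) \<le> (\<integral>\<^sup>+x. indicator (cball y r) x * V x \<partial>lborel)"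
    and up: "\<And>w. w \<in> cball 0 r \<Longrightarrow> (\<integral>\<^sup>+x. indicator {x. x - w \<in> T} x * V x \<partial>lborel) \<le> M"
    and r: "r > 0"
  shows "k * emeasure lborel T \<le> M"
proof -
  let ?b = "emeasure lborel (cball (0::'a) r)"
  have [measurable]: "cball (0::'a) r \<in> sets borel" by simp
  have shift: "(\<integral>\<^sup>+w. indicator (cball 0 r) w * V (y + w) \<partial>lborel) = (\<integral>\<^sup>+x. indicator (cball y r) x * V x \<partial>lborel)" for y
  proof -
    have [measurable]: "cball y r \<in> sets borel" by simp
    have "(\<integral>\<^sup>+x. indicator (cball y r) (x + y) * V (x + y) \<partial>lborel) = (\<integral>\<^sup>+x. indicator (cball y r) x * V x \<partial>lborel)"
      by (rule nn_integral_translate[where f = "\<lambda>x. indicator (cball y r) x * V x"]) measurable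
    moreover have "indicator (cball y r) (x + y) = (indicator (cball 0 r) x :: ennreal)" for x
      by (auto simp: indicator_def dist_norm)
    ultimately show ?thesis by (simp add: add.commute)
  qed
  have shift2: "(\<integral>\<^sup>+y. indicator T y * V (y + w) \<partial>lborel) = (\<integral>\<^sup>+x. indicator {x. x - w \<in> T} x * V x \<partial>lborel)" for w
  proof -
    have "(\<integral>\<^sup>+y. indicator T (y + w - w) * V (y + w) \<partial>lborel) = (\<integral>\<^sup>+x. indicator T (x - w) * V x \<partial>lborel)"
      by (rule nn_integral_translate[where f = "\<lambda>x. indicator T (x - w) * V x"]) measurable
    moreover have "indicator T (x - w) = (indicator {x. x - w \<in> T} x :: ennreal)" for x by (simp add: indicator_def)
    ultimately show ?thesis by simp
  qed
  have "(k * emeasure lborel T) * ?b = (\<integral>\<^sup>+y. indicator T y * (k * ?b) \<partial>lborel)"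
    by (subst nn_integral_multc) (auto simp: mult_ac)
  also have "\<dots> \<le> (\<integral>\<^sup>+y. \<integral>\<^sup>+w. indicator T y * (indicator (cball 0 r) w * V (y + w)) \<partial>lborel \<partial>lborel)"
  proof (rule nn_integral_mono)
    fix y
    have "indicator T y * (k * ?b) \<le> indicator T y * (\<integral>\<^sup>+w. indicator (cball 0 r) w * V (y + w) \<partial>lborel)"
      using low[of y] unfolding shift by (auto simp: indicator_def)
    also have "\<dots> = (\<integral>\<^sup>+w. indicator T y * (indicator (cball 0 r) w * V (y + w)) \<partial>lborel)"
      by (rule nn_integral_cmult[symmetric]) measurable
    finally show "indicator T y * (k * ?b) \<le> (\<integral>\<^sup>+w. indicator T y * (indicator (cball 0 r) w * V (y + w)) \<partial>lborel)" .
  qed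
  also have "\<dots> = (\<integral>\<^sup>+w. \<integral>\<^sup>+y. indicator T y * (indicator (cball 0 r) w * V (y + w)) \<partial>lborel \<partial>lborel)"
    by (rule lborel_pair.Fubini') measurable
  also have "\<dots> \<le> (\<integral>\<^sup>+w. indicator (cball (0::'a) r) w * M \<partial>lborel)"
  proof (rule nn_integral_mono)
    fix w :: 'a
    have "(\<integral>\<^sup>+y. indicator T y * (indicator (cball 0 r) w * V (y + w)) \<partial>lborel)
        = (\<integral>\<^sup>+y. indicator (cball 0 r) w * (indicator T y * V (y + w)) \<partial>lborel)"
      by (intro nn_integral_cong) (simp add: mult_ac)
    also have "\<dots> = indicator (cball 0 r) w * (\<integral>\<^sup>+y. indicator T y * V (y + w) \<partial>lborel)"
      by (rule nn_integral_cmult) measurable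
    also have "\<dots> \<le> indicator (cball 0 r) w * M"
      using up[of w] unfolding shift2 by (auto simp: indicator_def)
    finally show "(\<integral>\<^sup>+y. indicator T y * (indicator (cball 0 r) w * V (y + w)) \<partial>lborel) \<le> indicator (cball 0 r) w * M" .
  qed
  also have "\<dots> = M * ?b" by (subst nn_integral_multc) (auto simp: mult_ac)
  finally have le: "(k * emeasure lborel T) * ?b \<le> M * ?b" .
  have b: "?b = ennreal (measure lborel (cball (0::'a) r))"
    using emeasure_bounded_finite[OF bounded_cball[of "0::'a" r]] by (simp add: emeasure_eq_ennreal_measure)
  have "measure lborel (cball (0::'a) r) > 0" using r by (simp add: content_cball_pos)
  then show ?thesis
    using le unfolding b by (subst (asm) (1 2) mult.commute, subst (asm) ennreal_mult_le_mult_iff) auto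
qed

text \<open>The weak formulation in terms of Borel functions on the whole space. \<open>D\<close> is
  the gradient in the equation and \<open>E\<close> the one that is locally in L^p; the notion of
  weak solution provides them separately, and they are identified on balls. That u^\<gamma> belongs
  to W^{1,p}_0 is represented here by \<open>hardy\<close>.\<close>

lemma no_normalised_solution:
  fixes \<Omega> :: "'a::euclidean_space set" and u F :: "'a \<Rightarrow> real" and D E :: "'a \<Rightarrow> 'a"
  assumes \<Omega>: "open \<Omega>" "\<Omega> \<noteq> {}" "bounded \<Omega>" "Ck_boundary 2 \<Omega>"
    and q: "1 < q" "q \<le> p" and s: "0 < s" "s < 1" and \<delta>: "\<delta> > 0" and \<beta>: "\<beta> \<ge> p" and \<gamma>: "\<gamma> \<ge> 1"
    and u: "integrable lborel u" "\<And>x. u x \<ge> 0" and upos: "AE x in lborel. x \<in> \<Omega> \<longrightarrow> 0 < u x"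
    and D [measurable]: "D \<in> borel_measurable borel" and E [measurable]: "E \<in> borel_measurable borel"
    and F [measurable]: "F \<in> borel_measurable borel" and F0: "AE x in lborel. F x \<ge> 0"
    and weakD: "\<And>\<phi>. \<phi> \<in> test_functions \<Omega> \<Longrightarrow> (LINT x|lborel. u x *\<^sub>R gradient \<phi> x) = - (LINT x|lborel. \<phi> x *\<^sub>R D x)"
    and weakE: "\<And>\<phi>. \<phi> \<in> test_functions \<Omega> \<Longrightarrow> (LINT x|lborel. u x *\<^sub>R gradient \<phi> x) = - (LINT x|lborel. \<phi> x *\<^sub>R E x)"
    and D1: "\<And>c r. cball c r \<subseteq> \<Omega> \<Longrightarrow> (\<integral>\<^sup>+x. indicator (cball c r) x * norm (D x) \<partial>lborel) < \<infinity>"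
    and Ep: "\<And>c r. cball c r \<subseteq> \<Omega> \<Longrightarrow> (\<integral>\<^sup>+x. indicator (cball c r) x * norm (E x) powr p \<partial>lborel) < \<infinity>"
    and Fi: "\<And>c r. cball c r \<subseteq> \<Omega> \<Longrightarrow> integrable lborel (\<lambda>x. indicator (cball c r) x * F x)"
    and eqn: "\<And>\<phi>. \<phi> \<in> test_functions \<Omega> \<Longrightarrow> integrable (lborel \<Otimes>\<^sub>M lborel) (nonlocal_integrand q s u \<phi>) \<and>
        (LINT x|lborel. norm (D x) powr (p - 2) * (D x \<bullet> gradient \<phi> x))
        + (LINT z|(lborel \<Otimes>\<^sub>M lborel). nonlocal_integrand q s u \<phi> z) = (LINT x|lborel. F x * \<phi> x)"
    and M: "M \<ge> 0" and hardy: "\<And>S z. S \<in> sets borel \<Longrightarrow> S \<subseteq> \<Omega> \<Longrightarrow> (\<And>x. x \<in> S \<Longrightarrow> x - z \<notin> \<Omega>) \<Longrightarrow>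
        (\<integral>\<^sup>+x. indicator S x * u x powr (\<gamma> * p) \<partial>lborel) \<le> ennreal (M * norm z powr p)"
    and low: "c1 > 0" "\<rho> > 0" "AE x in lborel. x \<in> \<Omega> \<and> infdist x (frontier \<Omega>) < \<rho> \<longrightarrow>
        c1 * infdist x (frontier \<Omega>) powr (- \<beta>) * u x powr (- \<delta>) \<le> F x"
  shows False
proof -
  have p1: "1 < p" using q by simp
  have [measurable]: "u \<in> borel_measurable borel" using u by auto
  have "\<Omega> \<noteq> UNIV" using \<Omega>(3) not_bounded_UNIV by metis
  then have fr: "frontier \<Omega> \<noteq> {}" using \<Omega>(2) by (simp add: frontier_eq_empty)
  then obtain x0 where x0: "x0 \<in> frontier \<Omega>" by blast
  obtain e :: 'a and \<Lambda> \<epsilon>0 c :: real and T :: "real \<Rightarrow> 'a set"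
    where e: "norm e = 1" and \<Lambda>: "\<Lambda> \<ge> 1" and \<epsilon>0: "\<epsilon>0 > 0" and c: "c > 0"
      and Tm [measurable]: "\<And>\<epsilon>. T \<epsilon> \<in> sets borel"
      and Tvol: "\<And>\<epsilon>. 0 < \<epsilon> \<Longrightarrow> \<epsilon> < \<epsilon>0 \<Longrightarrow> ennreal (c * \<epsilon>) \<le> emeasure lborel (T \<epsilon>)"
      and T: "\<And>\<epsilon> y z. 0 < \<epsilon> \<Longrightarrow> \<epsilon> < \<epsilon>0 \<Longrightarrow> y \<in> T \<epsilon> \<Longrightarrow> z \<in> cball y (\<epsilon> / (2 * \<Lambda>)) \<Longrightarrow>
        z \<in> \<Omega> \<and> infdist z (frontier \<Omega>) \<le> 3 * \<epsilon> \<and> z - (3 * \<epsilon>) *\<^sub>R e \<notin> \<Omega>"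
    using boundary_strip[OF \<Omega>(1,4) x0] by metis
  obtain L0 where L0: "L0 \<ge> 1" "\<And>(c::'a) r x. r > 0 \<Longrightarrow> norm (gradient (bump c r) x) \<le> L0 / r"
    using bump_gradient_bound by metis
  obtain A where A: "(\<integral>\<^sup>+z. Kernel q s (z :: 'a) \<partial>lborel) = ennreal A" "A \<ge> 0"
    using nn_integral_Kernel_finite[OF q(1) s, where 'a = 'a] by (auto simp: less_top_ennreal)
  define m where "m = nat \<lceil>p\<rceil>"
  have pm: "p \<le> real m" unfolding m_def by linarith
  \<comment> \<open>With 3\<epsilon> = 12\<Lambda>R, as arranged below,
    \<open>K * R powr (- p)\<close> equals c1 (3\<epsilon>)^(-p).\<close>
  define K where "K = c1 * (12 * \<Lambda>) powr (- p)"
  have K: "K > 0" using low \<Lambda> by (simp add: K_def)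
  \<comment> \<open>The constant asked for by the ball estimate, enlarged by 1 to be
    positive.\<close>
  define C where "C = 1 + 2 ^ DIM('a) * ((real m * L0) powr p + 2 * nonlocal_const q m * A * L0 powr p) * exp (4 / 3 * real m) / K"
  have nc: "nonlocal_const q m \<ge> 0" by (simp add: nonlocal_const_def)
  have C: "C > 0" using K A nc by (auto simp: C_def intro!: add_pos_nonneg)
  obtain t where t: "0 < t" "t \<le> 1" "2 * C \<le> t powr (- \<delta>) * exp (- 1)" by (rule threshold_exists[OF C \<delta>])
  define k where "k = t powr (\<gamma> * p) / 2"
  have k: "k > 0" using t by (simp add: k_def)
  have "M * 3 powr p \<ge> 0" using M by simp
  \<comment> \<open>The bound by \<epsilon>0 is for the strip; 1/3 gives 3\<epsilon> \<le> 1, hence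
    (3\<epsilon>)^(-p) \<le> (3\<epsilon>)^(-\<beta>); \<rho>/3 puts the strip where
    \<open>f\<close> is bounded below. The last inequality will be contradicted; it can be had
    because p > 1.\<close>
  then obtain \<epsilon> where \<epsilon>: "0 < \<epsilon>" "\<epsilon> < Min {\<epsilon>0, 1 / 3, \<rho> / 3}" and \<epsilon>lt: "(M * 3 powr p) * \<epsilon> powr p < (k * c) * \<epsilon>"
    using small_powr_exists[OF p1, of "k * c" "M * 3 powr p" "Min {\<epsilon>0, 1 / 3, \<rho> / 3}"] k c \<epsilon>0 low(2) by auto
  have \<epsilon>': "\<epsilon> < \<epsilon>0" "3 * \<epsilon> \<le> 1" "3 * \<epsilon> < \<rho>" using \<epsilon> by auto
  \<comment> \<open>The admissible radius \<epsilon>/(2\<Lambda>) becomes 2R, which leaves room for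
    nested balls: both gradients are integrable on radius 2R and agree on 3R/2, which gives the
    margin for mollification in the energy estimate on radius R; the lower bound is drawn on
    R/2.\<close>
  define R where "R = \<epsilon> / (4 * \<Lambda>)"
  have R: "R > 0" "R \<le> 1 / 2" "\<epsilon> / (2 * \<Lambda>) = 2 * R" "3 * \<epsilon> = 12 * \<Lambda> * R"
    using \<epsilon> \<epsilon>' \<Lambda> by (auto simp: R_def field_simps)
  have strip: "ennreal k * emeasure lborel (T \<epsilon>) \<le> ennreal (M * (3 * \<epsilon>) powr p)"
  proof (rule nn_integral_strip_le[where V = "\<lambda>x. ennreal (u x powr (\<gamma> * p))" and r = "R / 2"])
    fix y assume y: "y \<in> T \<epsilon>"
    have TB: "z \<in> \<Omega>" "infdist z (frontier \<Omega>) \<le> 3 * \<epsilon>" if "z \<in> cball y (2 * R)" for z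
      using T[OF \<epsilon>(1) \<epsilon>'(1) y, of z] that R(3) by auto
    then have sub2: "cball y (2 * R) \<subseteq> \<Omega>" by blast
    have sub1: "cball y (3 / 2 * R) \<subseteq> \<Omega>" "cball y R \<subseteq> \<Omega>" using sub2 R by (auto intro!: subsetI dest: subsetD)
    have "(\<integral>\<^sup>+x. indicator (cball y (2 * R)) x * norm (E x) \<partial>lborel) < \<infinity>"
      using nn_integral_powr_lower_exponent[OF E _ _ Ep[OF sub2], of 1] p1 by simp
    then have DE: "AE x in lborel. x \<in> cball y (3 / 2 * R) \<longrightarrow> D x = E x"
      using R by (intro weak_gradient_unique_cball[OF u(1) D E weakD weakE sub2 _ D1[OF sub2]]) auto
    have "(\<integral>\<^sup>+x. indicator (cball y (3 / 2 * R)) x * norm (D x) powr p \<partial>lborel)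
        = (\<integral>\<^sup>+x. indicator (cball y (3 / 2 * R)) x * norm (E x) powr p \<partial>lborel)"
      using DE by (intro nn_integral_cong_AE) (auto elim!: eventually_mono simp: indicator_def)
    then have Dp: "(\<integral>\<^sup>+x. indicator (cball y (3 / 2 * R)) x * norm (D x) powr p \<partial>lborel) < \<infinity>"
      using Ep[OF sub1(1)] by simp
    have KF: "AE x in lborel. x \<in> cball y (R / 2) \<longrightarrow> K * R powr (- p) * u x powr (- \<delta>) \<le> F x"
      using low(3)
    proof eventually_elim
      case (elim x)
      show ?case
      proof
        assume "x \<in> cball y (R / 2)"
        then have "x \<in> cball y (2 * R)" using R by auto
        then have x: "x \<in> \<Omega>" "infdist x (frontier \<Omega>) \<le> 3 * \<epsilon>" by (rule TB)+
        have "x \<notin> frontier \<Omega>" using x(1) \<Omega>(1) by (simp add: frontier_def interior_open)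
        then have ip: "infdist x (frontier \<Omega>) > 0" using fr by (intro infdist_pos_not_in_closed) auto
        have "K * R powr (- p) = c1 * (3 * \<epsilon>) powr (- p)"
          using R \<Lambda> by (simp add: K_def powr_mult)
        also have "\<dots> \<le> c1 * (3 * \<epsilon>) powr (- \<beta>)"
          using \<epsilon> \<epsilon>' \<beta> low(1) by (intro mult_left_mono powr_mono') auto
        also have "\<dots> \<le> c1 * infdist x (frontier \<Omega>) powr (- \<beta>)"
          using ip x(2) low(1) \<beta> p1 by (intro mult_left_mono powr_mono2') auto
        finally have "K * R powr (- p) * u x powr (- \<delta>) \<le> c1 * infdist x (frontier \<Omega>) powr (- \<beta>) * u x powr (- \<delta>)"
          by (intro mult_right_mono) auto
        also have "\<dots> \<le> F x" using elim x \<epsilon>' by auto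
        finally show "K * R powr (- p) * u x powr (- \<delta>) \<le> F x" .
      qed
    qed
    have "(\<integral>\<^sup>+x. indicator (cball y (R / 2)) x * (u x powr (- \<delta>) * exp (- u x)) \<partial>lborel)
        \<le> ennreal (C * measure lborel (cball y (R / 2)))"
    proof (rule ball_lower_bound[OF u D F F0 weakD sub1(1) R(1) _ R(2) q pm s Dp Fi[OF sub1(2)] eqn L0 A K KF])
      show "R < 3 / 2 * R" using R by simp
    qed (simp_all add: C_def)
    then have "ennreal (t powr (\<gamma> * p) / 2 * measure lborel (cball y (R / 2)))
        \<le> (\<integral>\<^sup>+x. indicator (cball y (R / 2)) x * u x powr (\<gamma> * p) \<partial>lborel)"
    proof (rule ball_mass_bound[rotated 4])
      show "AE x in lborel. x \<in> cball y (R / 2) \<longrightarrow> 0 < u x"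
        using upos
      proof eventually_elim
        case (elim x)
        have "cball y (R / 2) \<subseteq> \<Omega>" using sub2 R by (auto intro!: subsetI dest: subsetD)
        then show ?case using elim by blast
      qed
      show "emeasure lborel (cball y (R / 2)) < \<infinity>" by (rule emeasure_bounded_finite[OF bounded_cball])
    qed (use C \<delta> t \<gamma> p1 in auto)
    moreover have "measure lborel (cball y (R / 2)) = measure lborel (cball (0::'a) (R / 2))"
      using R by (simp add: content_cball)
    moreover have "emeasure lborel (cball (0::'a) (R / 2)) = ennreal (measure lborel (cball (0::'a) (R / 2)))"
      using emeasure_bounded_finite[OF bounded_cball[of "0::'a" "R / 2"]] by (simp add: emeasure_eq_ennreal_measure)
    ultimately have "ennreal k * emeasure lborel (cball (0::'a) (R / 2))
        \<le> (\<integral>\<^sup>+x. ennreal (indicator (cball y (R / 2)) x * u x powr (\<gamma> * p)) \<partial>lborel)"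
      using k by (simp add: k_def ennreal_mult'[symmetric])
    also have "\<dots> = (\<integral>\<^sup>+x. indicator (cball y (R / 2)) x * ennreal (u x powr (\<gamma> * p)) \<partial>lborel)"
      by (intro nn_integral_cong) (simp add: indicator_def)
    finally show "ennreal k * emeasure lborel (cball (0::'a) (R / 2))
        \<le> (\<integral>\<^sup>+x. indicator (cball y (R / 2)) x * ennreal (u x powr (\<gamma> * p)) \<partial>lborel)" .
  next
    fix w :: 'a assume w: "w \<in> cball 0 (R / 2)"
    define S where "S = {x. x - w \<in> T \<epsilon>}"
    have Sm: "S \<in> sets borel"
      using measurable_sets[of "\<lambda>x. x - w" borel borel "T \<epsilon>"] by (simp add: S_def vimage_def)
    have S: "x \<in> \<Omega> \<and> x - (3 * \<epsilon>) *\<^sub>R e \<notin> \<Omega>" if "x \<in> S" for x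
    proof -
      \<comment> \<open>The offset w has length at most R/2, so \<open>x\<close> lies in the ball of
        radius 2R around the strip point x - w, where the strip properties hold.\<close>
      have "x \<in> cball (x - w) (\<epsilon> / (2 * \<Lambda>))" using w R by (simp add: dist_norm)
      then show ?thesis using T[OF \<epsilon>(1) \<epsilon>'(1), of "x - w" x] that by (simp add: S_def)
    qed
    have "(\<integral>\<^sup>+x. indicator S x * u x powr (\<gamma> * p) \<partial>lborel) \<le> ennreal (M * norm ((3 * \<epsilon>) *\<^sub>R e) powr p)"
      using S by (intro hardy Sm) auto
    also have "norm ((3 * \<epsilon>) *\<^sub>R e) = 3 * \<epsilon>" using e \<epsilon> by simp
    finally have "(\<integral>\<^sup>+x. ennreal (indicator S x * u x powr (\<gamma> * p)) \<partial>lborel) \<le> ennreal (M * (3 * \<epsilon>) powr p)" .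
    moreover have "(\<integral>\<^sup>+x. ennreal (indicator S x * u x powr (\<gamma> * p)) \<partial>lborel)
        = (\<integral>\<^sup>+x. indicator S x * ennreal (u x powr (\<gamma> * p)) \<partial>lborel)"
      by (intro nn_integral_cong) (simp add: indicator_def)
    ultimately show "(\<integral>\<^sup>+x. indicator {x. x - w \<in> T \<epsilon>} x * ennreal (u x powr (\<gamma> * p)) \<partial>lborel) \<le> ennreal (M * (3 * \<epsilon>) powr p)"
      by (simp add: S_def)
  qed (use R in \<open>auto intro: Tm\<close>)
  have "ennreal k * ennreal (c * \<epsilon>) \<le> ennreal k * emeasure lborel (T \<epsilon>)"
    by (rule mult_left_mono[OF Tvol[OF \<epsilon>(1) \<epsilon>'(1)]]) simp
  from this strip have "ennreal k * ennreal (c * \<epsilon>) \<le> ennreal (M * (3 * \<epsilon>) powr p)"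
    by (rule order_trans)
  then have "ennreal (k * (c * \<epsilon>)) \<le> ennreal (M * (3 * \<epsilon>) powr p)" using k by (simp add: ennreal_mult')
  then have "k * (c * \<epsilon>) \<le> M * (3 * \<epsilon>) powr p" using M by (simp add: ennreal_le_iff)
  also have "\<dots> = (M * 3 powr p) * \<epsilon> powr p" by (simp add: powr_mult)
  finally show False using \<epsilon>lt by simp
qed

section \<open>Passing from Lebesgue to Borel functions\<close>

text \<open>Completion supplies a Borel version of each coordinate. The factor
  \<open>indicator S\<close> makes the result vanish everywhere off \<open>S\<close>, not merely
  almost everywhere, so that integrals over \<open>S\<close> become integrals over the whole
  space.\<close>

lemma lebesgue_on_borel_representative:
  fixes f :: "'a::euclidean_space \<Rightarrow> 'b::euclidean_space"
  assumes S: "S \<in> sets borel" and f: "f \<in> borel_measurable (lebesgue_on S)"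
  obtains g where "g \<in> borel_measurable borel" "\<And>x. x \<notin> S \<Longrightarrow> g x = 0" "AE x in lborel. x \<in> S \<longrightarrow> g x = f x"
proof -
  have [measurable]: "S \<in> sets borel" by (rule S)
  have SL: "S \<in> sets lebesgue" using S by simp
  define h where "h x = (if x \<in> S then f x else 0)" for x
  have [measurable]: "h \<in> borel_measurable lebesgue"
    unfolding h_def using borel_measurable_if[OF SL] f by blast
  have "\<exists>g. g \<in> borel_measurable lborel \<and> (AE x in lborel. h x \<bullet> i = g x)" for i
  proof -
    have "(\<lambda>x. h x \<bullet> i) \<in> borel_measurable lebesgue" by measurable
    from completion_ex_borel_measurable_real[OF this] show ?thesis by blast
  qed
  then obtain g where g: "\<And>i. g i \<in> borel_measurable lborel" "\<And>i. AE x in lborel. h x \<bullet> i = g i x"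
    by metis
  have [measurable]: "g i \<in> borel_measurable borel" for i using g(1)[of i] by simp
  define G where "G x = (\<Sum>i\<in>Basis. (indicator S x * g i x) *\<^sub>R i)" for x
  have AE: "AE x in lborel. \<forall>i\<in>Basis. h x \<bullet> i = g i x"
    using g(2) by (intro AE_finite_allI) auto
  show ?thesis
  proof (rule that[of G])
    show "G \<in> borel_measurable borel" unfolding G_def by measurable
    show "G x = 0" if "x \<notin> S" for x using that by (simp add: G_def)
    show "AE x in lborel. x \<in> S \<longrightarrow> G x = f x"
      using AE
    proof eventually_elim
      case (elim x)
      show ?case
      proof
        assume x: "x \<in> S"
        then have "G x = (\<Sum>i\<in>Basis. (f x \<bullet> i) *\<^sub>R i)"
          unfolding G_def using elim by (intro sum.cong) (auto simp: h_def)
        then show "G x = f x" by (simp add: euclidean_representation)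
      qed
    qed
  qed
qed

lemma
  fixes f g :: "'a::euclidean_space \<Rightarrow> 'b::euclidean_space"
  assumes S: "S \<in> sets borel" and f: "f \<in> borel_measurable (lebesgue_on S)"
    and g: "g \<in> borel_measurable borel" "\<And>x. x \<notin> S \<Longrightarrow> g x = 0" "AE x in lborel. x \<in> S \<longrightarrow> g x = f x"
  shows integrable_lebesgue_on_representative: "integrable (lebesgue_on S) f \<longleftrightarrow> integrable lborel g"
    and integral_lebesgue_on_representative: "(LINT x|lebesgue_on S. f x) = (LINT x|lborel. g x)"
proof -
  have SL: "S \<inter> space lebesgue \<in> sets lebesgue" using S by simp
  have hm: "(\<lambda>x. indicator S x *\<^sub>R f x) \<in> borel_measurable lebesgue"
    using f S by (subst (asm) borel_measurable_restrict_space_iff) auto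
  have gm: "g \<in> borel_measurable lebesgue" using g(1) by (intro measurable_completion) simp
  have "AE x in lebesgue. x \<in> S \<longrightarrow> g x = f x" by (rule AE_completion[OF g(3)])
  then have AE: "AE x in lebesgue. indicator S x *\<^sub>R f x = g x"
    by eventually_elim (auto simp: indicator_def g(2))
  show "integrable (lebesgue_on S) f \<longleftrightarrow> integrable lborel g"
  proof -
    have "integrable (lebesgue_on S) f \<longleftrightarrow> integrable lebesgue (\<lambda>x. indicator S x *\<^sub>R f x)"
      by (rule integrable_restrict_space[OF SL])
    also have "\<dots> \<longleftrightarrow> integrable lebesgue g" by (rule integrable_cong_AE[OF hm gm AE])
    also have "\<dots> \<longleftrightarrow> integrable lborel g" using g(1) by (intro integrable_completion) simp
    finally show ?thesis .
  qed
  have "(LINT x|lebesgue_on S. f x) = (LINT x|lebesgue. indicator S x *\<^sub>R f x)"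
    by (rule integral_restrict_space[OF SL])
  also have "\<dots> = (LINT x|lebesgue. g x)" by (rule integral_cong_AE[OF hm gm AE])
  also have "\<dots> = (LINT x|lborel. g x)" using g(1) by (intro integral_completion) simp
  finally show "(LINT x|lebesgue_on S. f x) = (LINT x|lborel. g x)" .
qed

lemma Lp_representative_finite:
  fixes f g :: "'a::euclidean_space \<Rightarrow> 'b::euclidean_space"
  assumes S: "S \<in> sets borel" and f: "f \<in> Lp p S"
    and g: "g \<in> borel_measurable borel" "AE x in lborel. x \<in> S \<longrightarrow> g x = f x"
  shows "(\<integral>\<^sup>+x. indicator S x * norm (g x) powr p \<partial>lborel) < \<infinity>"
proof -
  have [measurable]: "f \<in> borel_measurable (lebesgue_on S)" using f by (simp add: Lp_def)
  have [measurable]: "S \<in> sets borel" "g \<in> borel_measurable borel" by fact+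
  have "integrable lborel (\<lambda>x. indicator S x * norm (g x) powr p)"
  proof (subst integrable_lebesgue_on_representative[symmetric, OF S])
    show "integrable (lebesgue_on S) (\<lambda>x. norm (f x) powr p)" using f by (simp add: Lp_def)
    show "(\<lambda>x. norm (f x) powr p) \<in> borel_measurable (lebesgue_on S)" by measurable
    show "AE x in lborel. x \<in> S \<longrightarrow> indicator S x * norm (g x) powr p = norm (f x) powr p"
      using g(2) by eventually_elim auto
  qed auto
  then show ?thesis by (auto simp: integrable_iff_bounded)
qed

text \<open>Serves to carry almost everywhere statements for \<open>lebesgue\<close> over to its
  product with itself.\<close>

lemma sigma_finite_lebesgue: "sigma_finite_measure (lebesgue :: 'a::euclidean_space measure)"
proof
  show "\<exists>A. countable A \<and> A \<subseteq> sets lebesgue \<and> \<Union> A = space (lebesgue :: 'a measure) \<and> (\<forall>a\<in>A. emeasure lebesgue a \<noteq> \<infinity>)"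
  proof (intro exI[of _ "range (\<lambda>n::nat. cball (0::'a) (real n))"] conjI ballI)
    show "\<Union> (range (\<lambda>n::nat. cball (0::'a) (real n))) = space lebesgue"
      by (auto simp: real_arch_simple)
    fix a assume "a \<in> range (\<lambda>n::nat. cball (0::'a) (real n))"
    then show "emeasure lebesgue a \<noteq> \<infinity>"
      using emeasure_bounded_finite[OF bounded_cball] by (auto simp: less_top)
  qed auto
qed

text \<open>The product of the completed measures lives on a larger sigma-algebra than the Borel
  product. The identity map pushes the former onto the latter, so Borel integrands have the same
  integrals.\<close>

lemma lborel_pair_eq_distr:
  "lborel \<Otimes>\<^sub>M lborel = distr (lebesgue \<Otimes>\<^sub>M lebesgue) (lborel \<Otimes>\<^sub>M lborel) (\<lambda>z :: 'a::euclidean_space \<times> 'a. z)"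
proof -
  have [simp]: "(\<lambda>x. x) \<in> borel_measurable (lebesgue :: 'a measure)"
    by (rule measurable_completion) simp
  have d: "distr lebesgue lborel (\<lambda>x. x) = (lborel :: 'a measure)"
    by (subst distr_completion) (auto intro: distr_id)
  have "distr lebesgue lborel (\<lambda>x. x) \<Otimes>\<^sub>M distr lebesgue lborel (\<lambda>x. x)
      = distr (lebesgue \<Otimes>\<^sub>M lebesgue) (lborel \<Otimes>\<^sub>M lborel) (\<lambda>(x :: 'a, y :: 'a). (x, y))"
    by (rule pair_measure_distr) (auto simp: d sigma_finite_lborel)
  then show ?thesis by (simp add: d id_def)
qed

lemma
  fixes f :: "'a::euclidean_space \<times> 'a \<Rightarrow> real"
  assumes f: "f \<in> borel_measurable (lborel \<Otimes>\<^sub>M lborel)"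
  shows integrable_lebesgue_pair: "integrable (lebesgue \<Otimes>\<^sub>M lebesgue) f \<longleftrightarrow> integrable (lborel \<Otimes>\<^sub>M lborel) f"
    and integral_lebesgue_pair: "(LINT z|(lebesgue \<Otimes>\<^sub>M lebesgue). f z) = (LINT z|(lborel \<Otimes>\<^sub>M lborel). f z)"
    and measurable_lebesgue_pair: "f \<in> borel_measurable (lebesgue \<Otimes>\<^sub>M lebesgue)"
proof -
  have "(\<lambda>x. x) \<in> (lebesgue \<rightarrow>\<^sub>M (lborel :: 'a measure))" by (rule measurable_completion) simp
  then have "(\<lambda>z. (fst z, snd z)) \<in> lebesgue \<Otimes>\<^sub>M lebesgue \<rightarrow>\<^sub>M (lborel \<Otimes>\<^sub>M lborel :: ('a \<times> 'a) measure)"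
    by (intro measurable_Pair measurable_compose[OF measurable_fst] measurable_compose[OF measurable_snd])
  then have id: "(\<lambda>z. z) \<in> lebesgue \<Otimes>\<^sub>M lebesgue \<rightarrow>\<^sub>M (lborel \<Otimes>\<^sub>M lborel :: ('a \<times> 'a) measure)" by simp
  show "integrable (lebesgue \<Otimes>\<^sub>M lebesgue) f \<longleftrightarrow> integrable (lborel \<Otimes>\<^sub>M lborel) f"
    using integrable_distr_eq[OF id f] unfolding lborel_pair_eq_distr[symmetric] by simp
  show "(LINT z|(lebesgue \<Otimes>\<^sub>M lebesgue). f z) = (LINT z|(lborel \<Otimes>\<^sub>M lborel). f z)"
    using integral_distr[OF id f] unfolding lborel_pair_eq_distr[symmetric] by simp
  show "f \<in> borel_measurable (lebesgue \<Otimes>\<^sub>M lebesgue)" using measurable_compose[OF id f] by simp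
qed

section \<open>Test functions and the decay of zero-trace functions at the boundary\<close>

lemma test_function_facts:
  assumes "\<phi> \<in> test_functions \<Omega>"
  shows "Ck k \<phi>" "x \<notin> \<Omega> \<Longrightarrow> \<phi> x = 0" "x \<notin> \<Omega> \<Longrightarrow> gradient \<phi> x = 0"
    "\<phi> \<in> borel_measurable borel" "gradient \<phi> \<in> borel_measurable borel"
proof -
  have C: "Ck k \<phi>" for k using assms by (simp add: test_functions_def)
  have sub: "closure {x. \<phi> x \<noteq> 0} \<subseteq> \<Omega>" using assms by (simp add: test_functions_def)
  show "Ck k \<phi>" by (rule C)
  show "\<phi> x = 0" if "x \<notin> \<Omega>" using that sub closure_subset[of "{x. \<phi> x \<noteq> 0}"] by blast
  show "gradient \<phi> x = 0" if "x \<notin> \<Omega>"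
  proof (rule gradient_0_outside[OF closed_closure])
    show "y \<in> closure {x. \<phi> x \<noteq> 0}" if "\<phi> y \<noteq> 0" for y
      using that closure_subset[of "{x. \<phi> x \<noteq> 0}"] by blast
    show "x \<notin> closure {x. \<phi> x \<noteq> 0}" using that sub by blast
  qed
  show "\<phi> \<in> borel_measurable borel" by (rule Ck_borel_measurable[OF C])
  show "gradient \<phi> \<in> borel_measurable borel"
    by (rule borel_measurable_continuous_onI[OF Ck_gradient_continuous[OF C]])
qed

lemma test_function_Lp_finite:
  fixes \<phi> :: "'a::euclidean_space \<Rightarrow> real"
  assumes \<phi>: "\<phi> \<in> test_functions \<Omega>" and p: "p > 0"
  shows "(\<integral>\<^sup>+x. norm (\<phi> x) powr p \<partial>lborel) < \<infinity>" "(\<integral>\<^sup>+x. norm (gradient \<phi> x) powr p \<partial>lborel) < \<infinity>"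
proof -
  have "bounded (closure {x. \<phi> x \<noteq> 0})" using \<phi> by (simp add: test_functions_def compact_imp_bounded)
  then obtain r where r: "closure {x. \<phi> x \<noteq> 0} \<subseteq> cball 0 r"
    unfolding bounded_iff by (auto simp: subset_iff)
  have supp: "x \<in> cball 0 r" if "\<phi> x \<noteq> 0" for x using r that closure_subset[of "{x. \<phi> x \<noteq> 0}"] by blast
  have *: "(\<integral>\<^sup>+x. norm (h x) powr p \<partial>lborel) < \<infinity>"
    if h: "\<And>x. norm (h x) \<le> B" "\<And>x. h x \<noteq> 0 \<Longrightarrow> x \<in> cball 0 r" for h :: "'a \<Rightarrow> 'b::real_normed_vector" and B
  proof -
    have "(\<integral>\<^sup>+x. norm (h x) powr p \<partial>lborel) \<le> (\<integral>\<^sup>+x. ennreal (B powr p) * indicator (cball (0::'a) r) x \<partial>lborel)"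
    proof (rule nn_integral_mono)
      fix x
      show "ennreal (norm (h x) powr p) \<le> ennreal (B powr p) * indicator (cball 0 r) x"
      proof (cases "h x = 0")
        case False
        have "norm (h x) powr p \<le> B powr p" using h(1)[of x] p by (intro powr_mono2) auto
        then show ?thesis using h(2)[OF False] by (simp add: ennreal_leI)
      qed (use p in simp)
    qed
    also have "\<dots> = ennreal (B powr p) * emeasure lborel (cball (0::'a) r)"
      by (simp add: nn_integral_cmult_indicator)
    also have "\<dots> < \<infinity>" using emeasure_bounded_finite[OF bounded_cball[of "0::'a" r]] by (simp add: ennreal_mult_less_top)
    finally show ?thesis .
  qed
  obtain B where B: "B \<ge> 0" "\<And>x. \<bar>\<phi> x\<bar> \<le> B"
    using Ck_bounded_support_bounded[OF test_function_facts(1)[OF \<phi>] supp] by metis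
  obtain L where L: "L \<ge> 0" "\<And>x. norm (gradient \<phi> x) \<le> L"
    using Ck_bounded_support_gradient_bounded[OF test_function_facts(1)[OF \<phi>] supp] by metis
  show "(\<integral>\<^sup>+x. norm (\<phi> x) powr p \<partial>lborel) < \<infinity>" using B supp by (intro *[of \<phi> B]) auto
  show "(\<integral>\<^sup>+x. norm (gradient \<phi> x) powr p \<partial>lborel) < \<infinity>"
  proof (rule *[OF L(2)])
    show "x \<in> cball 0 r" if "gradient \<phi> x \<noteq> 0" for x
      using that gradient_0_outside[OF closed_cball supp] by metis
  qed
qed

text \<open>If the translate of \<open>S\<close> by \<open>- z\<close> leaves \<open>\<Omega>\<close>, then a test function \<open>\<phi>\<close> satisfies
  \<open>\<phi> x = \<phi> x - \<phi> (x - z)\<close> on \<open>S\<close>, and the bound passes to the closure.\<close>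

lemma W1p0_hardy:
  fixes v v0 :: "'a::euclidean_space \<Rightarrow> real"
  assumes \<Omega>: "open \<Omega>" and v: "v \<in> W1p0 p \<Omega>" and p: "p > 1"
    and v0: "v0 \<in> borel_measurable borel" "\<And>x. x \<notin> \<Omega> \<Longrightarrow> v0 x = 0" "AE x in lborel. x \<in> \<Omega> \<longrightarrow> v0 x = v x"
  shows "\<exists>M\<ge>0. \<forall>S\<in>sets borel. \<forall>z. (\<forall>x\<in>S. x - z \<notin> \<Omega>) \<longrightarrow>
    (\<integral>\<^sup>+x. indicator S x * \<bar>v0 x\<bar> powr p \<partial>lborel) \<le> ennreal (M * norm z powr p)"
proof -
  have \<Omega>b: "\<Omega> \<in> sets borel" using \<Omega> by simp
  note [measurable] = v0(1)
  obtain Dv \<phi> where vLp: "v \<in> Lp p \<Omega>" and Dv: "Dv \<in> Lp p \<Omega>" and \<phi>: "\<And>k::nat. \<phi> k \<in> test_functions \<Omega>"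
    and lim: "(\<lambda>k. W1p_norm p \<Omega> (\<lambda>x. v x - \<phi> k x) (\<lambda>x. Dv x - gradient (\<phi> k) x)) \<longlonglongrightarrow> 0"
    using v by (auto simp: W1p0_def)
  have vm [measurable]: "v \<in> borel_measurable (lebesgue_on \<Omega>)" and Dvm [measurable]: "Dv \<in> borel_measurable (lebesgue_on \<Omega>)"
    using vLp Dv by (simp_all add: Lp_def)
  have [measurable]: "\<phi> k \<in> borel_measurable borel" "gradient (\<phi> k) \<in> borel_measurable borel" for k
    using test_function_facts(4,5)[OF \<phi>] by auto
  have lm: "f \<in> borel_measurable (lebesgue_on \<Omega>)" if "f \<in> borel_measurable borel" for f :: "'a \<Rightarrow> 'b::euclidean_space"
    using that by (intro measurable_restrict_space1 measurable_completion) simp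
  obtain W where W [measurable]: "W \<in> borel_measurable borel" and W0: "\<And>x. x \<notin> \<Omega> \<Longrightarrow> W x = 0" "AE x in lborel. x \<in> \<Omega> \<longrightarrow> W x = Dv x"
    by (rule lebesgue_on_borel_representative[OF \<Omega>b Dvm]) (rule that)
  have ind: "(\<integral>\<^sup>+x. indicator \<Omega> x * norm (h x) powr p \<partial>lborel) = (\<integral>\<^sup>+x. norm (h x) powr p \<partial>lborel)"
    if "\<And>x. x \<notin> \<Omega> \<Longrightarrow> h x = 0" for h :: "'a \<Rightarrow> 'b::euclidean_space"
    using that by (intro nn_integral_cong) (auto simp: indicator_def)
  have v0p: "(\<integral>\<^sup>+x. norm (v0 x) powr p \<partial>lborel) < \<infinity>"
    using Lp_representative_finite[OF \<Omega>b vLp v0(1,3)] ind[of v0] v0(2) by simp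
  have Wp: "(\<integral>\<^sup>+x. norm (W x) powr p \<partial>lborel) < \<infinity>"
    using Lp_representative_finite[OF \<Omega>b Dv W W0(2)] ind[of W] W0(1) by simp
  define a where "a k = (LINT x|lborel. norm (v0 x - \<phi> k x) powr p)" for k
  define b where "b k = (LINT x|lborel. norm (W x - gradient (\<phi> k) x) powr p)" for k
  have fin: "(\<integral>\<^sup>+x. norm (f x - g x) powr p \<partial>lborel) < \<infinity>"
    if [measurable]: "f \<in> borel_measurable borel" "g \<in> borel_measurable borel"
      and "(\<integral>\<^sup>+x. norm (f x) powr p \<partial>lborel) < \<infinity>" "(\<integral>\<^sup>+x. norm (g x) powr p \<partial>lborel) < \<infinity>"
    for f g :: "'a \<Rightarrow> 'b::euclidean_space"
  proof -
    have "(\<integral>\<^sup>+x. norm (f x + (- g x)) powr p \<partial>lborel)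
        \<le> ennreal (2 powr p) * ((\<integral>\<^sup>+x. norm (f x) powr p \<partial>lborel) + (\<integral>\<^sup>+x. norm (- g x) powr p \<partial>lborel))"
      using p by (intro nn_integral_norm_add_powr_le) auto
    also have "\<dots> < \<infinity>" using that by (simp add: ennreal_mult_less_top)
    finally show ?thesis by simp
  qed
  have p0: "p > 0" using p by simp
  have ai: "integrable lborel (\<lambda>x. norm (v0 x - \<phi> k x) powr p)" for k
    using fin[OF v0(1) _ v0p test_function_Lp_finite(1)[OF \<phi> p0]] by (intro integrableI_nonneg) auto
  have bi: "integrable lborel (\<lambda>x. norm (W x - gradient (\<phi> k) x) powr p)" for k
    using fin[OF W _ Wp test_function_Lp_finite(2)[OF \<phi> p0]] by (intro integrableI_nonneg) auto
  have a0: "a k \<ge> 0" and b0: "b k \<ge> 0" for k by (simp_all add: a_def b_def)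
  have a_eq: "(LINT x|lebesgue_on \<Omega>. \<bar>v x - \<phi> k x\<bar> powr p) = a k" for k
    unfolding a_def
  proof (rule integral_lebesgue_on_representative[OF \<Omega>b])
    have [measurable]: "\<phi> k \<in> borel_measurable (lebesgue_on \<Omega>)" by (rule lm) simp
    show "(\<lambda>x. \<bar>v x - \<phi> k x\<bar> powr p) \<in> borel_measurable (lebesgue_on \<Omega>)" by measurable
    show "AE x in lborel. x \<in> \<Omega> \<longrightarrow> norm (v0 x - \<phi> k x) powr p = \<bar>v x - \<phi> k x\<bar> powr p"
      using v0(3) by eventually_elim auto
    show "norm (v0 x - \<phi> k x) powr p = 0" if "x \<notin> \<Omega>" for x
      using v0(2)[OF that] test_function_facts(2)[OF \<phi> that] by simp
  qed simp
  have b_eq: "(LINT x|lebesgue_on \<Omega>. norm (Dv x - gradient (\<phi> k) x) powr p) = b k" for k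
    unfolding b_def
  proof (rule integral_lebesgue_on_representative[OF \<Omega>b])
    have [measurable]: "gradient (\<phi> k) \<in> borel_measurable (lebesgue_on \<Omega>)" by (rule lm) simp
    show "(\<lambda>x. norm (Dv x - gradient (\<phi> k) x) powr p) \<in> borel_measurable (lebesgue_on \<Omega>)" by measurable
    show "AE x in lborel. x \<in> \<Omega> \<longrightarrow> norm (W x - gradient (\<phi> k) x) powr p = norm (Dv x - gradient (\<phi> k) x) powr p"
      using W0(2) by eventually_elim auto
    show "norm (W x - gradient (\<phi> k) x) powr p = 0" if "x \<notin> \<Omega>" for x
      using W0(1)[OF that] test_function_facts(3)[OF \<phi> that] by simp
  qed simp
  \<comment> \<open>Raising to the power \<open>p\<close> undoes the root in the norm and leaves the
    sum of the two integrals.\<close>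
  have "(\<lambda>k. ((a k + b k) powr (1 / p)) powr p) \<longlonglongrightarrow> 0 powr p"
    using lim p0 by (intro tendsto_powr') (auto simp: W1p_norm_def a_eq b_eq)
  then have ab: "(\<lambda>k. a k + b k) \<longlonglongrightarrow> 0" using a0 b0 p0 by (simp add: powr_powr)
  have alim: "a \<longlonglongrightarrow> 0" and blim: "b \<longlonglongrightarrow> 0"
    using a0 b0 by (auto intro!: tendsto_sandwich[OF _ _ tendsto_const ab])
  obtain w where w: "(\<integral>\<^sup>+x. norm (W x) powr p \<partial>lborel) = ennreal w" "w \<ge> 0" using Wp by (auto simp: less_top_ennreal)
  define C where "C = (2::real) powr p"
  have C: "C > 0" by (simp add: C_def)
  show ?thesis
  \<comment> \<open>One factor \<open>C\<close> comes from splitting \<open>v0\<close> into a test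
    function and an error, the other from bounding the gradient of that test function by
    \<open>W\<close> and an error whose p-th power has integral below 1.\<close>
  proof (intro exI[of _ "C * C * (w + 1)"] conjI ballI allI impI)
    show "C * C * (w + 1) \<ge> 0" using C w by simp
    fix S :: "'a set" and z :: 'a
    assume [measurable]: "S \<in> sets borel" and S': "\<forall>x\<in>S. x - z \<notin> \<Omega>"
    have S: "x - z \<notin> \<Omega>" if "x \<in> S" for x using S' that by blast
    show "(\<integral>\<^sup>+x. indicator S x * \<bar>v0 x\<bar> powr p \<partial>lborel) \<le> ennreal (C * C * (w + 1) * norm z powr p)"
    proof (rule ennreal_le_epsilon)
      fix e :: real assume e: "e > 0"
      have "eventually (\<lambda>k. a k < e / C) sequentially" "eventually (\<lambda>k. b k < 1) sequentially"
        using order_tendstoD(2)[OF alim, of "e / C"] order_tendstoD(2)[OF blim, of 1] e C by auto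
      then obtain k where k: "a k < e / C" "b k < 1"
        by (metis (mono_tags, lifting) eventually_conj eventually_happens' sequentially_bot)
      have A: "(\<integral>\<^sup>+x. norm (v0 x - \<phi> k x) powr p \<partial>lborel) = ennreal (a k)"
        unfolding a_def by (rule nn_integral_eq_integral[OF ai]) simp
      have B: "(\<integral>\<^sup>+x. norm (W x - gradient (\<phi> k) x) powr p \<partial>lborel) = ennreal (b k)"
        unfolding b_def by (rule nn_integral_eq_integral[OF bi]) simp
      have grad: "(\<integral>\<^sup>+x. norm (gradient (\<phi> k) x) powr p \<partial>lborel) \<le> ennreal (C * (w + 1))"
      proof -
        have "(\<integral>\<^sup>+x. norm (W x + (- (W x - gradient (\<phi> k) x))) powr p \<partial>lborel)
            \<le> ennreal C * ((\<integral>\<^sup>+x. norm (W x) powr p \<partial>lborel) + (\<integral>\<^sup>+x. norm (- (W x - gradient (\<phi> k) x)) powr p \<partial>lborel))"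
          unfolding C_def using p by (intro nn_integral_norm_add_powr_le) auto
        also have "\<dots> = ennreal C * (ennreal w + ennreal (b k))" by (simp only: norm_minus_cancel w B)
        also have "\<dots> = ennreal (C * (w + b k))" using C w b0 by (intro ennreal_mult_plus) auto
        also have "\<dots> \<le> ennreal (C * (w + 1))" using C k by (intro ennreal_leI mult_left_mono) auto
        finally show ?thesis by simp
      qed
      have \<phi>S: "(\<integral>\<^sup>+x. indicator S x * norm (\<phi> k x) powr p \<partial>lborel) \<le> ennreal (norm z powr p * (C * (w + 1)))"
      proof -
        have "(\<integral>\<^sup>+x. ennreal (indicator S x * norm (\<phi> k x) powr p) \<partial>lborel)
            = (\<integral>\<^sup>+x. indicator S x * ennreal (\<bar>\<phi> k (x + (- z)) - \<phi> k x\<bar> powr p) \<partial>lborel)"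
          using test_function_facts(2)[OF \<phi> S] by (intro nn_integral_cong) (auto simp: indicator_def)
        also have "\<dots> \<le> ennreal (norm (- z) powr p) * (\<integral>\<^sup>+x. indicator UNIV x * ennreal (norm (gradient (\<phi> k) x) powr p) \<partial>lborel)"
          using p by (intro translation_estimate test_function_facts(1)[OF \<phi>]) auto
        also have "\<dots> \<le> ennreal (norm z powr p) * ennreal (C * (w + 1))"
          using grad by (simp add: mult_left_mono)
        finally show ?thesis using C w by (simp add: ennreal_mult)
      qed
      have "(\<integral>\<^sup>+x. indicator S x * \<bar>v0 x\<bar> powr p \<partial>lborel)
          = (\<integral>\<^sup>+x. norm (indicator S x * \<phi> k x + indicator S x * (v0 x - \<phi> k x)) powr p \<partial>lborel)"
        by (intro nn_integral_cong) (auto simp: indicator_def)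
      also have "\<dots> \<le> ennreal C * ((\<integral>\<^sup>+x. norm (indicator S x * \<phi> k x) powr p \<partial>lborel)
          + (\<integral>\<^sup>+x. norm (indicator S x * (v0 x - \<phi> k x)) powr p \<partial>lborel))"
        unfolding C_def using p by (intro nn_integral_norm_add_powr_le) auto
      also have "\<dots> \<le> ennreal C * (ennreal (norm z powr p * (C * (w + 1))) + ennreal (e / C))"
      proof (intro mult_left_mono add_mono)
        have "(\<integral>\<^sup>+x. norm (indicator S x * \<phi> k x) powr p \<partial>lborel) = (\<integral>\<^sup>+x. indicator S x * norm (\<phi> k x) powr p \<partial>lborel)"
          by (intro nn_integral_cong) (auto simp: indicator_def)
        then show "(\<integral>\<^sup>+x. norm (indicator S x * \<phi> k x) powr p \<partial>lborel) \<le> ennreal (norm z powr p * (C * (w + 1)))"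
          using \<phi>S by simp
        have "(\<integral>\<^sup>+x. norm (indicator S x * (v0 x - \<phi> k x)) powr p \<partial>lborel) \<le> (\<integral>\<^sup>+x. norm (v0 x - \<phi> k x) powr p \<partial>lborel)"
          by (intro nn_integral_mono) (auto simp: indicator_def)
        then show "(\<integral>\<^sup>+x. norm (indicator S x * (v0 x - \<phi> k x)) powr p \<partial>lborel) \<le> ennreal (e / C)"
          using A k by (simp add: order_trans ennreal_leI)
      qed simp
      also have "\<dots> = ennreal (C * (norm z powr p * (C * (w + 1)) + e / C))"
        using C w e by (intro ennreal_mult_plus) auto
      also have "C * (norm z powr p * (C * (w + 1)) + e / C) = C * C * (w + 1) * norm z powr p + e"
        using C by (simp add: algebra_simps)
      also have "ennreal (C * C * (w + 1) * norm z powr p + e) = ennreal (C * C * (w + 1) * norm z powr p) + ennreal e"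
        using C w e by (intro ennreal_plus) auto
      finally show "(\<integral>\<^sup>+x. indicator S x * \<bar>v0 x\<bar> powr p \<partial>lborel) \<le> ennreal (C * C * (w + 1) * norm z powr p) + ennreal e" .
    qed
  qed
qed

section \<open>Reduction of the weak formulation to Borel representatives\<close>

lemma Lp_loc_representative_cball:
  fixes f g :: "'a::euclidean_space \<Rightarrow> 'b::euclidean_space"
  assumes f: "f \<in> Lp_loc p \<Omega>" and g: "g \<in> borel_measurable borel" "AE x in lborel. x \<in> \<Omega> \<longrightarrow> g x = f x"
    and sub: "cball c r \<subseteq> \<Omega>"
  shows "(\<integral>\<^sup>+x. indicator (cball c r) x * norm (g x) powr p \<partial>lborel) < \<infinity>"
proof (rule Lp_representative_finite[OF _ _ g(1)])
  show "f \<in> Lp p (cball c r)" using f sub by (simp add: Lp_loc_def)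
  show "AE x in lborel. x \<in> cball c r \<longrightarrow> g x = f x"
    using g(2) by eventually_elim (use sub in auto)
qed simp

lemma weak_gradient_representative:
  fixes u u0 :: "'a::euclidean_space \<Rightarrow> real" and Du D0 :: "'a \<Rightarrow> 'a"
  assumes \<Omega>: "\<Omega> \<in> sets borel" and weak: "has_weak_gradient \<Omega> u Du" and \<phi>: "\<phi> \<in> test_functions \<Omega>"
    and u0: "u0 \<in> borel_measurable borel" "\<And>x. x \<notin> \<Omega> \<Longrightarrow> u0 x = 0" "AE x in lborel. x \<in> \<Omega> \<longrightarrow> u0 x = u x"
    and D0: "D0 \<in> borel_measurable borel" "\<And>x. x \<notin> \<Omega> \<Longrightarrow> D0 x = 0" "AE x in lborel. x \<in> \<Omega> \<longrightarrow> D0 x = Du x"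
  shows "(LINT x|lborel. u0 x *\<^sub>R gradient \<phi> x) = - (LINT x|lborel. \<phi> x *\<^sub>R D0 x)"
proof -
  note [measurable] = u0(1) D0(1) test_function_facts(4,5)[OF \<phi>]
  have [measurable]: "u \<in> borel_measurable (lebesgue_on \<Omega>)" "Du \<in> borel_measurable (lebesgue_on \<Omega>)"
    using weak by (simp_all add: has_weak_gradient_def Lp_loc_def)
  have [measurable]: "\<phi> \<in> borel_measurable (lebesgue_on \<Omega>)" "gradient \<phi> \<in> borel_measurable (lebesgue_on \<Omega>)"
    using test_function_facts(4,5)[OF \<phi>] by (auto intro!: measurable_restrict_space1 measurable_completion)
  have "(LINT x|lebesgue_on \<Omega>. u x *\<^sub>R gradient \<phi> x) = (LINT x|lborel. u0 x *\<^sub>R gradient \<phi> x)"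
  proof (rule integral_lebesgue_on_representative[OF \<Omega>])
    show "(\<lambda>x. u x *\<^sub>R gradient \<phi> x) \<in> borel_measurable (lebesgue_on \<Omega>)" by measurable
    show "AE x in lborel. x \<in> \<Omega> \<longrightarrow> u0 x *\<^sub>R gradient \<phi> x = u x *\<^sub>R gradient \<phi> x"
      using u0(3) by eventually_elim auto
  qed (auto simp: u0(2))
  moreover have "(LINT x|lebesgue_on \<Omega>. \<phi> x *\<^sub>R Du x) = (LINT x|lborel. \<phi> x *\<^sub>R D0 x)"
  proof (rule integral_lebesgue_on_representative[OF \<Omega>])
    show "(\<lambda>x. \<phi> x *\<^sub>R Du x) \<in> borel_measurable (lebesgue_on \<Omega>)" by measurable
    show "AE x in lborel. x \<in> \<Omega> \<longrightarrow> \<phi> x *\<^sub>R D0 x = \<phi> x *\<^sub>R Du x"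
      using D0(3) by eventually_elim auto
  qed (auto simp: D0(2))
  moreover have "(LINT x|lebesgue_on \<Omega>. u x *\<^sub>R gradient \<phi> x) = - (LINT x|lebesgue_on \<Omega>. \<phi> x *\<^sub>R Du x)"
    using weak \<phi> by (simp add: has_weak_gradient_def)
  ultimately show ?thesis by simp
qed

text \<open>The integrand also sees values outside \<open>\<Omega>\<close>, so the two functions
  have to agree almost everywhere on the whole space; a null set of one variable is then null in the
  product.\<close>

lemma nonlocal_representative:
  fixes u u0 \<phi> :: "'a::euclidean_space \<Rightarrow> real"
  assumes u0 [measurable]: "u0 \<in> borel_measurable borel" and AE: "AE x in lebesgue. u0 x = u x"
    and \<phi> [measurable]: "\<phi> \<in> borel_measurable borel"
    and int: "integrable (lebesgue \<Otimes>\<^sub>M lebesgue) (nonlocal_integrand q s u \<phi>)"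
  shows "integrable (lborel \<Otimes>\<^sub>M lborel) (nonlocal_integrand q s u0 \<phi>)"
    and "(LINT z|(lebesgue \<Otimes>\<^sub>M lebesgue). nonlocal_integrand q s u \<phi> z) = (LINT z|(lborel \<Otimes>\<^sub>M lborel). nonlocal_integrand q s u0 \<phi> z)"
proof -
  interpret leb: sigma_finite_measure "lebesgue :: 'a measure" by (rule sigma_finite_lebesgue)
  have m: "nonlocal_integrand q s u0 \<phi> \<in> borel_measurable (lborel \<Otimes>\<^sub>M lborel)"
    unfolding nonlocal_integrand_def by measurable
  have ae: "AE z in lebesgue \<Otimes>\<^sub>M lebesgue. nonlocal_integrand q s u \<phi> z = nonlocal_integrand q s u0 \<phi> z"
    using leb.AE_pair_fst[OF AE] leb.AE_pair_snd[OF AE, where N = lebesgue]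
    by eventually_elim (auto simp: nonlocal_integrand_def case_prod_beta)
  show "integrable (lborel \<Otimes>\<^sub>M lborel) (nonlocal_integrand q s u0 \<phi>)"
    using integrable_cong_AE_imp[OF int measurable_lebesgue_pair[OF m]] ae integrable_lebesgue_pair[OF m]
    by (auto elim!: eventually_mono)
  show "(LINT z|(lebesgue \<Otimes>\<^sub>M lebesgue). nonlocal_integrand q s u \<phi> z) = (LINT z|(lborel \<Otimes>\<^sub>M lborel). nonlocal_integrand q s u0 \<phi> z)"
    using integral_cong_AE[OF borel_measurable_integrable[OF int] measurable_lebesgue_pair[OF m] ae]
    by (simp add: integral_lebesgue_pair[OF m])
qed

lemma no_weak_solution:
  fixes \<Omega> :: "'a::euclidean_space set" and f u :: "'a \<Rightarrow> real"
  assumes \<Omega>: "open \<Omega>" "\<Omega> \<noteq> {}" "bounded \<Omega>" "Ck_boundary 2 \<Omega>"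
    and q: "1 < q" "q \<le> p" and s: "0 < s" "s < 1" and \<delta>: "\<delta> > 0" and \<beta>: "\<beta> \<ge> p"
    and f0: "AE x in lebesgue. x \<in> \<Omega> \<longrightarrow> f x \<ge> 0" and c1: "c1 > 0" and \<rho>: "\<rho> > 0"
    and low: "AE x in lebesgue. x \<in> \<Omega> \<and> infdist x (frontier \<Omega>) < \<rho> \<longrightarrow> c1 * infdist x (frontier \<Omega>) powr (- \<beta>) \<le> f x"
    and sol: "weak_solution p q s \<delta> \<Omega> f u"
  shows False
proof -
  have \<Omega>b [measurable]: "\<Omega> \<in> sets borel" using \<Omega> by simp
  have p: "p > 1" using q by simp
  obtain Dg where uLp: "u \<in> Lp_loc p \<Omega>" and Dg: "has_weak_gradient \<Omega> u Dg" "Dg \<in> Lp_loc p \<Omega>"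
    using sol by (auto simp: weak_solution_def W1p_loc_def)
  have uout: "AE x in lebesgue. x \<notin> \<Omega> \<longrightarrow> u x = 0" and upos: "AE x in lebesgue. x \<in> \<Omega> \<longrightarrow> u x > 0"
    and fu: "(\<lambda>x. f x * u x powr (- \<delta>)) \<in> Lp_loc 1 \<Omega>"
    using sol by (auto simp: weak_solution_def)
  obtain \<gamma> where \<gamma>: "\<gamma> \<ge> 1" "(\<lambda>x. u x powr \<gamma>) \<in> W1p0 p \<Omega>" using sol by (auto simp: weak_solution_def)
  obtain Du where Du: "has_weak_gradient \<Omega> u Du"
    and eqn: "\<And>\<phi>. \<phi> \<in> test_functions \<Omega> \<Longrightarrow> integrable (lebesgue \<Otimes>\<^sub>M lebesgue) (nonlocal_integrand q s u \<phi>) \<and>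
      (LINT x|lebesgue_on \<Omega>. norm (Du x) powr (p - 2) * (Du x \<bullet> gradient \<phi> x))
      + (LINT z|(lebesgue \<Otimes>\<^sub>M lebesgue). nonlocal_integrand q s u \<phi> z)
      = (LINT x|lebesgue_on \<Omega>. f x * u x powr (- \<delta>) * \<phi> x)"
    using sol unfolding weak_solution_def by blast
  have um [measurable]: "u \<in> borel_measurable (lebesgue_on \<Omega>)" using uLp by (simp add: Lp_loc_def)
  have Dum [measurable]: "Du \<in> borel_measurable (lebesgue_on \<Omega>)" using Du by (simp add: has_weak_gradient_def Lp_loc_def)
  have Dgm: "Dg \<in> borel_measurable (lebesgue_on \<Omega>)" using Dg by (simp add: Lp_loc_def)
  have fum [measurable]: "(\<lambda>x. f x * u x powr (- \<delta>)) \<in> borel_measurable (lebesgue_on \<Omega>)" using fu by (simp add: Lp_loc_def)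
  obtain u1 where u1: "u1 \<in> borel_measurable borel" "\<And>x. x \<notin> \<Omega> \<Longrightarrow> u1 x = 0" "AE x in lborel. x \<in> \<Omega> \<longrightarrow> u1 x = u x"
    by (rule lebesgue_on_borel_representative[OF \<Omega>b um]) (rule that)
  obtain D0 where D0: "D0 \<in> borel_measurable borel" "\<And>x. x \<notin> \<Omega> \<Longrightarrow> D0 x = 0" "AE x in lborel. x \<in> \<Omega> \<longrightarrow> D0 x = Du x"
    by (rule lebesgue_on_borel_representative[OF \<Omega>b Dum]) (rule that)
  obtain E0 where E0: "E0 \<in> borel_measurable borel" "\<And>x. x \<notin> \<Omega> \<Longrightarrow> E0 x = 0" "AE x in lborel. x \<in> \<Omega> \<longrightarrow> E0 x = Dg x"
    by (rule lebesgue_on_borel_representative[OF \<Omega>b Dgm]) (rule that)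
  obtain F0 where F0: "F0 \<in> borel_measurable borel" "\<And>x. x \<notin> \<Omega> \<Longrightarrow> F0 x = 0"
    "AE x in lborel. x \<in> \<Omega> \<longrightarrow> F0 x = f x * u x powr (- \<delta>)"
    by (rule lebesgue_on_borel_representative[OF \<Omega>b fum]) (rule that)
  \<comment> \<open>The representative is made nonnegative everywhere, since the pointwise
    inequalities are applied without exceptional sets. As u > 0 almost everywhere in
    \<open>\<Omega>\<close>, it still agrees with \<open>u\<close> there up to a null set.\<close>
  define u0 where "u0 x = max 0 (u1 x)" for x
  note [measurable] = u1(1) D0(1) E0(1) F0(1)
  have u0m [measurable]: "u0 \<in> borel_measurable borel" unfolding u0_def by measurable
  have u00: "u0 x \<ge> 0" for x by (simp add: u0_def)
  have u0out: "u0 x = 0" if "x \<notin> \<Omega>" for x using u1(2)[OF that] by (simp add: u0_def)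
  have upos': "AE x in lborel. x \<in> \<Omega> \<longrightarrow> u x > 0" using upos by (simp add: AE_completion_iff)
  have u0u: "AE x in lborel. x \<in> \<Omega> \<longrightarrow> u0 x = u x"
    using u1(3) upos' by eventually_elim (auto simp: u0_def)
  have u0pos: "AE x in lborel. x \<in> \<Omega> \<longrightarrow> 0 < u0 x" using u0u upos' by eventually_elim auto
  have u0uL: "AE x in lebesgue. u0 x = u x"
    using AE_completion[OF u0u] uout by eventually_elim (auto simp: u0out)
  have f0': "AE x in lborel. x \<in> \<Omega> \<longrightarrow> f x \<ge> 0" using f0 by (simp add: AE_completion_iff)
  have low': "AE x in lborel. x \<in> \<Omega> \<and> infdist x (frontier \<Omega>) < \<rho> \<longrightarrow> c1 * infdist x (frontier \<Omega>) powr (- \<beta>) \<le> f x"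
    using low by (simp add: AE_completion_iff)
  have vAE: "AE x in lborel. x \<in> \<Omega> \<longrightarrow> u0 x powr \<gamma> = u x powr \<gamma>" using u0u by eventually_elim auto
  have vm: "(\<lambda>x. u0 x powr \<gamma>) \<in> borel_measurable borel" by measurable
  have vout: "u0 x powr \<gamma> = 0" if "x \<notin> \<Omega>" for x using u0out[OF that] by simp
  obtain M where M: "M \<ge> 0" and hardy: "\<forall>S\<in>sets borel. \<forall>z. (\<forall>x\<in>S. x - z \<notin> \<Omega>) \<longrightarrow>
      (\<integral>\<^sup>+x. indicator S x * \<bar>u0 x powr \<gamma>\<bar> powr p \<partial>lborel) \<le> ennreal (M * norm z powr p)"
    using W1p0_hardy[OF \<Omega>(1) \<gamma>(2) p vm vout vAE] by blast
  have vp: "(\<integral>\<^sup>+x. indicator \<Omega> x * norm (u0 x powr \<gamma>) powr p \<partial>lborel) < \<infinity>"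
    using \<gamma>(2) by (intro Lp_representative_finite[OF \<Omega>b _ _ vAE]) (auto simp: W1p0_def)
  \<comment> \<open>Local membership in W^{1,p} gives no integrability up to the boundary. It comes
    from u^\<gamma> in L^p and t \<le> 1 + t^(\<gamma>p), because \<open>\<Omega>\<close> has finite
    measure; mollification on the whole space relies on it.\<close>
  have u0i: "integrable lborel u0"
  proof (rule integrableI_nonneg)
    have "(\<integral>\<^sup>+x. u0 x \<partial>lborel) \<le> (\<integral>\<^sup>+x. indicator \<Omega> x + ennreal (indicator \<Omega> x * norm (u0 x powr \<gamma>) powr p) \<partial>lborel)"
    proof (rule nn_integral_mono)
      fix x
      have "u0 x powr 1 \<le> 1 + u0 x powr (\<gamma> * p)"
        using \<gamma>(1) p mult_mono[of 1 \<gamma> 1 p] by (intro powr_le_1_add_powr u00) auto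
      then have "ennreal (u0 x) \<le> ennreal (1 + u0 x powr (\<gamma> * p))" using u00 by (intro ennreal_leI) simp
      then show "ennreal (u0 x) \<le> indicator \<Omega> x + ennreal (indicator \<Omega> x * norm (u0 x powr \<gamma>) powr p)"
        by (cases "x \<in> \<Omega>") (auto simp: u0out powr_powr)
    qed
    also have "\<dots> = emeasure lborel \<Omega> + (\<integral>\<^sup>+x. indicator \<Omega> x * norm (u0 x powr \<gamma>) powr p \<partial>lborel)"
      by (subst nn_integral_add) auto
    also have "\<dots> < \<infinity>" using vp emeasure_bounded_finite[OF \<Omega>(3)] by simp
    finally show "(\<integral>\<^sup>+x. u0 x \<partial>lborel) < \<infinity>" .
  qed (use u00 in auto)
  show False
  proof (rule no_normalised_solution[OF \<Omega> q s \<delta> \<beta> \<gamma>(1) u0i u00 u0pos D0(1) E0(1) F0(1) _ _ _ _ _ _ _ M _ c1 \<rho>])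
    show "AE x in lborel. F0 x \<ge> 0"
      using F0(3) f0'
    proof eventually_elim
      case (elim x)
      then show ?case by (cases "x \<in> \<Omega>") (auto simp: F0(2))
    qed
    show "(LINT x|lborel. u0 x *\<^sub>R gradient \<phi> x) = - (LINT x|lborel. \<phi> x *\<^sub>R D0 x)" if "\<phi> \<in> test_functions \<Omega>" for \<phi>
      by (rule weak_gradient_representative[OF \<Omega>b Du that u0m u0out u0u D0])
    show "(LINT x|lborel. u0 x *\<^sub>R gradient \<phi> x) = - (LINT x|lborel. \<phi> x *\<^sub>R E0 x)" if "\<phi> \<in> test_functions \<Omega>" for \<phi>
      by (rule weak_gradient_representative[OF \<Omega>b Dg(1) that u0m u0out u0u E0])
    show "(\<integral>\<^sup>+x. indicator (cball c r) x * norm (D0 x) \<partial>lborel) < \<infinity>" if "cball c r \<subseteq> \<Omega>" for c r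
      using Lp_loc_representative_cball[OF _ D0(1,3) that, of 1] Du by (simp add: has_weak_gradient_def)
    show "(\<integral>\<^sup>+x. indicator (cball c r) x * norm (E0 x) powr p \<partial>lborel) < \<infinity>" if "cball c r \<subseteq> \<Omega>" for c r
      by (rule Lp_loc_representative_cball[OF Dg(2) E0(1,3) that])
    show "integrable lborel (\<lambda>x. indicator (cball c r) x * F0 x)" if "cball c r \<subseteq> \<Omega>" for c r
    proof (rule integrableI_bounded)
      have [measurable]: "cball c r \<in> sets borel" by simp
      show "(\<lambda>x. indicator (cball c r) x * F0 x) \<in> borel_measurable lborel" by measurable
      show "(\<integral>\<^sup>+x. norm (indicator (cball c r) x * F0 x) \<partial>lborel) < \<infinity>"
        using Lp_loc_representative_cball[OF fu F0(1,3) that] by (simp add: abs_mult)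
    qed
    show "integrable (lborel \<Otimes>\<^sub>M lborel) (nonlocal_integrand q s u0 \<phi>) \<and>
        (LINT x|lborel. norm (D0 x) powr (p - 2) * (D0 x \<bullet> gradient \<phi> x))
        + (LINT z|(lborel \<Otimes>\<^sub>M lborel). nonlocal_integrand q s u0 \<phi> z) = (LINT x|lborel. F0 x * \<phi> x)"
      if \<phi>: "\<phi> \<in> test_functions \<Omega>" for \<phi>
    proof -
      note [measurable] = test_function_facts(4,5)[OF \<phi>]
      have [measurable]: "\<phi> \<in> borel_measurable (lebesgue_on \<Omega>)" "gradient \<phi> \<in> borel_measurable (lebesgue_on \<Omega>)"
        using test_function_facts(4,5)[OF \<phi>] by (auto intro!: measurable_restrict_space1 measurable_completion)
      have int: "integrable (lebesgue \<Otimes>\<^sub>M lebesgue) (nonlocal_integrand q s u \<phi>)" using eqn[OF \<phi>] by simp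
      have "(LINT x|lebesgue_on \<Omega>. norm (Du x) powr (p - 2) * (Du x \<bullet> gradient \<phi> x))
          = (LINT x|lborel. norm (D0 x) powr (p - 2) * (D0 x \<bullet> gradient \<phi> x))"
      proof (rule integral_lebesgue_on_representative[OF \<Omega>b])
        show "(\<lambda>x. norm (Du x) powr (p - 2) * (Du x \<bullet> gradient \<phi> x)) \<in> borel_measurable (lebesgue_on \<Omega>)" by measurable
        show "AE x in lborel. x \<in> \<Omega> \<longrightarrow> norm (D0 x) powr (p - 2) * (D0 x \<bullet> gradient \<phi> x)
            = norm (Du x) powr (p - 2) * (Du x \<bullet> gradient \<phi> x)"
          using D0(3) by eventually_elim auto
      qed (auto simp: D0(2))
      moreover have "(LINT x|lebesgue_on \<Omega>. f x * u x powr (- \<delta>) * \<phi> x) = (LINT x|lborel. F0 x * \<phi> x)"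
      proof (rule integral_lebesgue_on_representative[OF \<Omega>b])
        show "(\<lambda>x. f x * u x powr (- \<delta>) * \<phi> x) \<in> borel_measurable (lebesgue_on \<Omega>)"
          by (rule borel_measurable_times[OF fum]) measurable
        show "AE x in lborel. x \<in> \<Omega> \<longrightarrow> F0 x * \<phi> x = f x * u x powr (- \<delta>) * \<phi> x"
          using F0(3) by eventually_elim auto
      qed (auto simp: F0(2))
      ultimately show ?thesis
        using nonlocal_representative[OF u0m u0uL test_function_facts(4)[OF \<phi>] int] eqn[OF \<phi>] by simp
    qed
    show "(\<integral>\<^sup>+x. indicator S x * u0 x powr (\<gamma> * p) \<partial>lborel) \<le> ennreal (M * norm z powr p)"
      if "S \<in> sets borel" "S \<subseteq> \<Omega>" "\<And>x. x \<in> S \<Longrightarrow> x - z \<notin> \<Omega>" for S z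
      using hardy that(1,3) by (simp add: powr_powr)
    show "AE x in lborel. x \<in> \<Omega> \<and> infdist x (frontier \<Omega>) < \<rho> \<longrightarrow>
        c1 * infdist x (frontier \<Omega>) powr (- \<beta>) * u0 x powr (- \<delta>) \<le> F0 x"
      using low' F0(3) u0u
    proof eventually_elim
      case (elim x)
      then show ?case by (auto intro!: mult_right_mono)
    qed
  qed
qed

theorem theorem2p30:
  fixes \<Omega> :: "(real ^ 'n) set" and f :: "real ^ 'n \<Rightarrow> real"
    and p q s \<delta> \<beta> c1 c2 \<rho> :: real
  assumes "open \<Omega>" "connected \<Omega>" "\<Omega> \<noteq> {}" "bounded \<Omega>" "Ck_boundary 2 \<Omega>"
    and "1 < q" "q \<le> p" "0 < s" "s < 1" "\<delta> > 0" "\<beta> \<ge> p"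
    and "f \<in> Linf_loc \<Omega>"
    and "AE x in lebesgue. x \<in> \<Omega> \<longrightarrow> f x \<ge> 0"
    and "c1 > 0" "c2 > 0" "\<rho> > 0"
    and "AE x in lebesgue. x \<in> \<Omega> \<and> infdist x (frontier \<Omega>) < \<rho> \<longrightarrow>
           c1 * infdist x (frontier \<Omega>) powr (- \<beta>) \<le> f x \<and>
           f x \<le> c2 * infdist x (frontier \<Omega>) powr (- \<beta>)"
  shows "\<not> (\<exists>u. weak_solution p q s \<delta> \<Omega> f u)"
proof
  assume "\<exists>u. weak_solution p q s \<delta> \<Omega> f u"
  then obtain u where u: "weak_solution p q s \<delta> \<Omega> f u" ..
  have "AE x in lebesgue. x \<in> \<Omega> \<and> infdist x (frontier \<Omega>) < \<rho> \<longrightarrow> c1 * infdist x (frontier \<Omega>) powr (- \<beta>) \<le> f x"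
    using assms(17) by eventually_elim blast
  from no_weak_solution[OF assms(1,3-11,13,14,16) this u] show False .
qed

end
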